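(* Let $p\in(2,6)$, $q\in(2,4)$, $\alpha,\beta>0$, $\varepsilon>0$, and let $V\subset\mathbb V_{\mathcal G_\varepsilon}$ be a finite set ($\#V<+\infty$). Then: (i) if $p\in(2,4)$, then $\mathcal E_{\mathcal G_\varepsilon}(\mu)<0$ and a ground state of $E(\cdot,\mathcal G_\varepsilon)$ in $H^1_\mu(\mathcal G_\varepsilon)$ exists for every $\mu>0$; (ii) if $p\in[4,6)$, then there exists $\overline\mu=\overline\mu(p,q,\alpha,\beta,V,\varepsilon)>0$ such that $\mathcal E_{\mathcal G_\varepsilon}(\mu)=0$ for $\mu\in(0,\overline\mu]$ and $\mathcal E_{\mathcal G_\varepsilon}(\mu)<0$ for $\mu>\overline\mu$; moreover ground states exist for every $\mu>\overline\mu$ and do not exist for any $\mu\in(0,\overline\mu)$.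
   Context: For $\varepsilon>0$, $\mathcal G_\varepsilon$ is the metric graph embedded in $\mathbb R^2$ with vertex set $\mathbb V_{\mathcal G_\varepsilon}=\varepsilon\mathbb Z^2$ and an edge (a segment of length $\varepsilon$) joining every pair of vertices at Euclidean distance $\varepsilon$. $H^1(\mathcal G_\varepsilon)$ is the space of continuous functions $u:\mathcal G_\varepsilon\to\mathbb R$ whose restriction to each edge belongs to $H^1$ of that edge and with $\|u\|_{L^2(\mathcal G_\varepsilon)}^2+\|u'\|_{L^2(\mathcal G_\varepsilon)}^2<\infty$, where $L^r$ norms on $\mathcal G_\varepsilon$ are computed by summing the one-dimensional integrals over all edges. $H^1_\mu(\mathcal G_\varepsilon)=\{u\in H^1(\mathcal G_\varepsilon):\|u\|_{L^2(\mathcal G_\varepsilon)}^2=\mu\}$. For $V\subseteq\mathbb V_{\mathcal G_\varepsilon}$ and $\alpha,\beta>0$, $E(u,\mathcal G_\varepsilon)=\frac12\|u'\|_{L^2(\mathcal G_\varepsilon)}^2-\frac\alpha p\|u\|_{L^p(\mathcal G_\varepsilon)}^p-\frac\beta q\sum_{\mathrm v\in V}|u(\mathrm v)|^q$, and $\mathcal E_{\mathcal G_\varepsilon}(\mu)=\inf_{u\in H^1_\mu(\mathcal G_\varepsilon)}E(u,\mathcal G_\varepsilon)$. A ground state with mass $\mu$ is a $u\in H^1_\mu(\mathcal G_\varepsilon)$ with $E(u,\mathcal G_\varepsilon)=\mathcal E_{\mathcal G_\varepsilon}(\mu)$. *)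

theory Defs
  imports "HOL-Analysis.Analysis"
begin

text \<open>The square-lattice metric graph G_eps.  Vertices are eps*(i,j) with (i,j) in Z^2.
  Edges are indexed by ((i,j), d): for d = True the horizontal edge from eps*(i,j) to
  eps*(i+1,j), for d = False the vertical edge from eps*(i,j) to eps*(i,j+1).
  As a subset of R^2 the graph is the union of all grid lines.\<close>

type_synonym edge = "(int \<times> int) \<times> bool"

definition grid :: "real \<Rightarrow> (real \<times> real) set" where
  "grid eps = {(x, y). (\<exists>k::int. x = eps * of_int k) \<or> (\<exists>k::int. y = eps * of_int k)}"

definition vtx :: "real \<Rightarrow> int \<times> int \<Rightarrow> real \<times> real" where
  "vtx eps v = (eps * of_int (fst v), eps * of_int (snd v))"

definition edge_fun :: "real \<Rightarrow> (real \<times> real \<Rightarrow> real) \<Rightarrow> edge \<Rightarrow> real \<Rightarrow> real" where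
  "edge_fun eps u e t =
     (if snd e then u (eps * of_int (fst (fst e)) + t, eps * of_int (snd (fst e)))
      else u (eps * of_int (fst (fst e)), eps * of_int (snd (fst e)) + t))"

text \<open>f in H^1(a,b) with weak derivative g (f the continuous representative):
  g in L^2(a,b) and f(x) = f(a) + int_a^x g.\<close>
definition h1_deriv :: "real \<Rightarrow> real \<Rightarrow> (real \<Rightarrow> real) \<Rightarrow> (real \<Rightarrow> real) \<Rightarrow> bool" where
  "h1_deriv a b f g \<longleftrightarrow>
     set_integrable lborel {a..b} g \<and>
     set_integrable lborel {a..b} (\<lambda>t. (g t)\<^sup>2) \<and>
     (\<forall>x\<in>{a..b}. f x = f a + set_lebesgue_integral lborel {a..x} g)"

definition h1_interval :: "real \<Rightarrow> real \<Rightarrow> (real \<Rightarrow> real) \<Rightarrow> bool" where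
  "h1_interval a b f \<longleftrightarrow> (\<exists>g. h1_deriv a b f g)"

text \<open>||u'||^2 on one edge (independent of the a.e.-choice of the weak derivative).\<close>
definition edge_dirichlet :: "real \<Rightarrow> (real \<times> real \<Rightarrow> real) \<Rightarrow> edge \<Rightarrow> real" where
  "edge_dirichlet eps u e =
     set_lebesgue_integral lborel {0..eps}
       (\<lambda>t. ((SOME g. h1_deriv 0 eps (edge_fun eps u e) g) t)\<^sup>2)"

definition edge_Lr :: "real \<Rightarrow> real \<Rightarrow> (real \<times> real \<Rightarrow> real) \<Rightarrow> edge \<Rightarrow> real" where
  "edge_Lr eps r u e = set_lebesgue_integral lborel {0..eps} (\<lambda>t. \<bar>edge_fun eps u e t\<bar> powr r)"

definition dirichlet :: "real \<Rightarrow> (real \<times> real \<Rightarrow> real) \<Rightarrow> real" where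
  "dirichlet eps u = infsum (edge_dirichlet eps u) UNIV"

definition Lr_pow :: "real \<Rightarrow> real \<Rightarrow> (real \<times> real \<Rightarrow> real) \<Rightarrow> real" where
  "Lr_pow eps r u = infsum (edge_Lr eps r u) UNIV"

definition H1 :: "real \<Rightarrow> (real \<times> real \<Rightarrow> real) set" where
  "H1 eps = {u. continuous_on (grid eps) u \<and>
                (\<forall>e. h1_interval 0 eps (edge_fun eps u e)) \<and>
                edge_Lr eps 2 u summable_on UNIV \<and>
                edge_dirichlet eps u summable_on UNIV}"

definition H1_mass :: "real \<Rightarrow> real \<Rightarrow> (real \<times> real \<Rightarrow> real) set" where
  "H1_mass eps \<mu> = {u \<in> H1 eps. Lr_pow eps 2 u = \<mu>}"

definition energy ::
  "real \<Rightarrow> real \<Rightarrow> real \<Rightarrow> real \<Rightarrow> real \<Rightarrow> (int \<times> int) set \<Rightarrow> (real \<times> real \<Rightarrow> real) \<Rightarrow> real" where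
  "energy p q \<alpha> \<beta> eps V u =
     dirichlet eps u / 2 - \<alpha> / p * Lr_pow eps p u
       - \<beta> / q * (\<Sum>v\<in>V. \<bar>u (vtx eps v)\<bar> powr q)"

definition ground_level ::
  "real \<Rightarrow> real \<Rightarrow> real \<Rightarrow> real \<Rightarrow> real \<Rightarrow> (int \<times> int) set \<Rightarrow> real \<Rightarrow> real" where
  "ground_level p q \<alpha> \<beta> eps V \<mu> = (INF u\<in>H1_mass eps \<mu>. energy p q \<alpha> \<beta> eps V u)"

definition ground_state ::
  "real \<Rightarrow> real \<Rightarrow> real \<Rightarrow> real \<Rightarrow> real \<Rightarrow> (int \<times> int) set \<Rightarrow> real \<Rightarrow> (real \<times> real \<Rightarrow> real) \<Rightarrow> bool" where
  "ground_state p q \<alpha> \<beta> eps V \<mu> u \<longleftrightarrow>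
     u \<in> H1_mass eps \<mu> \<and> energy p q \<alpha> \<beta> eps V u = ground_level p q \<alpha> \<beta> eps V \<mu>"

end

theory Submission
  imports Defs "HOL-Complex_Analysis.Great_Picard"
begin

text \<open>A negative level is attained: weak limits of minimizing sequences exist edge by edge, and since
  \<open>E(\<lambda> u) < \<lambda>\<^sup>2 E(u)\<close> for \<open>\<lambda> > 1\<close> and nonzero \<open>u\<close>, a nonzero limit must carry the whole mass by the Brezis-Lieb
  splitting. A zero limit makes the point terms vanish; then the energy without them has the same level, it
  is invariant under lattice translations, and a translated sequence has a nonzero limit because functions
  of small sup norm cannot have negative energy.

  The sign of the level is a matter of scaling. Spread over distance \<open>R\<close>, a function of mass \<open>\<mu>\<close> has Dirichlet energy of
  order \<open>R\<close> to the power \<open>-2\<close> and \<open>p\<close>-term of order \<open>R\<close> to the power \<open>2 - p\<close>, so the level is nonpositive, and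
  negative for \<open>p < 4\<close>. For \<open>p \<ge> 4\<close> the two-dimensional Gagliardo-Nirenberg inequality on the lattice of vertices bounds both
  nonlinear terms by the Dirichlet energy times a factor that vanishes with the mass.\<close>

section \<open>Weak compactness in L2\<close>

text \<open>The delicate case is small mass with p at least 4: both nonlinear terms must be bounded
  linearly by the Dirichlet energy \<open>D u\<close>, whether it is small or large. For
  \<open>D u\<close> at least 1 the grid behaves one-dimensionally: \<open>u\<close> squared is at
  most a multiple of \<open>sqrt (mass u * D u)\<close>, so the terms grow like \<open>D u\<close>
  to the powers (p - 2)/4 and q/4, both below 1 because p < 6 and q < 4; the same exponents give
  coercivity. For \<open>D u\<close> below 1 such powers are too large and the planar geometry has
  to enter. An l4 bound on the vertex values settles the p-term, but for a single vertex value it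
  yields only the power q/4. Hence the lattice inequality is proved for all even powers, which give
  powers of \<open>D u\<close> approaching q/2 > 1.

  One comparison, \<open>E_ge_mass_fraction\<close>, serves three ends: it excludes splitting of
  mass, carries negativity of the level to larger masses, and rules out ground states below the
  critical mass.

  Compactness combines a weak limit of derivatives with limits at vertices, so minimizing sequences
  converge at every point of the grid.\<close>

definition L2 :: "'a measure \<Rightarrow> ('a \<Rightarrow> real) set" where
  "L2 M = {f \<in> borel_measurable M. integrable M (\<lambda>x. (f x)\<^sup>2)}"

lemma sum_squared_le: "(x + y)\<^sup>2 \<le> 2 * x\<^sup>2 + 2 * y\<^sup>2" for x y :: real
  using zero_le_power2[of "x - y"] by (simp add: power2_eq_square algebra_simps)

text \<open>\<open>L2\<close> consists of functions rather than classes modulo null sets, so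
  \<open>sqnorm\<close> is only a seminorm there; limits and uniqueness are phrased through a
  vanishing \<open>sqnorm\<close> or equality almost everywhere.\<close>

definition ip :: "'a measure \<Rightarrow> ('a \<Rightarrow> real) \<Rightarrow> ('a \<Rightarrow> real) \<Rightarrow> real" where
  "ip M f g = (\<integral>x. f x * g x \<partial>M)"

abbreviation sqnorm :: "'a measure \<Rightarrow> ('a \<Rightarrow> real) \<Rightarrow> real" where
  "sqnorm M f \<equiv> ip M f f"

lemma L2_measurable [measurable_dest]: "f \<in> L2 M \<Longrightarrow> f \<in> borel_measurable M"
  by (simp add: L2_def)

lemma L2_square_integrable: "f \<in> L2 M \<Longrightarrow> integrable M (\<lambda>x. (f x)\<^sup>2)"
  by (simp add: L2_def)

lemma abs_mult_le_squares: "\<bar>a * b\<bar> \<le> a\<^sup>2 + b\<^sup>2" for a b :: real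
proof -
  have "0 \<le> (\<bar>a\<bar> - \<bar>b\<bar>)\<^sup>2" by simp
  then have "2 * \<bar>a * b\<bar> \<le> a\<^sup>2 + b\<^sup>2" by (simp add: power2_diff abs_mult)
  then show ?thesis using abs_ge_zero[of "a * b"] by linarith
qed

lemma L2_mult_integrable:
  assumes "f \<in> L2 M" "g \<in> L2 M" shows "integrable M (\<lambda>x. f x * g x)"
proof (rule Bochner_Integration.integrable_bound)
  show "integrable M (\<lambda>x. (f x)\<^sup>2 + (g x)\<^sup>2)"
    using assms L2_square_integrable by (intro Bochner_Integration.integrable_add)
  show "(\<lambda>x. f x * g x) \<in> borel_measurable M" using assms by (auto dest!: L2_measurable)
qed (use abs_mult_le_squares in \<open>auto simp: abs_mult\<close>)

lemma L2_scale: "f \<in> L2 M \<Longrightarrow> (\<lambda>x. c * f x) \<in> L2 M"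
  by (auto simp: L2_def power_mult_distrib)

lemma L2_add:
  assumes "f \<in> L2 M" "g \<in> L2 M" shows "(\<lambda>x. f x + g x) \<in> L2 M"
proof -
  have "integrable M (\<lambda>x. (f x)\<^sup>2 + (g x)\<^sup>2 + 2 * (f x * g x))"
    using assms L2_square_integrable L2_mult_integrable by (intro Bochner_Integration.integrable_add) auto
  then show ?thesis using assms by (auto simp: L2_def power2_sum mult.assoc)
qed

lemma L2_diff:
  assumes "f \<in> L2 M" "g \<in> L2 M" shows "(\<lambda>x. f x - g x) \<in> L2 M"
  using L2_add[OF assms(1) L2_scale[OF assms(2), of "-1"]] by simp

lemma L2_abs: "f \<in> L2 M \<Longrightarrow> (\<lambda>x. \<bar>f x\<bar>) \<in> L2 M"
  by (auto simp: L2_def)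

lemma ip_commute: "ip M f g = ip M g f" by (simp add: ip_def mult.commute)

lemma ip_self: "sqnorm M f = (\<integral>x. (f x)\<^sup>2 \<partial>M)" by (simp add: ip_def power2_eq_square)

lemma ip_self_nonneg: "0 \<le> sqnorm M f" unfolding ip_self by simp

lemma ip_scale_left: "ip M (\<lambda>x. c * f x) g = c * ip M f g"
  by (simp add: ip_def mult.assoc)

lemma ip_add_left:
  "f \<in> L2 M \<Longrightarrow> g \<in> L2 M \<Longrightarrow> h \<in> L2 M \<Longrightarrow> ip M (\<lambda>x. f x + g x) h = ip M f h + ip M g h"
  using L2_mult_integrable[of f M h] L2_mult_integrable[of g M h] by (simp add: ip_def ring_distribs)

lemma ip_diff_left:
  "f \<in> L2 M \<Longrightarrow> g \<in> L2 M \<Longrightarrow> h \<in> L2 M \<Longrightarrow> ip M (\<lambda>x. f x - g x) h = ip M f h - ip M g h"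
  using L2_mult_integrable[of f M h] L2_mult_integrable[of g M h] by (simp add: ip_def ring_distribs)

lemma ip_scale_right: "ip M g (\<lambda>x. c * f x) = c * ip M g f"
  by (simp only: ip_commute[of M g] ip_scale_left)

lemma ip_add_right:
  "f \<in> L2 M \<Longrightarrow> g \<in> L2 M \<Longrightarrow> h \<in> L2 M \<Longrightarrow> ip M h (\<lambda>x. f x + g x) = ip M h f + ip M h g"
  by (simp only: ip_commute[of M h] ip_add_left)

lemma ip_diff_right:
  "f \<in> L2 M \<Longrightarrow> g \<in> L2 M \<Longrightarrow> h \<in> L2 M \<Longrightarrow> ip M h (\<lambda>x. f x - g x) = ip M h f - ip M h g"
  by (simp only: ip_commute[of M h] ip_diff_left)

lemma ip_diff_self:
  assumes "f \<in> L2 M" "g \<in> L2 M"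
  shows "sqnorm M (\<lambda>x. f x - g x) = sqnorm M f - 2 * ip M f g + sqnorm M g"
  using assms by (simp add: ip_diff_left ip_diff_right L2_diff ip_commute[of M g f])

text \<open>The squared norm of \<open>f - t g\<close> is a nonnegative polynomial in
  \<open>t\<close>, evaluated at its minimizer. If \<open>g\<close> is null the polynomial is affine
  and has to be constant.\<close>

lemma ip_Cauchy_Schwarz:
  assumes "f \<in> L2 M" "g \<in> L2 M" shows "(ip M f g)\<^sup>2 \<le> sqnorm M f * sqnorm M g"
proof -
  have *: "0 \<le> sqnorm M f - 2 * t * ip M f g + t\<^sup>2 * sqnorm M g" for t
    using ip_self_nonneg[of M "\<lambda>x. f x - t * g x"] assms
    by (simp add: ip_diff_self L2_scale ip_scale_left ip_scale_right power2_eq_square mult.assoc)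
  show ?thesis
  proof (cases "sqnorm M g = 0")
    case True
    have "ip M f g = 0"
    proof (rule ccontr)
      assume "ip M f g \<noteq> 0"
      \<comment> \<open>At this \<open>t\<close> the affine polynomial has the value -1.\<close>
      then show False
        using *[of "(sqnorm M f + 1) / (2 * ip M f g)"] True by simp
    qed
    then show ?thesis using True by simp
  next
    case False
    then have "sqnorm M g > 0" using ip_self_nonneg[of M g] by linarith
    then show ?thesis using *[of "ip M f g / sqnorm M g"]
      by (simp add: field_simps power2_eq_square)
  qed
qed

lemma ip_Cauchy_Schwarz_sqrt:
  assumes "f \<in> L2 M" "g \<in> L2 M" shows "\<bar>ip M f g\<bar> \<le> sqrt (sqnorm M f) * sqrt (sqnorm M g)"
  using real_le_rsqrt[OF ip_Cauchy_Schwarz[OF assms]]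
  by (metis ip_Cauchy_Schwarz[OF assms] real_sqrt_abs real_sqrt_le_mono real_sqrt_mult)

lemma ip_bound:
  assumes "f \<in> L2 M" "g \<in> L2 M" "sqnorm M f \<le> C" "sqnorm M g \<le> D"
  shows "\<bar>ip M f g\<bar> \<le> sqrt C * sqrt D"
proof -
  have "\<bar>ip M f g\<bar> \<le> sqrt (sqnorm M f) * sqrt (sqnorm M g)" using assms by (intro ip_Cauchy_Schwarz_sqrt)
  also have "\<dots> \<le> sqrt C * sqrt D" using assms ip_self_nonneg
    by (intro mult_mono) (auto intro: order_trans)
  finally show ?thesis .
qed

text \<open>Weighting the squared increments by \<open>2^k\<close> still leaves a convergent sum of
  integrals, so the weighted sum of squares is finite almost everywhere; there the increments are
  absolutely summable and the sequence telescopes.\<close>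

lemma L2_fast_Cauchy_AE_convergent:
  fixes f :: "nat \<Rightarrow> 'a \<Rightarrow> real"
  assumes f: "\<And>n. f n \<in> L2 M"
    and fast: "\<And>k. sqnorm M (\<lambda>x. f (Suc k) x - f k x) \<le> (1/4)^k"
  shows "AE x in M. convergent (\<lambda>n. f n x)"
proof -
  note [measurable] = L2_measurable[OF f]
  define d where "d k x = f (Suc k) x - f k x" for k x
  have [measurable]: "d k \<in> borel_measurable M" for k unfolding d_def by measurable
  have dL: "d k \<in> L2 M" for k unfolding d_def using f by (intro L2_diff)
  have "(\<integral>\<^sup>+x. (\<Sum>k. ennreal (2^k * (d k x)\<^sup>2)) \<partial>M) = (\<Sum>k. \<integral>\<^sup>+x. ennreal (2^k * (d k x)\<^sup>2) \<partial>M)"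
    by (intro nn_integral_suminf) measurable
  also have "\<dots> \<le> (\<Sum>k. ennreal ((1/2)^k))"
  proof (rule suminf_le)
    fix k
    have "(\<integral>\<^sup>+x. ennreal (2^k * (d k x)\<^sup>2) \<partial>M) = ennreal (\<integral>x. 2^k * (d k x)\<^sup>2 \<partial>M)"
      using L2_square_integrable[OF dL] by (intro nn_integral_eq_integral) auto
    also have "(\<integral>x. 2^k * (d k x)\<^sup>2 \<partial>M) = 2^k * sqnorm M (d k)" by (simp add: ip_self)
    also have "\<dots> \<le> 2^k * (1/4)^k"
      using fast[of k] unfolding d_def by (intro mult_left_mono) auto
    also have "\<dots> = (1/2)^k" unfolding power_mult_distrib[symmetric] by simp
    finally show "(\<integral>\<^sup>+x. ennreal (2^k * (d k x)\<^sup>2) \<partial>M) \<le> ennreal ((1/2)^k)"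
      by (simp add: ennreal_leI)
  qed auto
  also have "\<dots> = ennreal (\<Sum>k. (1/2)^k)" by (intro suminf_ennreal2) (auto simp: summable_geometric)
  also have "\<dots> < \<infinity>" by simp
  finally have "AE x in M. (\<Sum>k. ennreal (2^k * (d k x)\<^sup>2)) \<noteq> \<infinity>"
    by (intro nn_integral_PInf_AE) auto
  then show ?thesis
  proof eventually_elim
    case (elim x)
    have s1: "summable (\<lambda>k. 2^k * (d k x)\<^sup>2)"
      using elim by (intro summable_suminf_not_top) auto
    have s2: "summable (\<lambda>k. (1/2)^k :: real)" by (simp add: summable_geometric)
    have "summable (\<lambda>k. d k x)"
    proof (rule summable_comparison_test')
      show "summable (\<lambda>k. (1/2)^k + 2^k * (d k x)\<^sup>2)" using summable_add[OF s2 s1] .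
      fix k
      \<comment> \<open>Young's inequality with weight \<open>2^k\<close>, obtained by expanding a
        square.\<close>
      have "0 \<le> 2^k * (\<bar>d k x\<bar> - (1/2)^k)\<^sup>2" by simp
      also have "\<dots> = 2^k * (d k x)\<^sup>2 - 2 * (2^k * (1/2)^k) * \<bar>d k x\<bar> + (2^k * (1/2)^k) * (1/2)^k"
        by (simp only: power2_diff power2_abs) (simp only: power2_eq_square algebra_simps)
      also have "2^k * (1/2)^k = (1::real)" unfolding power_mult_distrib[symmetric] by simp
      finally have "2 * \<bar>d k x\<bar> \<le> (1/2)^k + 2^k * (d k x)\<^sup>2" by simp
      then show "norm (d k x) \<le> (1/2)^k + 2^k * (d k x)\<^sup>2" by simp
    qed
    then have "summable (\<lambda>k. f (Suc k) x - f k x)" by (simp add: d_def)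
    then have "convergent (\<lambda>n. \<Sum>k<n. f (Suc k) x - f k x)" by (simp add: summable_iff_convergent)
    then have "convergent (\<lambda>n. (f n x - f 0 x) + f 0 x)"
      by (subst (asm) sum_lessThan_telescope) (intro convergent_add convergent_const)
    then show ?case by simp
  qed
qed

text \<open>A rapidly Cauchy subsequence converges almost everywhere, and Fatou's lemma upgrades
  this to convergence in norm of the whole sequence.\<close>

lemma L2_complete:
  fixes f :: "nat \<Rightarrow> 'a \<Rightarrow> real"
  assumes f: "\<And>n. f n \<in> L2 M"
    and C: "\<And>e. e > 0 \<Longrightarrow> \<exists>N. \<forall>m\<ge>N. \<forall>n\<ge>N. sqnorm M (\<lambda>x. f m x - f n x) < e"
  shows "\<exists>g\<in>L2 M. (\<lambda>n. sqnorm M (\<lambda>x. f n x - g x)) \<longlonglongrightarrow> 0"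
proof -
  note [measurable] = L2_measurable[OF f]
  define N where "N k = (SOME N. \<forall>m\<ge>N. \<forall>n\<ge>N. sqnorm M (\<lambda>x. f m x - f n x) < (1/4)^k)" for k :: nat
  have N: "sqnorm M (\<lambda>x. f m x - f n x) < (1/4)^k" if "m \<ge> N k" "n \<ge> N k" for m n k
    using someI_ex[OF C[of "(1/4)^k"]] that unfolding N_def by auto
  \<comment> \<open>The sum makes \<open>r\<close> nondecreasing and at least \<open>N k\<close>;
    the extra \<open>k\<close> makes it tend to infinity.\<close>
  define r where "r k = (\<Sum>i\<le>k. N i) + k" for k
  have rN: "r k \<ge> N k" for k unfolding r_def
    by (metis atMost_iff finite_atMost le_refl member_le_sum trans_le_add1 zero_le)
  have rr: "r (Suc k) \<ge> r k" for k unfolding r_def by simp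
  have rk: "r k \<ge> k" for k unfolding r_def by simp
  have ae: "AE x in M. convergent (\<lambda>k. f (r k) x)"
  proof (intro L2_fast_Cauchy_AE_convergent f less_imp_le[OF N])
    show "N k \<le> r (Suc k)" for k using rN[of k] rr[of k] by linarith
  qed (rule rN)
  define g where "g x = lim (\<lambda>k. f (r k) x)" for x
  have [measurable]: "g \<in> borel_measurable M" unfolding g_def by (intro borel_measurable_lim_metric) auto
  have lim: "AE x in M. (\<lambda>k. f (r k) x) \<longlonglongrightarrow> g x"
    using ae by eventually_elim (simp add: g_def convergent_LIMSEQ_iff)
  have key: "(\<integral>\<^sup>+x. ennreal ((f n x - g x)\<^sup>2) \<partial>M) \<le> ennreal e" if "e > 0"
    "\<forall>m\<ge>K. \<forall>n\<ge>K. sqnorm M (\<lambda>x. f m x - f n x) < e" "n \<ge> K" for n K e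
  proof -
    have "(\<integral>\<^sup>+x. ennreal ((f n x - g x)\<^sup>2) \<partial>M) = (\<integral>\<^sup>+x. liminf (\<lambda>k. ennreal ((f n x - f (r k) x)\<^sup>2)) \<partial>M)"
    proof (rule nn_integral_cong_AE)
      show "AE x in M. ennreal ((f n x - g x)\<^sup>2) = liminf (\<lambda>k. ennreal ((f n x - f (r k) x)\<^sup>2))"
        using lim
      proof eventually_elim
        case (elim x)
        then have "(\<lambda>k. ennreal ((f n x - f (r k) x)\<^sup>2)) \<longlonglongrightarrow> ennreal ((f n x - g x)\<^sup>2)"
          by (intro tendsto_ennrealI tendsto_intros)
        from lim_imp_Liminf[OF _ this] show ?case by simp
      qed
    qed
    also have "\<dots> \<le> liminf (\<lambda>k. \<integral>\<^sup>+x. ennreal ((f n x - f (r k) x)\<^sup>2) \<partial>M)"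
      by (intro nn_integral_liminf) measurable
    also have "\<dots> \<le> liminf (\<lambda>k. ennreal e)"
    proof (rule Liminf_mono)
      show "\<forall>\<^sub>F k in sequentially. (\<integral>\<^sup>+x. ennreal ((f n x - f (r k) x)\<^sup>2) \<partial>M) \<le> ennreal e"
        using eventually_ge_at_top[of K]
      proof eventually_elim
        case (elim k)
        have "(\<integral>\<^sup>+x. ennreal ((f n x - f (r k) x)\<^sup>2) \<partial>M) = ennreal (sqnorm M (\<lambda>x. f n x - f (r k) x))"
          unfolding ip_self by (intro nn_integral_eq_integral) (auto intro!: L2_square_integrable L2_diff f)
        also have "\<dots> \<le> ennreal e"
          using that rk[of k] elim by (intro ennreal_leI less_imp_le) auto
        finally show ?case .
      qed
    qed
    finally show ?thesis by (simp add: Liminf_const)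
  qed
  obtain K where K: "\<forall>m\<ge>K. \<forall>n\<ge>K. sqnorm M (\<lambda>x. f m x - f n x) < 1" using C[of 1] by auto
  have "(\<lambda>x. f K x - g x) \<in> L2 M"
    using key[of 1 K K] K unfolding L2_def
    by (auto intro!: integrableI_nonneg intro: le_less_trans[OF _ ennreal_one_less_top])
  from L2_diff[OF f[of K] this] have g: "g \<in> L2 M" by simp
  have "(\<lambda>n. sqnorm M (\<lambda>x. f n x - g x)) \<longlonglongrightarrow> 0"
  proof (rule LIMSEQ_I)
    fix e :: real assume "e > 0"
    then obtain K where K: "\<forall>m\<ge>K. \<forall>n\<ge>K. sqnorm M (\<lambda>x. f m x - f n x) < e/2" using C[of "e/2"] by auto
    have "sqnorm M (\<lambda>x. f n x - g x) < e" if "n \<ge> K" for n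
    proof -
      have "ennreal (sqnorm M (\<lambda>x. f n x - g x)) = (\<integral>\<^sup>+x. ennreal ((f n x - g x)\<^sup>2) \<partial>M)"
        unfolding ip_self by (intro nn_integral_eq_integral[symmetric]) (auto intro!: L2_square_integrable L2_diff f g)
      also have "\<dots> \<le> ennreal (e/2)" using key[of "e/2" K n] K that \<open>e > 0\<close> by auto
      finally show ?thesis using \<open>e > 0\<close> by (simp add: ennreal_le_iff)
    qed
    then show "\<exists>no. \<forall>n\<ge>no. norm (sqnorm M (\<lambda>x. f n x - g x) - 0) < e"
      by (intro exI[of _ K]) (simp add: ip_self_nonneg)
  qed
  with g show ?thesis by blast
qed

lemma ip_tendsto_of_norm:
  assumes "\<And>n. f n \<in> L2 M" "g \<in> L2 M" "h \<in> L2 M"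
    and "(\<lambda>n. sqnorm M (\<lambda>x. f n x - g x)) \<longlonglongrightarrow> 0"
  shows "(\<lambda>n. ip M (f n) h) \<longlonglongrightarrow> ip M g h"
proof -
  have "(\<lambda>n. ip M (f n) h - ip M g h) \<longlonglongrightarrow> 0"
  proof (rule Lim_null_comparison)
    show "\<forall>\<^sub>F n in sequentially. norm (ip M (f n) h - ip M g h) \<le>
        sqrt (sqnorm M (\<lambda>x. f n x - g x)) * sqrt (sqnorm M h)"
      using ip_Cauchy_Schwarz_sqrt[OF L2_diff[OF assms(1,2)] assms(3)] assms
      by (auto simp: ip_diff_left)
    show "(\<lambda>n. sqrt (sqnorm M (\<lambda>x. f n x - g x)) * sqrt (sqnorm M h)) \<longlonglongrightarrow> 0"
      using tendsto_mult[OF tendsto_real_sqrt[OF assms(4)] tendsto_const[of "sqrt (sqnorm M h)"]] by simp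
  qed
  then show ?thesis by (simp add: LIM_zero_iff)
qed

text \<open>The tail hulls below are closed convex hulls, written as intersections of half-spaces; their
  almost minimal elements form a Cauchy sequence by the parallelogram law.\<close>

lemma L2_weak_cluster_point:
  fixes g :: "nat \<Rightarrow> 'a \<Rightarrow> real"
  assumes g: "\<And>n. g n \<in> L2 M" and bd: "\<And>n. sqnorm M (g n) \<le> C"
  shows "\<exists>h\<in>L2 M. \<forall>f\<in>L2 M. \<forall>l. (\<lambda>n. ip M (g n) f) \<longlonglongrightarrow> l \<longrightarrow> ip M h f = l"
proof -
  define K where "K N = {h\<in>L2 M. \<forall>f\<in>L2 M. \<forall>a. (\<forall>n\<ge>N. ip M (g n) f \<le> a) \<longrightarrow> ip M h f \<le> a}" for N :: nat
  define d where "d N = (INF h\<in>K N. sqnorm M h)" for N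
  have gK: "g n \<in> K N" if "n \<ge> N" for n N unfolding K_def using g that by auto
  have anti: "K N' \<subseteq> K N" if "N \<le> N'" for N N' unfolding K_def using that by (auto intro: order_trans)
  have bdd: "bdd_below ((\<lambda>h. sqnorm M h) ` K N)" for N
    by (intro bdd_belowI2[of _ 0]) (rule ip_self_nonneg)
  have dle: "d N \<le> sqnorm M h" if "h \<in> K N" for h N
    unfolding d_def using bdd that by (rule cINF_lower)
  have dC: "d N \<le> C" for N using dle[OF gK[OF order_refl]] bd order_trans by blast
  have dmono: "d N \<le> d N'" if "N \<le> N'" for N N'
    unfolding d_def using gK[of N' N'] anti[OF that] bdd by (intro cINF_superset_mono) auto
  have "\<exists>h. h \<in> K N \<and> sqnorm M h < d N + 1 / real (Suc N)" for N
    using cINF_less_iff[OF _ bdd, of N "d N + 1 / real (Suc N)"] gK[of N N] unfolding d_def by auto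
  then obtain h where hK: "\<And>N. h N \<in> K N" and hd: "\<And>N. sqnorm M (h N) < d N + 1 / real (Suc N)" by metis
  have hL: "h N \<in> L2 M" for N using hK unfolding K_def by auto
  have "incseq d" using dmono by (simp add: incseq_def)
  then obtain dl where dl: "d \<longlonglongrightarrow> dl" using incseq_convergent[of d C] dC by blast
  have ddl: "d N \<le> dl" for N using incseq_le[OF \<open>incseq d\<close> dl] .
  \<comment> \<open>The midpoint of \<open>h m\<close> and \<open>h n\<close> stays in
    \<open>K N\<close>, so its squared norm is at least \<open>d N\<close>, while those of
    \<open>h m\<close> and \<open>h n\<close> are at most \<open>dl + 1 / (N + 1)\<close>; hence the
    two are close.\<close>
  have par: "sqnorm M (\<lambda>x. h m x - h n x) \<le> 4 * (dl - d N + 1 / real (Suc N))"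
    if mn: "m \<ge> N" "n \<ge> N" for m n N
  proof -
    define c :: real where "c = 1/2"
    define mid where "mid x = c * h m x + c * h n x" for x
    have "mid \<in> K N"
    proof -
      have "mid \<in> L2 M" unfolding mid_def by (intro L2_add L2_scale hL)
      moreover have "ip M mid f \<le> a" if f: "f \<in> L2 M" "\<forall>n\<ge>N. ip M (g n) f \<le> a" for f a
      proof -
        have "ip M (h m) f \<le> a" "ip M (h n) f \<le> a"
          using hK[of m] hK[of n] anti[OF mn(1)] anti[OF mn(2)] f unfolding K_def by auto
        moreover have "ip M mid f = c * ip M (h m) f + c * ip M (h n) f"
          unfolding mid_def using f hL by (simp add: ip_add_left L2_scale ip_scale_left)
        ultimately show ?thesis by (simp add: c_def)
      qed
      ultimately show ?thesis unfolding K_def by auto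
    qed
    then have "d N \<le> sqnorm M mid" by (rule dle)
    also have "sqnorm M mid = c * (c * sqnorm M (h m) + c * ip M (h m) (h n)) + c * (c * ip M (h m) (h n) + c * sqnorm M (h n))"
      unfolding mid_def using hL
      by (simp add: ip_add_left ip_add_right L2_scale L2_add ip_scale_left ip_scale_right ip_commute[of M "h n" "h m"])
    also have "\<dots> = (sqnorm M (h m) + sqnorm M (h n) + 2 * ip M (h m) (h n)) / 4"
      by (simp add: c_def field_simps)
    finally have "- 2 * ip M (h m) (h n) \<le> sqnorm M (h m) + sqnorm M (h n) - 4 * d N" by simp
    then have "sqnorm M (\<lambda>x. h m x - h n x) \<le> 2 * sqnorm M (h m) + 2 * sqnorm M (h n) - 4 * d N"
      using hL by (simp add: ip_diff_self)
    moreover have "sqnorm M (h k) \<le> dl + 1 / real (Suc N)" if "k \<ge> N" for k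
    proof -
      have "1 / real (Suc k) \<le> 1 / real (Suc N)" using that by (simp add: frac_le)
      then show ?thesis using hd[of k] ddl[of k] by linarith
    qed
    ultimately show ?thesis using mn by (smt (verit) field_sum_of_halves)
  qed
  have "\<exists>N. \<forall>m\<ge>N. \<forall>n\<ge>N. sqnorm M (\<lambda>x. h m x - h n x) < e" if "e > 0" for e
  proof -
    have "(\<lambda>N. 4 * (dl - d N + 1 / real (Suc N))) \<longlonglongrightarrow> 4 * (dl - dl + 0)"
      by (intro tendsto_intros dl LIMSEQ_Suc[OF lim_1_over_n])
    then have "\<forall>\<^sub>F N in sequentially. 4 * (dl - d N + 1 / real (Suc N)) < e"
      using that by (intro order_tendstoD(2)) auto
    then obtain N where "4 * (dl - d N + 1 / real (Suc N)) < e" by (auto simp: eventually_sequentially)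
    then show ?thesis using par by (meson le_less_trans)
  qed
  from L2_complete[OF hL this] obtain k where k: "k \<in> L2 M"
    "(\<lambda>n. sqnorm M (\<lambda>x. h n x - k x)) \<longlonglongrightarrow> 0" by auto
  \<comment> \<open>Pairings converging to \<open>l\<close> are eventually at most
    \<open>l + e\<close>, which is one of the half-space conditions defining
    \<open>K N\<close>.\<close>
  have le: "ip M k f \<le> l" if f: "f \<in> L2 M" "(\<lambda>n. ip M (g n) f) \<longlonglongrightarrow> l" for f l
  proof (rule field_le_epsilon)
    fix e :: real assume "e > 0"
    then have "\<forall>\<^sub>F n in sequentially. ip M (g n) f < l + e" using f(2) by (intro order_tendstoD(2)) auto
    then obtain N where "\<forall>n\<ge>N. ip M (g n) f < l + e" by (auto simp: eventually_sequentially)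
    then have N: "\<And>n. n \<ge> N \<Longrightarrow> ip M (g n) f \<le> l + e" by (simp add: less_imp_le)
    have "ip M (h n) f \<le> l + e" if "n \<ge> N" for n
      using hK[of n] N that f(1) unfolding K_def by auto
    then show "ip M k f \<le> l + e"
      using ip_tendsto_of_norm[OF hL k(1) f(1) k(2)] by (intro LIMSEQ_le_const2) auto
  qed
  have "ip M k f = l" if f: "f \<in> L2 M" "(\<lambda>n. ip M (g n) f) \<longlonglongrightarrow> l" for f l
  proof (rule antisym)
    show "ip M k f \<le> l" using f by (rule le)
    have "ip M k (\<lambda>x. -1 * f x) \<le> - l"
    proof (rule le)
      show "(\<lambda>n. ip M (g n) (\<lambda>x. - 1 * f x)) \<longlonglongrightarrow> - l"
        unfolding ip_scale_right using tendsto_mult_left[OF f(2), of "-1"] by simp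
    qed (intro L2_scale f)
    then show "l \<le> ip M k f" unfolding ip_scale_right by simp
  qed
  then show ?thesis using k(1) by blast
qed

text \<open>The diagonal selection tests only against the members \<open>g m\<close> of the sequence
  itself, which take the place of a countable dense set. Any two weak cluster points then agree
  against every \<open>g m\<close>, and this already forces them to agree against every test
  function, so a subsequence that stays away from the limit is impossible.\<close>

lemma L2_weak_compactness:
  fixes g :: "nat \<Rightarrow> 'a \<Rightarrow> real"
  assumes g: "\<And>n. g n \<in> L2 M" and bd: "\<And>n. sqnorm M (g n) \<le> C"
  shows "\<exists>r h. strict_mono r \<and> h \<in> L2 M \<and> (\<forall>f\<in>L2 M. (\<lambda>n. ip M (g (r n)) f) \<longlonglongrightarrow> ip M h f)"
proof -
  have "\<exists>r :: nat \<Rightarrow> nat. strict_mono r \<and> (\<forall>m. \<exists>l. (\<lambda>n. ip M (g (r n)) (g m)) \<longlonglongrightarrow> l)"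
  proof (rule function_convergent_subsequence[of "UNIV :: nat set" "\<lambda>n m. ip M (g n) (g m)" "sqrt C * sqrt C"])
    show "norm (ip M (g n) (g m)) \<le> sqrt C * sqrt C" for n m
      using ip_bound[OF g g bd bd] by simp
    fix k :: "nat \<Rightarrow> nat"
    assume "strict_mono k" "\<And>x. x \<in> UNIV \<Longrightarrow> \<exists>l. (\<lambda>n. ip M (g (k n)) (g x)) \<longlonglongrightarrow> l"
    then show ?thesis by (intro exI[of _ k] conjI allI) simp_all
  qed simp
  then obtain r :: "nat \<Rightarrow> nat" where r: "strict_mono r" and b: "\<forall>m. \<exists>l. (\<lambda>n. ip M (g (r n)) (g m)) \<longlonglongrightarrow> l"
    by (elim exE conjE)
  obtain h where h: "h \<in> L2 M" and hl: "\<And>f l. f \<in> L2 M \<Longrightarrow> (\<lambda>n. ip M (g (r n)) f) \<longlonglongrightarrow> l \<Longrightarrow> ip M h f = l"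
    using L2_weak_cluster_point[of "\<lambda>n. g (r n)", OF g bd] by blast
  have "(\<lambda>n. ip M (g (r n)) f) \<longlonglongrightarrow> ip M h f" if f: "f \<in> L2 M" for f
  proof (rule ccontr)
    assume "\<not> ?thesis"
    then obtain e where e: "e > 0" "\<exists>\<^sub>F n in sequentially. \<not> dist (ip M (g (r n)) f) (ip M h f) < e"
      by (auto simp: tendsto_iff not_eventually)
    define S where "S = {n. \<not> dist (ip M (g (r n)) f) (ip M h f) < e}"
    have inf: "infinite S" using e(2) unfolding S_def by (simp add: frequently_cofinite flip: cofinite_eq_sequentially)
    define s where "s = enumerate S"
    have s: "strict_mono s" "\<And>n. s n \<in> S"
      using inf unfolding s_def by (auto simp: strict_mono_enumerate enumerate_in_set)
    have "bounded (range (\<lambda>n. ip M (g (r (s n))) f))"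
      using ip_bound[OF g f bd order_refl] by (auto simp: bounded_iff)
    from bounded_imp_convergent_subsequence[OF this]
    obtain l t where t: "strict_mono t" "((\<lambda>n. ip M (g (r (s n))) f) \<circ> t) \<longlonglongrightarrow> l" by auto
    obtain h' where h': "h' \<in> L2 M" and hl': "\<And>f l. f \<in> L2 M \<Longrightarrow> (\<lambda>n. ip M (g (r (s (t n)))) f) \<longlonglongrightarrow> l \<Longrightarrow> ip M h' f = l"
      using L2_weak_cluster_point[of "\<lambda>n. g (r (s (t n)))", OF g bd] by blast
    have eq: "ip M h (g m) = ip M h' (g m)" for m
    proof -
      obtain l where l: "(\<lambda>n. ip M (g (r n)) (g m)) \<longlonglongrightarrow> l" using b by blast
      have "(\<lambda>n. ip M (g (r (s (t n)))) (g m)) \<longlonglongrightarrow> l"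
        using LIMSEQ_subseq_LIMSEQ[OF l strict_mono_o[OF s(1) t(1)]] by (simp add: o_def)
      then show ?thesis using hl[OF g l] hl'[OF g] by simp
    qed
    define D where "D x = h x - h' x" for x
    have D: "D \<in> L2 M" unfolding D_def using h h' by (intro L2_diff)
    \<comment> \<open>Orthogonality to every \<open>g m\<close> passes to the weak cluster points
      \<open>h\<close> and \<open>h'\<close>, so \<open>D\<close> is orthogonal to its own two terms
      and has norm zero.\<close>
    have orth: "ip M (g m) D = 0" for m
      using eq[of m] h h' g[of m] unfolding D_def by (simp add: ip_diff_right) (simp add: ip_commute)
    have "ip M h D = 0" "ip M h' D = 0" using hl[OF D] hl'[OF D] orth by auto
    then have "sqnorm M D = 0" using h h' D unfolding D_def[abs_def] by (simp add: ip_diff_left)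
    then have "ip M D f = 0" using ip_Cauchy_Schwarz[OF D f] by simp
    then have "ip M h f = ip M h' f" using h h' f unfolding D_def[abs_def] by (simp add: ip_diff_left)
    moreover have "ip M h' f = l" using hl'[OF f] t(2) by (simp add: o_def)
    ultimately have "(\<lambda>n. ip M (g (r (s (t n)))) f) \<longlonglongrightarrow> ip M h f" using t(2) by (simp add: o_def)
    then have "\<forall>\<^sub>F n in sequentially. dist (ip M (g (r (s (t n)))) f) (ip M h f) < e"
      using e(1) by (auto simp: tendsto_iff)
    then show False using s(2) unfolding S_def by (auto simp: eventually_sequentially)
  qed
  with r h show ?thesis by blast
qed

text \<open>Where \<open>\<bar>f\<bar>\<close> is not small it is dominated by a multiple of the integrable function \<open>f\<^sup>2\<close>, so that dominated
  convergence applies; the part where it is small has small norm.\<close>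

lemma ip_abs_tendsto_zero:
  fixes f :: "'a \<Rightarrow> real"
  assumes f: "f \<in> L2 M" and w: "\<And>n. w n \<in> L2 M" and bd: "\<And>n. sqnorm M (w n) \<le> C"
    and K: "\<And>n x. x \<in> space M \<Longrightarrow> \<bar>w n x\<bar> \<le> K"
    and lim: "\<And>x. x \<in> space M \<Longrightarrow> (\<lambda>n. w n x) \<longlonglongrightarrow> 0"
  shows "(\<lambda>n. \<integral>x. \<bar>f x\<bar> * \<bar>w n x\<bar> \<partial>M) \<longlonglongrightarrow> 0"
proof -
  note [measurable] = L2_measurable[OF f] L2_measurable[OF w]
  note fi = L2_square_integrable[OF f]
  define a where "a k x = (if \<bar>f x\<bar> < 1 / real (Suc k) then \<bar>f x\<bar> else 0)" for k x
  have [measurable]: "a k \<in> borel_measurable M" for k unfolding a_def by measurable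
  have aL: "a k \<in> L2 M" for k unfolding L2_def
    by (auto intro!: Bochner_Integration.integrable_bound[OF fi] simp: a_def)
  have "(\<lambda>k. sqnorm M (a k)) \<longlonglongrightarrow> (\<integral>x. 0 \<partial>M)" unfolding ip_self
  proof (rule integral_dominated_convergence[OF _ _ fi])
    show "AE x in M. (\<lambda>k. (a k x)\<^sup>2) \<longlonglongrightarrow> 0"
    proof (rule AE_I2)
      fix x
      have "\<forall>\<^sub>F k in sequentially. (a k x)\<^sup>2 = 0"
      proof (cases "f x = 0")
        case False
        have "\<forall>\<^sub>F k in sequentially. 1 / real (Suc k) < \<bar>f x\<bar>"
          using False by (intro order_tendstoD(2)[OF LIMSEQ_Suc[OF lim_1_over_n]]) auto
        then show ?thesis by eventually_elim (simp add: a_def)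
      qed (simp add: a_def)
      then show "(\<lambda>k. (a k x)\<^sup>2) \<longlonglongrightarrow> 0" by (rule tendsto_eventually)
    qed
  qed (auto simp: a_def)
  then have a0: "(\<lambda>k. sqrt (sqnorm M (a k)) * sqrt C) \<longlonglongrightarrow> 0"
    using tendsto_mult[OF tendsto_real_sqrt tendsto_const[of "sqrt C"]] by fastforce
  show ?thesis
  proof (rule LIMSEQ_I)
    fix e :: real assume "e > 0"
    then have "\<forall>\<^sub>F k in sequentially. sqrt (sqnorm M (a k)) * sqrt C < e/2"
      by (intro order_tendstoD(2)[OF a0]) auto
    then obtain k where k: "sqrt (sqnorm M (a k)) * sqrt C < e/2" by (auto simp: eventually_sequentially)
    define b where "b x = \<bar>f x\<bar> - a k x" for x
    have [measurable]: "b \<in> borel_measurable M" unfolding b_def by measurable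
    have b: "0 \<le> b x" "b x \<le> real (Suc k) * (f x)\<^sup>2" for x
    proof -
      show "0 \<le> b x" by (simp add: b_def a_def)
      have "\<bar>f x\<bar> \<le> real (Suc k) * (f x)\<^sup>2" if "\<bar>f x\<bar> \<ge> 1 / real (Suc k)"
      proof -
        have "1 \<le> real (Suc k) * \<bar>f x\<bar>" using that by (simp add: field_simps)
        then have "1 * \<bar>f x\<bar> \<le> (real (Suc k) * \<bar>f x\<bar>) * \<bar>f x\<bar>" by (intro mult_right_mono) auto
        then show ?thesis by (simp add: power2_eq_square mult.assoc)
      qed
      then show "b x \<le> real (Suc k) * (f x)\<^sup>2" by (auto simp: b_def a_def not_less)
    qed
    have dom: "integrable M (\<lambda>x. K * real (Suc k) * (f x)\<^sup>2)" using fi by simp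
    have dombd: "norm (b x * \<bar>w n x\<bar>) \<le> K * real (Suc k) * (f x)\<^sup>2" if "x \<in> space M" for n x
      using mult_mono[OF b(2)[of x] K[OF that, of n]] b(1)[of x] by (simp add: mult_ac)
    have "(\<lambda>n. \<integral>x. b x * \<bar>w n x\<bar> \<partial>M) \<longlonglongrightarrow> (\<integral>x. 0 \<partial>M)"
    proof (rule integral_dominated_convergence[OF _ _ dom])
      show "AE x in M. (\<lambda>n. b x * \<bar>w n x\<bar>) \<longlonglongrightarrow> 0"
        using lim by (intro AE_I2) (auto intro!: tendsto_mult_right_zero tendsto_rabs_zero)
    qed (use dombd in \<open>auto intro!: AE_I2\<close>)
    then have "\<forall>\<^sub>F n in sequentially. (\<integral>x. b x * \<bar>w n x\<bar> \<partial>M) < e/2"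
      using \<open>e > 0\<close> by (intro order_tendstoD(2)) auto
    then obtain N where N: "\<And>n. n \<ge> N \<Longrightarrow> (\<integral>x. b x * \<bar>w n x\<bar> \<partial>M) < e/2" by (auto simp: eventually_sequentially)
    have "(\<integral>x. \<bar>f x\<bar> * \<bar>w n x\<bar> \<partial>M) < e" if "n \<ge> N" for n
    proof -
      have "(\<integral>x. \<bar>f x\<bar> * \<bar>w n x\<bar> \<partial>M) = (\<integral>x. a k x * \<bar>w n x\<bar> + b x * \<bar>w n x\<bar> \<partial>M)"
        by (simp add: b_def algebra_simps)
      also have "\<dots> = ip M (a k) (\<lambda>x. \<bar>w n x\<bar>) + (\<integral>x. b x * \<bar>w n x\<bar> \<partial>M)"
        unfolding ip_def
      proof (intro Bochner_Integration.integral_add L2_mult_integrable[OF aL L2_abs[OF w]])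
        show "integrable M (\<lambda>x. b x * \<bar>w n x\<bar>)"
          by (rule Bochner_Integration.integrable_bound[OF dom])
            (use dombd in \<open>auto intro!: AE_I2 intro: order_trans[OF _ abs_ge_self]\<close>)
      qed
      also have "ip M (a k) (\<lambda>x. \<bar>w n x\<bar>) \<le> sqrt (sqnorm M (a k)) * sqrt C"
      proof -
        have "sqnorm M (\<lambda>x. \<bar>w n x\<bar>) \<le> C" using bd[of n] by (simp add: ip_self)
        from ip_bound[OF aL L2_abs[OF w] order_refl this, of k] show ?thesis by linarith
      qed
      finally show ?thesis using k N[OF that] by linarith
    qed
    moreover have "0 \<le> (\<integral>x. \<bar>f x\<bar> * \<bar>w n x\<bar> \<partial>M)" for n by simp
    ultimately show "\<exists>no. \<forall>n\<ge>no. norm ((\<integral>x. \<bar>f x\<bar> * \<bar>w n x\<bar> \<partial>M) - 0) < e"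
      by (intro exI[of _ N]) auto
  qed
qed

section \<open>Functions on the grid as square-integrable functions on a product space\<close>

text \<open>Half-lines form an intersection-stable generator of the Borel sets, so by Dynkin's
  argument the integral of \<open>d\<close> over every Borel set vanishes; the total integral
  handles complements. Testing on the sets where \<open>d\<close> is positive and where it is
  negative finishes the proof.\<close>

lemma AE_zero_if_integrals_atMost_zero:
  fixes d :: "real \<Rightarrow> real"
  assumes d: "integrable lborel d" and tot: "integral\<^sup>L lborel d = 0"
    and z: "\<And>x. (LINT t:{..x}|lborel. d t) = 0"
  shows "AE t in lborel. d t = 0"
proof -
  have [measurable]: "d \<in> borel_measurable borel" using d by auto
  have si: "set_integrable lborel A d" if "A \<in> sets borel" for A
    unfolding set_integrable_def using d that by (intro integrable_mult_indicator) auto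
  have P: "(LINT t:A|lborel. d t) = 0" if "A \<in> sets borel" for A
  proof -
    have sb: "sigma_sets UNIV (range (atMost :: real \<Rightarrow> real set)) = sets borel" unfolding borel_eq_atMost by simp
    have "Int_stable (range (atMost :: real \<Rightarrow> real set))" by (auto simp: Int_stable_def)
    moreover have "range (atMost :: real \<Rightarrow> real set) \<subseteq> Pow UNIV" by simp
    moreover have "A \<in> sigma_sets UNIV (range atMost)" using that sb by simp
    ultimately show ?thesis
    proof (induction rule: sigma_sets_induct_disjoint)
      case (basic A) then show ?case using z by auto
    next
      case empty then show ?case by (simp add: set_lebesgue_integral_def)
    next
      case (compl A)
      then have A: "A \<in> sets borel" using sb by simp
      have "(LINT t:A \<union> (UNIV - A)|lborel. d t) = (LINT t:A|lborel. d t) + (LINT t:UNIV - A|lborel. d t)"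
        using A by (intro set_integral_Un si) auto
      moreover have "A \<union> (UNIV - A) = UNIV" by auto
      ultimately show ?case using compl(2) tot by (simp add: set_lebesgue_integral_def)
    next
      case (union A)
      then have A: "A i \<in> sets borel" for i using sb by auto
      then have "(LINT t:(\<Union>i. A i)|lborel. d t) = (\<Sum>i. (LINT t:A i|lborel. d t))"
        using union(1) by (intro lebesgue_integral_countable_add si) (auto simp: disjoint_family_on_def)
      then show ?case using union by simp
    qed
  qed
  \<comment> \<open>The factor \<open>c\<close> is the sign of \<open>d\<close> on
    \<open>A\<close>.\<close>
  have half: "AE t in lborel. indicator A t * \<bar>d t\<bar> = 0" if A: "A \<in> sets borel"
    and s: "\<And>t. t \<in> A \<Longrightarrow> c * d t = \<bar>d t\<bar>" for A and c :: real
  proof -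
    have eq: "indicator A t * \<bar>d t\<bar> = c * (indicator A t * d t)" for t
      using s[of t] by (auto simp: indicator_def)
    have "integrable lborel (\<lambda>t. indicator A t * \<bar>d t\<bar>)"
      using si[OF A] unfolding eq set_integrable_def by simp
    moreover have "(\<integral>t. indicator A t * \<bar>d t\<bar> \<partial>lborel) = 0"
      using P[OF A] unfolding eq set_lebesgue_integral_def by simp
    ultimately show ?thesis by (subst (asm) integral_nonneg_eq_0_iff_AE) auto
  qed
  have "{t. d t > 0} \<in> sets borel" "{t. d t < 0} \<in> sets borel" by measurable
  from half[OF this(1), of 1] half[OF this(2), of "-1"] show ?thesis
    by (auto elim!: eventually_elim2 simp: indicator_def split: if_splits)
qed

section \<open>The measure space of all edges\<close>

abbreviation Iv :: "real \<Rightarrow> real measure" where "Iv eps \<equiv> restrict_space lborel {0..eps}"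

text \<open>Counting measure on the edges turns an integral over \<open>EM\<close> into the sum over
  edges of one-dimensional integrals, so a function on the whole grid is one element of a single L2
  space and weak compactness is applied once, to all edges together.\<close>

definition EM :: "real \<Rightarrow> (edge \<times> real) measure" where
  "EM eps = count_space UNIV \<Otimes>\<^sub>M Iv eps"

lemma finite_measure_Iv: "finite_measure (Iv eps)"
  by (intro finite_measureI, cases "0 \<le> eps") (simp_all add: emeasure_restrict_space space_restrict_space)

interpretation Iv: finite_measure "Iv eps" for eps by (rule finite_measure_Iv)

interpretation EMp: pair_sigma_finite "count_space (UNIV :: edge set)" "Iv eps" for eps
  unfolding pair_sigma_finite_def
  using sigma_finite_measure_count_space_countable[of "UNIV :: edge set"] Iv.sigma_finite_measure_axioms by auto

lemma space_Iv: "space (Iv eps) = {0..eps}" by (simp add: space_restrict_space)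

lemma space_EM: "space (EM eps) = UNIV \<times> {0..eps}"
  by (simp add: EM_def space_pair_measure space_Iv)

text \<open>There are countably many edges, so measurability on each slice suffices.\<close>

lemma measurable_EM:
  fixes F :: "edge \<times> real \<Rightarrow> real"
  assumes "\<And>e. (\<lambda>t. F (e, t)) \<in> borel_measurable (Iv eps)"
  shows "F \<in> borel_measurable (EM eps)"
  unfolding EM_def using assms by (intro measurable_pair_measure_countable1) auto

lemma measurable_EM_slice:
  assumes "F \<in> borel_measurable (EM eps)" shows "(\<lambda>t. F (e, t)) \<in> borel_measurable (Iv eps)"
  using assms unfolding EM_def by (intro measurable_compose[OF _ assms[unfolded EM_def]] measurable_Pair) auto

text \<open>For the counting measure "almost every edge" means every edge.\<close>

lemma integrable_EM_slice:
  fixes F :: "edge \<times> real \<Rightarrow> real"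
  assumes "integrable (EM eps) F" shows "integrable (Iv eps) (\<lambda>t. F (e, t))"
  using EMp.AE_integrable_fst'[OF assms[unfolded EM_def]] by (auto simp only: AE_count_space)

text \<open>Fubini's theorem, with the Bochner integral over the counting measure converted into the
  unordered sums by which the norms on the grid are defined.\<close>

lemma integral_EM:
  fixes F :: "edge \<times> real \<Rightarrow> real"
  assumes "integrable (EM eps) F"
  shows "((\<lambda>e. \<integral>t. F (e, t) \<partial>Iv eps) has_sum (\<integral>x. F x \<partial>EM eps)) UNIV"
proof -
  have i: "integrable (count_space UNIV) (\<lambda>e. \<integral>t. F (e, t) \<partial>Iv eps)"
    using EMp.integrable_fst'[OF assms[unfolded EM_def]] .
  then have s: "Infinite_Set_Sum.abs_summable_on (\<lambda>e. \<integral>t. F (e, t) \<partial>Iv eps) UNIV"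
    by (simp add: abs_summable_on_def)
  have "(\<integral>x. F x \<partial>EM eps) = infsetsum (\<lambda>e. \<integral>t. F (e, t) \<partial>Iv eps) UNIV"
    unfolding EM_def infsetsum_def using EMp.integral_fst'[OF assms[unfolded EM_def]] by simp
  also have "\<dots> = (\<Sum>\<^sub>\<infinity>e. \<integral>t. F (e, t) \<partial>Iv eps)" by (rule infsetsum_infsum[OF s])
  finally show ?thesis
    using abs_summable_summable[OF s[folded abs_summable_equivalent]] by (simp only: has_sum_infsum)
qed

lemma integrable_EM_nonneg:
  fixes F :: "edge \<times> real \<Rightarrow> real"
  assumes m: "\<And>e. (\<lambda>t. F (e, t)) \<in> borel_measurable (Iv eps)" and nn: "\<And>x. 0 \<le> F x"
    and i: "\<And>e. integrable (Iv eps) (\<lambda>t. F (e, t))"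
    and s: "(\<lambda>e. \<integral>t. F (e, t) \<partial>Iv eps) summable_on UNIV"
  shows "integrable (EM eps) F"
proof -
  have F: "F \<in> borel_measurable (count_space UNIV \<Otimes>\<^sub>M Iv eps)"
    using measurable_EM[OF m] by (simp add: EM_def)
  have "Infinite_Sum.abs_summable_on (\<lambda>e. \<integral>t. F (e, t) \<partial>Iv eps) UNIV"
    using s nn by simp
  then have "integrable (count_space UNIV) (\<lambda>e. \<integral>t. F (e, t) \<partial>Iv eps)"
    by (simp only: abs_summable_equivalent abs_summable_on_def)
  then show ?thesis unfolding EM_def
    using nn i by (intro EMp.Fubini_integrable F) (auto simp: AE_count_space)
qed

section \<open>Weak derivatives on a single edge\<close>

lemma set_integral_Iv:
  fixes f :: "real \<Rightarrow> real" shows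
  "set_lebesgue_integral lborel {0..eps} f = (\<integral>t. f t \<partial>Iv eps)"
  unfolding set_lebesgue_integral_def by (subst integral_restrict_space) auto

lemma set_integrable_Iv:
  fixes f :: "real \<Rightarrow> real" shows "set_integrable lborel {0..eps} f = integrable (Iv eps) f"
  unfolding set_integrable_def by (subst integrable_restrict_space) auto

text \<open>Writing increments as pairings with an L2 function lets weak convergence of derivatives
  pass to convergence of values.\<close>

lemma ip_indicator:
  assumes "x \<in> {0..eps}"
  shows "set_lebesgue_integral lborel {0..x} g = ip (Iv eps) (indicator {0..x}) g"
  unfolding ip_def set_lebesgue_integral_def
  using assms by (subst integral_restrict_space) (auto intro!: Bochner_Integration.integral_cong simp: indicator_def)

lemma indicator_L2_Iv: "indicator {0..x} \<in> L2 (Iv eps)"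
proof -
  have "(indicator {0..x} :: real \<Rightarrow> real) \<in> borel_measurable (Iv eps)"
    by (intro measurable_restrict_space1) (rule borel_measurable_indicator, simp)
  then show ?thesis unfolding L2_def
    by (auto intro!: Iv.integrable_const_bound[of _ 1] simp del: space_restrict_space simp: indicator_le_1 power_le_one)
qed

lemma one_L2_Iv: "(\<lambda>t. 1) \<in> L2 (Iv eps)"
  unfolding L2_def by simp

lemma L2_Iv_integrable: "g \<in> L2 (Iv eps) \<Longrightarrow> integrable (Iv eps) g"
  using L2_mult_integrable[OF one_L2_Iv, of g] by simp

text \<open>On an interval of finite length square integrability implies integrability, so the two
  integrability conditions collapse to membership in \<open>L2\<close>.\<close>

lemma h1_deriv_iff:
  "h1_deriv 0 eps f g \<longleftrightarrow> g \<in> L2 (Iv eps) \<and> (\<forall>x\<in>{0..eps}. f x = f 0 + ip (Iv eps) (indicator {0..x}) g)"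
proof -
  have "integrable (Iv eps) g \<and> integrable (Iv eps) (\<lambda>t. (g t)\<^sup>2) \<longleftrightarrow> g \<in> L2 (Iv eps)"
    using L2_Iv_integrable[of g eps] borel_measurable_integrable[of "Iv eps" g]
    unfolding L2_def mem_Collect_eq by argo
  moreover have "(\<forall>x\<in>{0..eps}. f x = f 0 + set_lebesgue_integral lborel {0..x} g) =
      (\<forall>x\<in>{0..eps}. f x = f 0 + ip (Iv eps) (indicator {0..x}) g)"
    by (rule ball_cong[OF refl]) (simp only: ip_indicator)
  ultimately show ?thesis unfolding h1_deriv_def set_integrable_Iv by argo
qed

lemma h1_deriv_L2: "h1_deriv 0 eps f g \<Longrightarrow> g \<in> L2 (Iv eps)"
  unfolding h1_deriv_iff by (rule conjunct1)

lemma h1_deriv_increment: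
  "h1_deriv 0 eps f g \<Longrightarrow> x \<in> {0..eps} \<Longrightarrow> f x = f 0 + ip (Iv eps) (indicator {0..x}) g"
  unfolding h1_deriv_iff by (drule conjunct2) (rule bspec)

text \<open>The difference of two derivatives, extended by zero, has zero integral over every
  half-line. This makes the arbitrary choice of derivative in \<open>edge_dirichlet\<close>
  harmless.\<close>

lemma h1_deriv_unique:
  assumes "h1_deriv 0 eps f g" "h1_deriv 0 eps f g'"
  shows "AE t in Iv eps. g t = g' t"
proof (cases "0 \<le> eps")
  case True
  define d where "d t = indicator {0..eps} t * (g t - g' t)" for t
  have dL: "(\<lambda>t. g t - g' t) \<in> L2 (Iv eps)" by (intro L2_diff h1_deriv_L2[OF assms(1)] h1_deriv_L2[OF assms(2)])
  have z: "ip (Iv eps) (indicator {0..x}) (\<lambda>t. g t - g' t) = 0" if "x \<in> {0..eps}" for x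
  proof -
    have "f x = f 0 + ip (Iv eps) (indicator {0..x}) g" "f x = f 0 + ip (Iv eps) (indicator {0..x}) g'"
      using h1_deriv_increment[OF assms(1) that] h1_deriv_increment[OF assms(2) that] by this
    then show ?thesis using h1_deriv_L2[OF assms(1)] h1_deriv_L2[OF assms(2)]
      by (simp add: ip_diff_right indicator_L2_Iv)
  qed
  have "AE t in lborel. d t = 0"
  proof (rule AE_zero_if_integrals_atMost_zero)
    show "integrable lborel d" using L2_Iv_integrable[OF dL]
      by (subst (asm) integrable_restrict_space) (auto simp: d_def[abs_def])
    show *: "(LINT t:{..x}|lborel. d t) = 0" for x
    proof (cases "x < 0")
      case True
      then show ?thesis by (auto simp: set_lebesgue_integral_def d_def indicator_def intro!: integral_eq_zero_AE)
    next
      case False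
      then have "(LINT t:{..x}|lborel. d t) = (LINT t:{0..min x eps}|lborel. g t - g' t)"
        unfolding set_lebesgue_integral_def d_def
        by (intro Bochner_Integration.integral_cong) (auto simp: indicator_def)
      also have "\<dots> = 0" using False True by (subst ip_indicator[of _ eps]) (auto intro!: z)
      finally show ?thesis .
    qed
    have "integral\<^sup>L lborel d = (LINT t:{..eps}|lborel. d t)"
      unfolding set_lebesgue_integral_def d_def
      by (intro Bochner_Integration.integral_cong) (auto simp: indicator_def)
    then show "integral\<^sup>L lborel d = 0" using * by simp
  qed
  then show ?thesis by (subst AE_restrict_space_iff) (auto simp: d_def elim!: eventually_mono)
next
  case False
  then show ?thesis by (intro AE_I2) (simp add: space_Iv)
qed

section \<open>Grid functions and their derivatives in the L2 space over all edges\<close>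

definition pr :: "real \<Rightarrow> (real \<times> real \<Rightarrow> real) \<Rightarrow> edge \<times> real \<Rightarrow> real" where
  "pr eps u x = edge_fun eps u (fst x) (snd x)"

text \<open>The choice is literally the one made in \<open>edge_dirichlet\<close>, so that
  \<open>der\<close> computes the Dirichlet energy without comparing representatives.\<close>

definition der :: "real \<Rightarrow> (real \<times> real \<Rightarrow> real) \<Rightarrow> edge \<times> real \<Rightarrow> real" where
  "der eps u x = (SOME g. h1_deriv 0 eps (edge_fun eps u (fst x)) g) (snd x)"

definition edge_pt :: "real \<Rightarrow> edge \<Rightarrow> real \<Rightarrow> real \<times> real" where
  "edge_pt eps e t = (if snd e then (eps * of_int (fst (fst e)) + t, eps * of_int (snd (fst e)))
      else (eps * of_int (fst (fst e)), eps * of_int (snd (fst e)) + t))"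

lemma edge_fun_pt: "edge_fun eps u e t = u (edge_pt eps e t)"
  by (simp add: edge_fun_def edge_pt_def)

lemma edge_pt_grid: "edge_pt eps e t \<in> grid eps"
  by (auto simp: edge_pt_def grid_def)

lemma continuous_on_edge_fun: "continuous_on (grid eps) u \<Longrightarrow> continuous_on A (edge_fun eps u e)"
proof -
  assume u: "continuous_on (grid eps) u"
  have "continuous_on A (edge_pt eps e)"
    unfolding edge_pt_def by (cases "snd e") (auto intro!: continuous_intros)
  then have "continuous_on A (\<lambda>t. u (edge_pt eps e t))"
    by (rule continuous_on_compose2[OF u]) (auto simp: edge_pt_grid)
  then show ?thesis by (simp add: edge_fun_pt)
qed

lemma edge_fun_measurable:
  assumes "continuous_on (grid eps) u" shows "edge_fun eps u e \<in> borel_measurable (Iv eps)"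
  using borel_measurable_continuous_on_restrict[OF continuous_on_edge_fun[OF assms, of "{0..eps}" e]]
  by (simp add: measurable_cong_sets[OF sets_restrict_space_cong[OF sets_lborel] refl])

lemma pr_measurable:
  assumes "continuous_on (grid eps) u" shows "pr eps u \<in> borel_measurable (EM eps)"
  by (rule measurable_EM) (simp add: pr_def edge_fun_measurable[OF assms, unfolded fun_eq_iff])

lemma edge_Lr_eq: "edge_Lr eps r u e = (\<integral>t. \<bar>pr eps u (e, t)\<bar> powr r \<partial>Iv eps)"
  by (simp add: edge_Lr_def set_integral_Iv pr_def)

lemma edge_dirichlet_eq: "edge_dirichlet eps u e = (\<integral>t. (der eps u (e, t))\<^sup>2 \<partial>Iv eps)"
  by (simp add: edge_dirichlet_def set_integral_Iv der_def)

lemma abs_powr_2: "\<bar>x\<bar> powr 2 = x\<^sup>2" for x :: real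
  by (cases "x = 0") (auto simp: powr_numeral)

lemma H1_continuous: "u \<in> H1 eps \<Longrightarrow> continuous_on (grid eps) u" by (simp add: H1_def)

lemma H1_der:
  assumes "u \<in> H1 eps" shows "h1_deriv 0 eps (edge_fun eps u e) (\<lambda>t. der eps u (e, t))"
proof -
  have "\<exists>g. h1_deriv 0 eps (edge_fun eps u e) g" using assms unfolding H1_def h1_interval_def by blast
  from someI_ex[OF this] show ?thesis by (simp add: der_def)
qed

lemma H1_der_L2:
  assumes "u \<in> H1 eps" shows "der eps u \<in> L2 (EM eps)"
proof -
  have L: "(\<lambda>t. der eps u (e, t)) \<in> L2 (Iv eps)" for e using h1_deriv_L2[OF H1_der[OF assms]] .
  have "edge_dirichlet eps u summable_on UNIV" using assms by (simp add: H1_def)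
  then have "(\<lambda>e. \<integral>t. (der eps u (e, t))\<^sup>2 \<partial>Iv eps) summable_on UNIV" by (simp add: edge_dirichlet_eq[abs_def])
  moreover have "integrable (Iv eps) (\<lambda>t. (der eps u (e, t))\<^sup>2)" for e
    using L[of e] by (rule L2_square_integrable)
  ultimately have "integrable (EM eps) (\<lambda>x. (der eps u x)\<^sup>2)"
    by (intro integrable_EM_nonneg) auto
  moreover have "der eps u \<in> borel_measurable (EM eps)"
    using L by (intro measurable_EM L2_measurable)
  ultimately show ?thesis by (simp add: L2_def)
qed

lemma H1_pr_L2:
  assumes "0 \<le> eps" "u \<in> H1 eps" shows "pr eps u \<in> L2 (EM eps)"
proof -
  note c = H1_continuous[OF assms(2)]
  have i: "integrable (Iv eps) (\<lambda>t. (pr eps u (e, t))\<^sup>2)" for e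
  proof -
    have "set_integrable lborel {0..eps} (\<lambda>t. (edge_fun eps u e t)\<^sup>2)"
      unfolding set_integrable_def
      by (intro borel_integrable_compact) (auto intro!: continuous_intros continuous_on_edge_fun c)
    then show ?thesis by (simp add: set_integrable_Iv pr_def)
  qed
  have "edge_Lr eps 2 u summable_on UNIV" using assms by (simp add: H1_def)
  then have "(\<lambda>e. \<integral>t. (pr eps u (e, t))\<^sup>2 \<partial>Iv eps) summable_on UNIV"
    by (simp add: edge_Lr_eq[abs_def] abs_powr_2)
  with i have "integrable (EM eps) (\<lambda>x. (pr eps u x)\<^sup>2)"
    by (intro integrable_EM_nonneg) auto
  then show ?thesis using pr_measurable[OF c] by (simp add: L2_def)
qed

lemma Lr_pow_eq:
  assumes "integrable (EM eps) (\<lambda>x. \<bar>pr eps u x\<bar> powr r)"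
  shows "Lr_pow eps r u = (\<integral>x. \<bar>pr eps u x\<bar> powr r \<partial>EM eps)"
  unfolding Lr_pow_def edge_Lr_eq[abs_def] using integral_EM[OF assms] by (rule infsumI)

lemma mass_eq:
  assumes "0 \<le> eps" "u \<in> H1 eps" shows "Lr_pow eps 2 u = sqnorm (EM eps) (pr eps u)"
  using Lr_pow_eq[of eps u 2] L2_square_integrable[OF H1_pr_L2[OF assms]]
  by (simp add: abs_powr_2 ip_self)

lemma dirichlet_eq:
  assumes "u \<in> H1 eps" shows "dirichlet eps u = sqnorm (EM eps) (der eps u)"
  unfolding dirichlet_def edge_dirichlet_eq[abs_def] ip_self
  using integral_EM[OF L2_square_integrable[OF H1_der_L2[OF assms]]] by (rule infsumI)

lemma L2_EM_slice: "G \<in> L2 (EM eps) \<Longrightarrow> (\<lambda>t. G (e, t)) \<in> L2 (Iv eps)"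
  using measurable_EM_slice[of G eps e] integrable_EM_slice[of eps "\<lambda>x. (G x)\<^sup>2" e] by (auto simp: L2_def)

text \<open>A concrete derivative \<open>G\<close> known on every edge may replace the chosen one
  under all integrals over \<open>EM\<close>.\<close>

lemma der_AE:
  assumes G: "G \<in> L2 (EM eps)" and d: "\<And>e. h1_deriv 0 eps (edge_fun eps u e) (\<lambda>t. G (e, t))"
  shows "AE x in EM eps. der eps u x = G x" "der eps u \<in> borel_measurable (EM eps)"
proof -
  have D: "h1_deriv 0 eps (edge_fun eps u e) (\<lambda>t. der eps u (e, t))" for e
    using someI[of "\<lambda>g. h1_deriv 0 eps (edge_fun eps u e) g", OF d[of e]] by (simp add: der_def)
  show m[measurable]: "der eps u \<in> borel_measurable (EM eps)"
    by (intro measurable_EM L2_measurable h1_deriv_L2[OF D])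
  have [measurable]: "G \<in> borel_measurable (EM eps)" using G by (rule L2_measurable)
  have "{x \<in> space (EM eps). der eps u x = G x} \<in> sets (EM eps)" by measurable
  then show "AE x in EM eps. der eps u x = G x"
    unfolding EM_def using h1_deriv_unique[OF D d] by (intro EMp.AE_pair_measure) (auto simp: AE_count_space)
qed

lemma ip_cong_AE:
  assumes "AE x in M. f x = f' x" "AE x in M. g x = g' x"
    "f \<in> borel_measurable M" "f' \<in> borel_measurable M" "g \<in> borel_measurable M" "g' \<in> borel_measurable M"
  shows "ip M f g = ip M f' g'"
  unfolding ip_def using assms by (intro integral_cong_AE) (auto elim!: eventually_elim2)

text \<open>The way in which new members of \<open>H1\<close> are certified: an explicit derivative
  that is square integrable over all edges gives the summability conditions that are stated with the
  chosen derivative.\<close>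

lemma H1_intro:
  assumes eps: "0 \<le> eps" and c: "continuous_on (grid eps) u" and p: "pr eps u \<in> L2 (EM eps)"
    and G: "G \<in> L2 (EM eps)" and d: "\<And>e. h1_deriv 0 eps (edge_fun eps u e) (\<lambda>t. G (e, t))"
  shows "u \<in> H1 eps"
proof -
  note ae = der_AE[OF G d]
  have "integrable (EM eps) (\<lambda>x. (der eps u x)\<^sup>2)"
  proof (subst integrable_cong_AE)
    show "AE x in EM eps. (der eps u x)\<^sup>2 = (G x)\<^sup>2" using ae(1) by eventually_elim simp
  qed (use ae(2) L2_square_integrable[OF G] L2_measurable[OF G] in auto)
  from integral_EM[OF this] have "edge_dirichlet eps u summable_on UNIV"
    by (auto simp: edge_dirichlet_eq[abs_def] summable_on_def)
  moreover from integral_EM[OF L2_square_integrable[OF p]] have "edge_Lr eps 2 u summable_on UNIV"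
    by (auto simp: edge_Lr_eq[abs_def] abs_powr_2 summable_on_def)
  ultimately show ?thesis using c d unfolding H1_def h1_interval_def by auto
qed

section \<open>Local compactness of the Sobolev space of the grid\<close>

text \<open>The index bounds express local finiteness: the edges found for the points of a bounded
  region have indices in a bounded range.\<close>

lemma grid_edge_pt:
  assumes eps: "0 < eps" and x: "x \<in> grid eps"
  obtains e t where "t \<in> {0..eps}" "x = edge_pt eps e t"
    "\<bar>real_of_int (fst (fst e))\<bar> \<le> \<bar>fst x\<bar> / eps + 1" "\<bar>real_of_int (snd (fst e))\<bar> \<le> \<bar>snd x\<bar> / eps + 1"
proof -
  have fl: "y - eps * of_int \<lfloor>y / eps\<rfloor> \<in> {0..eps}" "\<bar>real_of_int \<lfloor>y / eps\<rfloor>\<bar> \<le> \<bar>y\<bar> / eps + 1" for y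
  proof -
    have l: "real_of_int \<lfloor>y / eps\<rfloor> \<le> y / eps" and u: "y / eps < real_of_int \<lfloor>y / eps\<rfloor> + 1" by linarith+
    have e1: "eps * (y / eps) = y" using eps by simp
    have "eps * of_int \<lfloor>y / eps\<rfloor> \<le> y" using mult_left_mono[OF l, of eps] e1 eps by simp
    moreover have "y \<le> eps * of_int \<lfloor>y / eps\<rfloor> + eps"
      using mult_left_mono[OF less_imp_le[OF u], of eps] e1 eps by (simp add: distrib_left)
    ultimately show "y - eps * of_int \<lfloor>y / eps\<rfloor> \<in> {0..eps}" by simp
    have "\<bar>y / eps\<bar> = \<bar>y\<bar> / eps" using eps by simp
    then show "\<bar>real_of_int \<lfloor>y / eps\<rfloor>\<bar> \<le> \<bar>y\<bar> / eps + 1" using l u by linarith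
  qed
  have ab: "\<bar>eps * of_int k\<bar> / eps = \<bar>of_int k\<bar>" for k :: int using eps by (simp add: abs_mult)
  have "(\<exists>k::int. fst x = eps * of_int k) \<or> (\<exists>k::int. snd x = eps * of_int k)"
    using x unfolding grid_def by (simp add: case_prod_beta)
  then consider k :: int where "fst x = eps * of_int k" | k :: int where "snd x = eps * of_int k" by blast
  then show ?thesis
  proof cases
    case 1
    then show ?thesis using fl[of "snd x"] ab[of k]
      by (intro that[of "snd x - eps * of_int \<lfloor>snd x / eps\<rfloor>" "((k, \<lfloor>snd x / eps\<rfloor>), False)"])
        (auto simp: edge_pt_def prod_eq_iff)
  next
    case 2
    then show ?thesis using fl[of "fst x"] ab[of k]
      by (intro that[of "fst x - eps * of_int \<lfloor>fst x / eps\<rfloor>" "((\<lfloor>fst x / eps\<rfloor>, k), True)"])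
        (auto simp: edge_pt_def prod_eq_iff)
  qed
qed

text \<open>Limits of functions are controlled edge by edge, whereas \<open>H1\<close> demands
  continuity on the plane set. Edges are closed and locally finite, so continuity is pasted from the
  finitely many edges that cover a neighbourhood of each point.\<close>

lemma continuous_on_grid_if_on_edges:
  assumes eps: "0 < eps" and c: "\<And>e. continuous_on {0..eps} (edge_fun eps u e)"
  shows "continuous_on (grid eps) u"
proof -
  define seg where "seg e = edge_pt eps e ` {0..eps}" for e
  have cp: "continuous_on A (edge_pt eps e)" for A e
    unfolding edge_pt_def by (cases "snd e") (auto intro!: continuous_intros)
  have seg: "closed (seg e)" for e
    unfolding seg_def by (intro compact_imp_closed compact_continuous_image cp) simp
  define inv_pt where "inv_pt e x = (if snd e then fst x - eps * of_int (fst (fst e)) else snd x - eps * of_int (snd (fst e)))" for e :: edge and x :: "real \<times> real"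
  have inv: "inv_pt e (edge_pt eps e t) = t" for e t by (simp add: inv_pt_def edge_pt_def)
  have cseg: "continuous_on (seg e) u" for e
  proof -
    have "continuous_on (seg e) (\<lambda>x. edge_fun eps u e (inv_pt e x))"
    proof (rule continuous_on_compose2[OF c])
      show "continuous_on (seg e) (inv_pt e)"
        unfolding inv_pt_def by (cases "snd e") (auto intro!: continuous_intros)
    qed (auto simp: seg_def inv)
    moreover have "edge_fun eps u e (inv_pt e x) = u x" if "x \<in> seg e" for x
      using that by (auto simp: seg_def inv edge_fun_pt)
    ultimately show ?thesis by (simp cong: continuous_on_cong)
  qed
  show ?thesis
  proof (subst continuous_on_eq_continuous_within, intro ballI)
    fix P assume P: "P \<in> grid eps"
    \<comment> \<open>Large enough for the index bounds of \<open>grid_edge_pt\<close> at every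
      point of the unit ball around \<open>P\<close>.\<close>
    define N where "N = \<lceil>(norm P + 1) / eps + 1\<rceil>"
    define E :: "edge set" where "E = ({-N..N} \<times> {-N..N}) \<times> UNIV"
    have "finite E" unfolding E_def by simp
    have cE: "continuous_on (\<Union>e\<in>E. seg e) u"
      using \<open>finite E\<close> seg cseg by (rule continuous_on_closed_Union)
    have sub: "grid eps \<inter> ball P 1 \<subseteq> (\<Union>e\<in>E. seg e)"
    proof
      fix x assume x: "x \<in> grid eps \<inter> ball P 1"
      then obtain e t where et: "t \<in> {0..eps}" "x = edge_pt eps e t"
        "\<bar>real_of_int (fst (fst e))\<bar> \<le> \<bar>fst x\<bar> / eps + 1" "\<bar>real_of_int (snd (fst e))\<bar> \<le> \<bar>snd x\<bar> / eps + 1"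
        using grid_edge_pt[OF eps] by blast
      have "norm x \<le> norm P + norm (x - P)" by (metis add.commute diff_add_cancel norm_triangle_ineq)
      then have nx: "norm x \<le> norm P + 1" using x by (auto simp: dist_norm norm_minus_commute)
      have "\<bar>real_of_int k\<bar> \<le> N \<Longrightarrow> k \<in> {-N..N}" for k by auto
      moreover have "\<bar>y\<bar> / eps + 1 \<le> N" if "\<bar>y\<bar> \<le> norm x" for y
      proof -
        have "\<bar>y\<bar> / eps \<le> (norm P + 1) / eps" using that nx eps by (intro divide_right_mono) auto
        then show ?thesis unfolding N_def by linarith
      qed
      moreover have "\<bar>fst x\<bar> \<le> norm x" "\<bar>snd x\<bar> \<le> norm x"
        using norm_fst_le[of "fst x" "snd x"] norm_snd_le[of "snd x" "fst x"] by auto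
      ultimately have "e \<in> E" using et(3,4) unfolding E_def
        by (cases e; cases "fst e") (auto, (smt (verit))+)
      then show "x \<in> (\<Union>e\<in>E. seg e)" using et(1,2) unfolding seg_def by blast
    qed
    have "continuous (at P within (grid eps \<inter> ball P 1)) u"
      using cE P sub by (intro continuous_within_subset[OF _ sub]) (auto simp: continuous_on_eq_continuous_within)
    moreover have "at P within grid eps \<inter> ball P 1 = at P within grid eps"
      by (rule at_within_nhd[of P "ball P 1"]) auto
    ultimately show "continuous (at P within grid eps) u" by simp
  qed
qed

section \<open>Linear structure of the Sobolev space and its two quadratic forms\<close>

lemma pr_lincomb: "pr eps (\<lambda>x. a * u x + b * v x) = (\<lambda>x. a * pr eps u x + b * pr eps v x)"
  by (auto simp: pr_def edge_fun_def)

lemma H1_lincomb: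
  assumes eps: "0 \<le> eps" and u: "u \<in> H1 eps" and v: "v \<in> H1 eps"
  shows "(\<lambda>x. a * u x + b * v x) \<in> H1 eps"
    and "AE x in EM eps. der eps (\<lambda>x. a * u x + b * v x) x = a * der eps u x + b * der eps v x"
proof -
  define w where "w x = a * u x + b * v x" for x
  define G where "G x = a * der eps u x + b * der eps v x" for x
  have G: "G \<in> L2 (EM eps)" unfolding G_def using u v by (intro L2_add L2_scale H1_der_L2)
  have d: "h1_deriv 0 eps (edge_fun eps w e) (\<lambda>t. G (e, t))" for e
  proof -
    note du = H1_der[OF u, of e] and dv = H1_der[OF v, of e]
    have "edge_fun eps w e x = edge_fun eps w e 0 + ip (Iv eps) (indicator {0..x}) (\<lambda>t. G (e, t))"
      if x: "x \<in> {0..eps}" for x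
    proof -
      have "ip (Iv eps) (indicator {0..x}) (\<lambda>t. G (e, t)) =
        a * ip (Iv eps) (indicator {0..x}) (\<lambda>t. der eps u (e, t)) + b * ip (Iv eps) (indicator {0..x}) (\<lambda>t. der eps v (e, t))"
        unfolding G_def using h1_deriv_L2[OF du] h1_deriv_L2[OF dv]
        by (simp add: ip_add_right ip_scale_right L2_scale indicator_L2_Iv)
      moreover have "edge_fun eps w e y = a * edge_fun eps u e y + b * edge_fun eps v e y" for y
        by (auto simp: w_def edge_fun_def)
      ultimately show ?thesis using h1_deriv_increment[OF du x] h1_deriv_increment[OF dv x]
        by (simp add: algebra_simps)
    qed
    then show ?thesis unfolding h1_deriv_iff using L2_EM_slice[OF G] by blast
  qed
  have "w \<in> H1 eps"
  proof (rule H1_intro[OF eps _ _ G d])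
    show "continuous_on (grid eps) w" unfolding w_def
      using H1_continuous[OF u] H1_continuous[OF v] by (intro continuous_intros)
    show "pr eps w \<in> L2 (EM eps)" unfolding w_def pr_lincomb
      using H1_pr_L2[OF eps u] H1_pr_L2[OF eps v] by (intro L2_add L2_scale)
  qed
  then show "(\<lambda>x. a * u x + b * v x) \<in> H1 eps" by (simp add: w_def[abs_def])
  show "AE x in EM eps. der eps (\<lambda>x. a * u x + b * v x) x = a * der eps u x + b * der eps v x"
    using der_AE(1)[OF G d] unfolding w_def[abs_def] G_def .
qed

lemma H1_lincomb_forms:
  assumes eps: "0 \<le> eps" and u: "u \<in> H1 eps" and v: "v \<in> H1 eps"
  shows "dirichlet eps (\<lambda>x. a * u x + b * v x) =
      a\<^sup>2 * dirichlet eps u + 2 * (a * b) * ip (EM eps) (der eps u) (der eps v) + b\<^sup>2 * dirichlet eps v"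
    and "Lr_pow eps 2 (\<lambda>x. a * u x + b * v x) =
      a\<^sup>2 * Lr_pow eps 2 u + 2 * (a * b) * ip (EM eps) (pr eps u) (pr eps v) + b\<^sup>2 * Lr_pow eps 2 v"
proof -
  have sq: "sqnorm (EM eps) (\<lambda>x. a * f x + b * g x) = a\<^sup>2 * sqnorm (EM eps) f + 2 * (a * b) * ip (EM eps) f g + b\<^sup>2 * sqnorm (EM eps) g"
    if "f \<in> L2 (EM eps)" "g \<in> L2 (EM eps)" for f g
    using that by (simp add: ip_add_left ip_add_right L2_add L2_scale ip_scale_left ip_scale_right ip_commute[of _ g f])
      (simp add: power2_eq_square algebra_simps)
  note w = H1_lincomb[OF eps u v, of a b]
  note dL = H1_der_L2[OF u] H1_der_L2[OF v]
  note m = L2_measurable[OF H1_der_L2[OF w(1)]] L2_measurable[OF L2_add[OF L2_scale[OF dL(1)] L2_scale[OF dL(2)]]]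
  show "dirichlet eps (\<lambda>x. a * u x + b * v x) =
      a\<^sup>2 * dirichlet eps u + 2 * (a * b) * ip (EM eps) (der eps u) (der eps v) + b\<^sup>2 * dirichlet eps v"
    unfolding dirichlet_eq[OF w(1)] dirichlet_eq[OF u] dirichlet_eq[OF v] sq[OF dL, symmetric]
    by (rule ip_cong_AE[OF w(2) w(2)]) (rule m)+
  show "Lr_pow eps 2 (\<lambda>x. a * u x + b * v x) =
      a\<^sup>2 * Lr_pow eps 2 u + 2 * (a * b) * ip (EM eps) (pr eps u) (pr eps v) + b\<^sup>2 * Lr_pow eps 2 v"
    unfolding mass_eq[OF eps w(1)] mass_eq[OF eps u] mass_eq[OF eps v] pr_lincomb
    by (rule sq[OF H1_pr_L2[OF eps u] H1_pr_L2[OF eps v]])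
qed

lemma H1_scale:
  assumes eps: "0 \<le> eps" and u: "u \<in> H1 eps"
  shows "(\<lambda>x. a * u x) \<in> H1 eps" "Lr_pow eps 2 (\<lambda>x. a * u x) = a\<^sup>2 * Lr_pow eps 2 u"
    "dirichlet eps (\<lambda>x. a * u x) = a\<^sup>2 * dirichlet eps u"
  using H1_lincomb(1)[OF eps u u, of a 0] H1_lincomb_forms[OF eps u u, of a 0] by simp_all

lemma H1_diff:
  assumes eps: "0 \<le> eps" and u: "u \<in> H1 eps" and v: "v \<in> H1 eps"
  shows "(\<lambda>x. u x - v x) \<in> H1 eps" "pr eps (\<lambda>x. u x - v x) = (\<lambda>x. pr eps u x - pr eps v x)"
    "dirichlet eps (\<lambda>x. u x - v x) = dirichlet eps u - 2 * ip (EM eps) (der eps u) (der eps v) + dirichlet eps v"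
    "Lr_pow eps 2 (\<lambda>x. u x - v x) = Lr_pow eps 2 u - 2 * ip (EM eps) (pr eps u) (pr eps v) + Lr_pow eps 2 v"
  using H1_lincomb(1)[OF eps u v, of 1 "-1"] H1_lincomb_forms[OF eps u v, of 1 "-1"] pr_lincomb[of eps 1 u "-1" v] by simp_all

text \<open>The increment is the pairing of \<open>g\<close> with the indicator of the interval
  between \<open>s\<close> and \<open>t\<close>, whose squared norm is its length; Cauchy-Schwarz
  gives the bound.\<close>

lemma h1_deriv_Hoelder:
  assumes d: "h1_deriv 0 eps f g" and s: "s \<in> {0..eps}" and t: "t \<in> {0..eps}"
  shows "(f t - f s)\<^sup>2 \<le> \<bar>t - s\<bar> * sqnorm (Iv eps) g"
proof -
  have *: "(f t - f s)\<^sup>2 \<le> (t - s) * sqnorm (Iv eps) g" if st: "s \<le> t" "s \<in> {0..eps}" "t \<in> {0..eps}" for s t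
  proof -
    define w :: "real \<Rightarrow> real" where "w x = indicator {0..t} x - indicator {0..s} x" for x
    have w: "w \<in> L2 (Iv eps)" unfolding w_def by (intro L2_diff indicator_L2_Iv)
    have "f t - f s = ip (Iv eps) w g"
      using h1_deriv_increment[OF d st(2)] h1_deriv_increment[OF d st(3)] h1_deriv_L2[OF d]
      unfolding w_def by (simp add: ip_diff_left indicator_L2_Iv)
    then have "(f t - f s)\<^sup>2 \<le> sqnorm (Iv eps) w * sqnorm (Iv eps) g"
      using ip_Cauchy_Schwarz[OF w h1_deriv_L2[OF d]] by simp
    moreover have "indicator {0..eps} x *\<^sub>R (w x * w x) = indicator {s<..t} x" for x
      using st by (auto simp: w_def indicator_def)
    then have "sqnorm (Iv eps) w = (\<integral>x. indicator {s<..t} x \<partial>lborel)"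
      unfolding ip_def by (subst integral_restrict_space) simp_all
    then have "sqnorm (Iv eps) w = t - s" using st by simp
    ultimately show ?thesis by simp
  qed
  show ?thesis
  proof (cases "s \<le> t")
    case True then show ?thesis using *[of s t] s t by simp
  next
    case False
    then have "(f s - f t)\<^sup>2 \<le> (s - t) * sqnorm (Iv eps) g" using *[of t s] s t by simp
    then show ?thesis using False by (simp add: power2_commute)
  qed
qed

lemma h1_deriv_continuous:
  assumes d: "h1_deriv 0 eps f g" shows "continuous_on {0..eps} f"
  unfolding continuous_on_def
proof (intro ballI)
  fix s assume s: "s \<in> {0..eps}"
  have "((\<lambda>t. f t - f s) \<longlongrightarrow> 0) (at s within {0..eps})"
  proof (rule Lim_null_comparison)
    show "\<forall>\<^sub>F t in at s within {0..eps}. norm (f t - f s) \<le> sqrt (\<bar>t - s\<bar> * sqnorm (Iv eps) g)"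
      unfolding eventually_at_filter
      using h1_deriv_Hoelder[OF d s] by (auto intro!: always_eventually real_le_rsqrt)
    have "((\<lambda>t. sqrt (\<bar>t - s\<bar> * sqnorm (Iv eps) g)) \<longlongrightarrow> sqrt (\<bar>s - s\<bar> * sqnorm (Iv eps) g)) (at s within {0..eps})"
      by (intro tendsto_intros)
    then show "((\<lambda>t. sqrt (\<bar>t - s\<bar> * sqnorm (Iv eps) g)) \<longlongrightarrow> 0) (at s within {0..eps})" by simp
  qed
  then show "(f \<longlongrightarrow> f s) (at s within {0..eps})" by (simp add: LIM_zero_iff)
qed

section \<open>Pointwise bounds from mass and Dirichlet energy\<close>

definition edge_mass :: "real \<Rightarrow> (real \<times> real \<Rightarrow> real) \<Rightarrow> edge \<Rightarrow> real" where
  "edge_mass eps u e = (\<integral>t. (pr eps u (e, t))\<^sup>2 \<partial>Iv eps)"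

lemma edge_mass_nonneg: "0 \<le> edge_mass eps u e" unfolding edge_mass_def by simp

lemma edge_dirichlet_nonneg: "0 \<le> edge_dirichlet eps u e" unfolding edge_dirichlet_eq by simp

lemma edge_mass_has_sum:
  assumes "0 \<le> eps" "u \<in> H1 eps" shows "(edge_mass eps u has_sum Lr_pow eps 2 u) UNIV"
  using integral_EM[OF L2_square_integrable[OF H1_pr_L2[OF assms]]] mass_eq[OF assms]
  by (simp add: edge_mass_def[abs_def] ip_self)

lemma edge_dirichlet_has_sum:
  assumes "u \<in> H1 eps" shows "(edge_dirichlet eps u has_sum dirichlet eps u) UNIV"
  using assms unfolding dirichlet_def H1_def by (intro has_sum_infsum) auto

lemma has_sum_member_le:
  fixes f :: "'a \<Rightarrow> real"
  assumes "(f has_sum S) UNIV" "\<And>x. 0 \<le> f x" shows "f x \<le> S"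
  using finite_sum_le_has_sum[OF assms(1), of "{x}"] assms(2) by simp

text \<open>Averaging over a window of free length \<open>l\<close>; optimising in \<open>l\<close> gives the one-dimensional
  Gagliardo-Nirenberg inequality.\<close>

lemma edge_sup_bound:
  assumes eps: "0 < eps" and u: "u \<in> H1 eps" and t: "t \<in> {0..eps}" and l: "0 < l" "l \<le> eps"
  shows "(edge_fun eps u e t)\<^sup>2 \<le> 2 / l * edge_mass eps u e + 2 * l * edge_dirichlet eps u e"
proof -
  \<comment> \<open>The window of length \<open>l\<close> starts at \<open>t\<close> unless it would
    leave the edge; then it is pushed back to end at \<open>eps\<close>.\<close>
  define a where "a = (if t \<le> eps - l then t else eps - l)"
  define J where "J = {a..a+l}"
  have J: "J \<subseteq> {0..eps}" "t \<in> J" using t l unfolding J_def a_def by auto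
  let ?f = "edge_fun eps u e" and ?D = "edge_dirichlet eps u e"
  have D: "?D = sqnorm (Iv eps) (\<lambda>t. der eps u (e, t))" by (simp add: ip_self edge_dirichlet_eq)
  have pt: "indicator J s * (?f t)\<^sup>2 \<le> 2 * (pr eps u (e, s))\<^sup>2 + indicator J s * (2 * l * ?D)" for s
  proof (cases "s \<in> J")
    case True
    then have s: "s \<in> {0..eps}" using J by auto
    have "(?f t - ?f s)\<^sup>2 \<le> \<bar>t - s\<bar> * ?D" unfolding D by (rule h1_deriv_Hoelder[OF H1_der[OF u] s t])
    also have "\<dots> \<le> l * ?D" using True J(2) edge_dirichlet_nonneg unfolding J_def by (intro mult_right_mono) auto
    finally have 1: "(?f t - ?f s)\<^sup>2 \<le> l * ?D" .
    \<comment> \<open>This square is the exact slack in the inequality that follows.\<close>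
    have "0 \<le> (?f t - 2 * ?f s)\<^sup>2" by simp
    then have "(?f t)\<^sup>2 \<le> 2 * (?f s)\<^sup>2 + 2 * (?f t - ?f s)\<^sup>2" by (simp add: power2_eq_square algebra_simps)
    then show ?thesis using 1 True by (simp add: pr_def)
  qed simp
  have Jm: "J \<inter> space lborel \<in> sets lborel" by (simp add: J_def)
  have JL: "integrable (Iv eps) (indicator J :: real \<Rightarrow> real)"
    by (intro Iv.integrable_const_bound[of _ 1] measurable_restrict_space1) (auto simp: J_def)
  have Ji: "(\<integral>s. indicator J s \<partial>Iv eps) = l"
  proof -
    have *: "indicator {0..eps} s *\<^sub>R (indicator J s :: real) = indicator J s" for s
      using J(1) by (auto simp: indicator_def)
    have "(\<integral>s. indicator J s \<partial>Iv eps) = (\<integral>s. (indicator J s :: real) \<partial>lborel)"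
      by (subst integral_restrict_space) (simp, simp only: *)
    then show ?thesis using l by (simp add: J_def)
  qed
  have fi: "integrable (Iv eps) (\<lambda>s. (pr eps u (e, s))\<^sup>2)"
    using integrable_EM_slice[OF L2_square_integrable[OF H1_pr_L2[OF _ u]]] eps by simp
  have "(\<integral>s. indicator J s * (?f t)\<^sup>2 \<partial>Iv eps) \<le> (\<integral>s. 2 * (pr eps u (e, s))\<^sup>2 + indicator J s * (2 * l * ?D) \<partial>Iv eps)"
    using JL fi by (intro integral_mono pt) auto
  also have "\<dots> = 2 * edge_mass eps u e + l * (2 * l * ?D)"
    using JL fi Ji by (simp add: edge_mass_def)
  also have "(\<integral>s. indicator J s * (?f t)\<^sup>2 \<partial>Iv eps) = l * (?f t)\<^sup>2" using Ji by simp
  finally show ?thesis using l by (simp add: field_simps)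
qed

lemma sup_bound:
  assumes eps: "0 < eps" and u: "u \<in> H1 eps" and t: "t \<in> {0..eps}" and l: "0 < l" "l \<le> eps"
  shows "(edge_fun eps u e t)\<^sup>2 \<le> 2 / l * Lr_pow eps 2 u + 2 * l * dirichlet eps u"
proof -
  have "edge_mass eps u e \<le> Lr_pow eps 2 u" "edge_dirichlet eps u e \<le> dirichlet eps u"
    using has_sum_member_le[OF edge_mass_has_sum[OF _ u]] has_sum_member_le[OF edge_dirichlet_has_sum[OF u]]
      edge_mass_nonneg edge_dirichlet_nonneg eps by auto
  then have "2 / l * edge_mass eps u e + 2 * l * edge_dirichlet eps u e \<le> 2 / l * Lr_pow eps 2 u + 2 * l * dirichlet eps u"
    using l by (intro add_mono mult_left_mono) auto
  then show ?thesis using edge_sup_bound[OF assms] by (meson order_trans)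
qed

lemma edge_fun_start: "edge_fun eps u e 0 = u (vtx eps (fst e))"
  by (simp add: edge_fun_def vtx_def)

text \<open>The test function that picks out the increment from the start of the edge
  \<open>e\<close> to its point \<open>t\<close>; weak convergence over all edges is applied to
  it.\<close>

lemma ip_EM_indicator:
  assumes G: "G \<in> L2 (EM eps)"
  shows "(\<lambda>x. indicator {e} (fst x) * indicator {0..t} (snd x)) \<in> L2 (EM eps)"
    "ip (EM eps) (\<lambda>x. indicator {e} (fst x) * indicator {0..t} (snd x)) G = ip (Iv eps) (indicator {0..t}) (\<lambda>s. G (e, s))"
proof -
  let ?h = "\<lambda>x :: edge \<times> real. indicator {e} (fst x) * indicator {0..t} (snd x) :: real"
  have hm: "(\<lambda>s. ?h (e', s)) \<in> borel_measurable (Iv eps)" for e'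
    using L2_measurable[OF indicator_L2_Iv[of t eps]] by (intro borel_measurable_times) (simp_all add: borel_measurable_const)
  have i0: "(\<integral>s. (?h (e', s))\<^sup>2 \<partial>Iv eps) = 0" if "e' \<noteq> e" for e' using that by simp
  have "integrable (EM eps) (\<lambda>x. (?h x)\<^sup>2)"
  proof (rule integrable_EM_nonneg)
    show "(\<lambda>s. (?h (e', s))\<^sup>2) \<in> borel_measurable (Iv eps)" for e' using hm[of e'] by simp
    show "integrable (Iv eps) (\<lambda>s. (?h (e', s))\<^sup>2)" for e'
      using hm[of e'] by (intro Iv.integrable_const_bound[of _ 1]) (auto simp: indicator_def)
    show "(\<lambda>e'. \<integral>s. (?h (e', s))\<^sup>2 \<partial>Iv eps) summable_on UNIV"
      using i0 by (subst summable_on_cong_neutral[of "{e}" UNIV _ "\<lambda>e'. \<integral>s. (?h (e', s))\<^sup>2 \<partial>Iv eps"]) auto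
  qed simp
  then show h: "?h \<in> L2 (EM eps)" unfolding L2_def using measurable_EM[OF hm] by simp
  have "((\<lambda>e'. \<integral>s. ?h (e', s) * G (e', s) \<partial>Iv eps) has_sum ip (EM eps) ?h G) UNIV"
    unfolding ip_def by (rule integral_EM[OF L2_mult_integrable[OF h G]])
  then have "((\<lambda>e'. \<integral>s. ?h (e', s) * G (e', s) \<partial>Iv eps) has_sum ip (EM eps) ?h G) {e}"
    by (subst has_sum_cong_neutral[of UNIV "{e}" _ "\<lambda>e'. \<integral>s. ?h (e', s) * G (e', s) \<partial>Iv eps"]) auto
  then have "ip (EM eps) ?h G = (\<integral>s. ?h (e, s) * G (e, s) \<partial>Iv eps)"
    using has_sum_finite[of "{e}" "\<lambda>e'. \<integral>s. ?h (e', s) * G (e', s) \<partial>Iv eps"] has_sum_unique by fastforce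
  then show "ip (EM eps) ?h G = ip (Iv eps) (indicator {0..t}) (\<lambda>s. G (e, s))" by (simp add: ip_def)
qed

text \<open>Derivatives converge weakly along a subsequence, and a diagonal choice makes the values
  converge at all vertices. Every other value is a vertex value plus a pairing of the derivative
  with a fixed L2 function, so the functions converge at every point of the grid and the weak limit
  is the derivative of the limit.\<close>

lemma H1_compactness:
  assumes eps: "0 < eps" and u: "\<And>n. u n \<in> H1 eps"
    and mC: "\<And>n. Lr_pow eps 2 (u n) \<le> C" and dC: "\<And>n. dirichlet eps (u n) \<le> C"
  obtains r v where "strict_mono (r :: nat \<Rightarrow> nat)" "v \<in> H1 eps"
    "\<And>x. x \<in> space (EM eps) \<Longrightarrow> (\<lambda>n. pr eps (u (r n)) x) \<longlonglongrightarrow> pr eps v x"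
    "(\<lambda>n. ip (EM eps) (der eps (u (r n))) (der eps v)) \<longlonglongrightarrow> dirichlet eps v"
proof -
  have eps0: "0 \<le> eps" using eps by simp
  obtain r1 G where r1: "strict_mono (r1 :: nat \<Rightarrow> nat)" and G: "G \<in> L2 (EM eps)"
    and weak: "\<And>f. f \<in> L2 (EM eps) \<Longrightarrow> (\<lambda>n. ip (EM eps) (der eps (u (r1 n))) f) \<longlonglongrightarrow> ip (EM eps) G f"
    using L2_weak_compactness[of "\<lambda>n. der eps (u n)" "EM eps" C] H1_der_L2[OF u] dC dirichlet_eq[OF u] by auto
  define K where "K = 2 / eps * C + 2 * eps * C"
  have K: "(edge_fun eps (u n) e t)\<^sup>2 \<le> K" if "t \<in> {0..eps}" for n e t
  proof -
    have "2 / eps * Lr_pow eps 2 (u n) + 2 * eps * dirichlet eps (u n) \<le> K"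
      unfolding K_def using mC[of n] dC[of n] eps by (intro add_mono mult_left_mono) auto
    then show ?thesis using sup_bound[OF eps u that eps order_refl] by (meson order_trans)
  qed
  have bd: "norm (u (r1 n) (vtx eps z)) \<le> sqrt K" for n z
    using real_sqrt_le_mono[OF K[of 0 "r1 n" "(z, True)"]] eps by (simp add: edge_fun_start)
  have "\<exists>r :: nat \<Rightarrow> nat. strict_mono r \<and> (\<forall>z. \<exists>l. (\<lambda>n. u (r1 (r n)) (vtx eps z)) \<longlonglongrightarrow> l)"
  proof (rule function_convergent_subsequence[of "UNIV :: (int \<times> int) set" "\<lambda>n z. u (r1 n) (vtx eps z)" "sqrt K"])
    fix k :: "nat \<Rightarrow> nat"
    assume "strict_mono k" "\<And>x. x \<in> UNIV \<Longrightarrow> \<exists>l. (\<lambda>n. u (r1 (k n)) (vtx eps x)) \<longlonglongrightarrow> l"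
    then show ?thesis by (intro exI[of _ k] conjI allI) simp_all
  qed (use bd in auto)
  then obtain r2 :: "nat \<Rightarrow> nat" where r2: "strict_mono r2"
    and vl: "\<forall>z. \<exists>l. (\<lambda>n. u (r1 (r2 n)) (vtx eps z)) \<longlonglongrightarrow> l" by (elim exE conjE)
  define r where "r n = r1 (r2 n)" for n
  have r: "strict_mono r" using strict_mono_o[OF r1 r2] by (simp add: r_def[abs_def] o_def)
  have wk: "(\<lambda>n. ip (EM eps) (der eps (u (r n))) f) \<longlonglongrightarrow> ip (EM eps) G f" if "f \<in> L2 (EM eps)" for f
    using LIMSEQ_subseq_LIMSEQ[OF weak[OF that] r2] by (simp add: r_def[abs_def] o_def)
  define w where "w z = lim (\<lambda>n. u (r n) (vtx eps z))" for z
  have w: "(\<lambda>n. u (r n) (vtx eps z)) \<longlonglongrightarrow> w z" for z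
  proof -
    obtain l where "(\<lambda>n. u (r n) (vtx eps z)) \<longlonglongrightarrow> l" using vl unfolding r_def by blast
    then show ?thesis unfolding w_def by (simp add: limI)
  qed
  define V where "V e t = w (fst e) + ip (Iv eps) (indicator {0..t}) (\<lambda>s. G (e, s))" for e t
  have lim: "(\<lambda>n. edge_fun eps (u (r n)) e t) \<longlonglongrightarrow> V e t" if t: "t \<in> {0..eps}" for e t
  proof -
    let ?h = "\<lambda>x. indicator {e} (fst x) * indicator {0..t} (snd x)"
    have "edge_fun eps (u (r n)) e t = u (r n) (vtx eps (fst e)) + ip (EM eps) (der eps (u (r n))) ?h" for n
      using h1_deriv_increment[OF H1_der[OF u] t] ip_EM_indicator(2)[OF H1_der_L2[OF u]]
      by (simp add: edge_fun_start ip_commute[of _ "der eps (u (r n))"])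
    moreover have "V e t = w (fst e) + ip (EM eps) G ?h"
      unfolding V_def using ip_EM_indicator(2)[OF G] by (simp add: ip_commute[of _ G])
    ultimately show ?thesis using tendsto_add[OF w wk[OF ip_EM_indicator(1)[OF G]]] by simp
  qed
  \<comment> \<open>Taking the limit at points of the plane makes the values on edges meeting at a
    vertex agree automatically; off the grid \<open>v\<close> is arbitrary.\<close>
  define v where "v x = lim (\<lambda>n. u (r n) x)" for x
  have v: "edge_fun eps v e t = V e t" if "t \<in> {0..eps}" for e t
    using lim[OF that] by (simp add: edge_fun_pt v_def limI)
  have V0: "V e 0 = w (fst e)" for e
    using LIMSEQ_unique[OF lim[of 0 e]] w[of "fst e"] eps by (simp add: edge_fun_start)
  have d: "h1_deriv 0 eps (edge_fun eps v e) (\<lambda>t. G (e, t))" for e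
    unfolding h1_deriv_iff
  proof (intro conjI ballI)
    show "(\<lambda>t. G (e, t)) \<in> L2 (Iv eps)" by (rule L2_EM_slice[OF G])
    fix t assume t: "t \<in> {0..eps}"
    have "edge_fun eps v e 0 = w (fst e)" using v[of 0 e] V0[of e] eps by simp
    moreover have "edge_fun eps v e t = V e t" by (rule v[OF t])
    ultimately show "edge_fun eps v e t = edge_fun eps v e 0 + ip (Iv eps) (indicator {0..t}) (\<lambda>t. G (e, t))"
      by (simp only: V_def)
  qed
  have cv: "continuous_on (grid eps) v"
    by (rule continuous_on_grid_if_on_edges[OF eps h1_deriv_continuous[OF d]])
  have plim: "(\<lambda>n. pr eps (u (r n)) x) \<longlonglongrightarrow> pr eps v x" if "x \<in> space (EM eps)" for x
    using lim[of "snd x" "fst x"] v[of "snd x" "fst x"] that by (auto simp: pr_def space_EM)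
  have [measurable]: "pr eps v \<in> borel_measurable (EM eps)" "\<And>n. pr eps (u n) \<in> borel_measurable (EM eps)"
    using cv H1_continuous[OF u] by (auto intro: pr_measurable)
  \<comment> \<open>Fatou's lemma: the limit has finite mass, though mass may be lost.\<close>
  have "(\<integral>\<^sup>+x. ennreal ((pr eps v x)\<^sup>2) \<partial>EM eps) = (\<integral>\<^sup>+x. liminf (\<lambda>n. ennreal ((pr eps (u (r n)) x)\<^sup>2)) \<partial>EM eps)"
  proof (rule nn_integral_cong)
    fix x assume "x \<in> space (EM eps)"
    then have "(\<lambda>n. ennreal ((pr eps (u (r n)) x)\<^sup>2)) \<longlonglongrightarrow> ennreal ((pr eps v x)\<^sup>2)"
      by (intro tendsto_ennrealI tendsto_power plim)
    from lim_imp_Liminf[OF _ this] show "ennreal ((pr eps v x)\<^sup>2) = liminf (\<lambda>n. ennreal ((pr eps (u (r n)) x)\<^sup>2))" by simp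
  qed
  also have "\<dots> \<le> liminf (\<lambda>n. \<integral>\<^sup>+x. ennreal ((pr eps (u (r n)) x)\<^sup>2) \<partial>EM eps)"
    by (intro nn_integral_liminf) measurable
  also have "\<dots> \<le> liminf (\<lambda>n. ennreal C)"
  proof (intro Liminf_mono always_eventually allI)
    fix n
    have "(\<integral>\<^sup>+x. ennreal ((pr eps (u (r n)) x)\<^sup>2) \<partial>EM eps) = ennreal (Lr_pow eps 2 (u (r n)))"
      unfolding mass_eq[OF eps0 u] ip_self
      by (intro nn_integral_eq_integral L2_square_integrable H1_pr_L2 eps0 u) simp
    also have "\<dots> \<le> ennreal C" by (intro ennreal_leI mC)
    finally show "(\<integral>\<^sup>+x. ennreal ((pr eps (u (r n)) x)\<^sup>2) \<partial>EM eps) \<le> ennreal C" .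
  qed
  also have "\<dots> = ennreal C" by (simp add: Liminf_const)
  also have "\<dots> < \<infinity>" by simp
  finally have pL: "pr eps v \<in> L2 (EM eps)"
    unfolding L2_def by (auto intro!: integrableI_nonneg)
  have vH: "v \<in> H1 eps" by (rule H1_intro[OF eps0 cv pL G d])
  note ae = der_AE(1)[OF G d]
  note m = L2_measurable[OF H1_der_L2[OF vH]] L2_measurable[OF G] L2_measurable[OF H1_der_L2[OF u]]
  have "(\<lambda>n. ip (EM eps) (der eps (u (r n))) (der eps v)) \<longlonglongrightarrow> ip (EM eps) G (der eps v)"
    by (rule wk[OF H1_der_L2[OF vH]])
  moreover have "ip (EM eps) G (der eps v) = dirichlet eps v"
    unfolding dirichlet_eq[OF vH] using ae m by (intro ip_cong_AE) auto
  ultimately show ?thesis using that[OF r vH plim] by simp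
qed

section \<open>Power nonlinearities\<close>

text \<open>For positive \<open>c\<close> the threshold \<open>X\<close> is the point where
  \<open>c * X powr \<theta>\<close> equals \<open>\<kappa> * X\<close>. Beyond it the linear term
  dominates; below it monotonicity bounds the power by its value at \<open>X\<close>.\<close>

lemma powr_sublinear:
  fixes c \<theta> \<kappa> :: real
  assumes "0 \<le> c" "0 \<le> \<theta>" "\<theta> < 1" "0 < \<kappa>"
  shows "\<exists>K\<ge>0. \<forall>x>0. c * x powr \<theta> \<le> \<kappa> * x + K"
proof -
  define X where "X = (c / \<kappa>) powr (1 / (1 - \<theta>))"
  have "c * x powr \<theta> \<le> \<kappa> * x + c * X powr \<theta>" if x: "x > 0" for x
  proof (cases "X \<le> x")
    case True
    have "X powr (1 - \<theta>) = c / \<kappa>" unfolding X_def using assms by (cases "c = 0") (auto simp: powr_powr)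
    then have "c / \<kappa> \<le> x powr (1 - \<theta>)"
      using powr_mono2[of "1 - \<theta>" X x] True assms by (simp add: X_def)
    then have "c \<le> \<kappa> * x powr (1 - \<theta>)" using assms by (simp add: field_simps)
    then have "c * x powr \<theta> \<le> \<kappa> * x powr (1 - \<theta>) * x powr \<theta>" by (intro mult_right_mono) auto
    also have "\<dots> = \<kappa> * x" using x by (simp add: mult.assoc flip: powr_add)
    finally show ?thesis using assms by (smt (verit) mult_nonneg_nonneg powr_ge_zero)
  next
    case False
    then have "x powr \<theta> \<le> X powr \<theta>" using x assms by (intro powr_mono2) auto
    then have "c * x powr \<theta> \<le> c * X powr \<theta>" using assms by (intro mult_left_mono) auto
    moreover have "0 \<le> \<kappa> * x" using assms x by simp
    ultimately show ?thesis by linarith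
  qed
  then show ?thesis using assms by (intro exI[of _ "c * X powr \<theta>"]) auto
qed

lemma powr_diff_le:
  fixes x y z r :: real
  assumes r: "1 \<le> r" and x: "0 \<le> x" "x \<le> y" and y: "y \<le> z"
  shows "y powr r - x powr r \<le> r * z powr (r - 1) * (y - x)"
proof (cases "x = y")
  case False
  then have xy: "x < y" using x by simp
  have "\<exists>l c. x < c \<and> c < y \<and> DERIV (\<lambda>t. t powr r) c :> l \<and> y powr r - x powr r = (y - x) * l"
  proof (rule MVT[OF xy])
    show "continuous_on {x..y} (\<lambda>t. t powr r)" using x r by (intro continuous_on_powr') (auto intro!: continuous_intros)
    fix c assume "x < c"
    then show "(\<lambda>t. t powr r) differentiable at c"
      unfolding real_differentiable_def using x has_real_derivative_powr[of c r] by auto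
  qed
  then obtain l c where c: "x < c" "c < y" "DERIV (\<lambda>t. t powr r) c :> l" "y powr r - x powr r = (y - x) * l" by blast
  have "l = r * c powr (r - 1)" using c x by (intro DERIV_unique[OF c(3)] has_real_derivative_powr) auto
  also have "\<dots> \<le> r * z powr (r - 1)" using c x y r by (intro mult_left_mono powr_mono2) auto
  finally show ?thesis using c(4) xy by (simp add: mult.commute)
qed simp

text \<open>The error is bounded by a multiple of the product of \<open>\<bar>a\<bar>\<close> and
  \<open>\<bar>b\<bar>\<close>, the quantity whose integral \<open>ip_abs_tendsto_zero\<close> sends
  to zero. With \<open>\<bar>a\<bar>\<close> the smaller one, both \<open>\<bar>a + b\<bar>\<close>
  and \<open>\<bar>b\<bar>\<close> are at most \<open>2 * \<bar>b\<bar>\<close>; the mean value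
  theorem bounds the difference of their powers, and the remaining power of
  \<open>\<bar>a\<bar>\<close> gives the summand 1 in the constant.\<close>

lemma Brezis_Lieb_pointwise:
  fixes a b M r :: real
  assumes r: "2 \<le> r" and a: "\<bar>a\<bar> \<le> M" and b: "\<bar>b\<bar> \<le> M"
  shows "\<bar>\<bar>a + b\<bar> powr r - \<bar>a\<bar> powr r - \<bar>b\<bar> powr r\<bar> \<le> (r * 2 powr (r - 1) + 1) * M powr (r - 2) * (\<bar>a\<bar> * \<bar>b\<bar>)"
proof -
  have *: "\<bar>\<bar>a + b\<bar> powr r - \<bar>a\<bar> powr r - \<bar>b\<bar> powr r\<bar> \<le> (r * 2 powr (r - 1) + 1) * M powr (r - 2) * (\<bar>a\<bar> * \<bar>b\<bar>)"
    if ab: "\<bar>a\<bar> \<le> \<bar>b\<bar>" "\<bar>b\<bar> \<le> M" for a b :: real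
  proof (cases "b = 0")
    case False
    define z where "z = 2 * \<bar>b\<bar>"
    have sq: "t powr r = t powr (r - 1) * t" "t powr (r - 1) = t powr (r - 2) * t" if "0 \<le> t" for t :: real
      using that r powr_add[of t "r - 1" 1] powr_add[of t "r - 2" 1] by (cases "t = 0"; simp)+
    have d: "\<bar>\<bar>a + b\<bar> - \<bar>b\<bar>\<bar> \<le> \<bar>a\<bar>" by linarith
    have "\<bar>\<bar>a + b\<bar> powr r - \<bar>b\<bar> powr r\<bar> \<le> r * z powr (r - 1) * \<bar>\<bar>a + b\<bar> - \<bar>b\<bar>\<bar>"
    proof (cases "\<bar>a + b\<bar> \<le> \<bar>b\<bar>")
      case True
      then have "\<bar>a + b\<bar> powr r \<le> \<bar>b\<bar> powr r" using r by (intro powr_mono2) auto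
      then show ?thesis using powr_diff_le[of r "\<bar>a + b\<bar>" "\<bar>b\<bar>" z] True r by (simp add: z_def)
    next
      case False
      then have "\<bar>b\<bar> powr r \<le> \<bar>a + b\<bar> powr r" using r by (intro powr_mono2) auto
      then show ?thesis using powr_diff_le[of r "\<bar>b\<bar>" "\<bar>a + b\<bar>" z] False r ab by (simp add: z_def)
    qed
    also have "\<dots> \<le> r * z powr (r - 1) * \<bar>a\<bar>" using d r by (intro mult_left_mono) auto
    also have "z powr (r - 1) = 2 powr (r - 1) * (\<bar>b\<bar> powr (r - 2) * \<bar>b\<bar>)"
      unfolding z_def by (subst powr_mult) (simp_all add: sq(2))
    finally have 1: "\<bar>\<bar>a + b\<bar> powr r - \<bar>b\<bar> powr r\<bar> \<le> r * 2 powr (r - 1) * (\<bar>b\<bar> powr (r - 2) * (\<bar>a\<bar> * \<bar>b\<bar>))"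
      by (simp add: mult_ac)
    have bM: "\<bar>b\<bar> powr (r - 2) * (\<bar>a\<bar> * \<bar>b\<bar>) \<le> M powr (r - 2) * (\<bar>a\<bar> * \<bar>b\<bar>)"
      using ab r by (intro mult_right_mono powr_mono2) auto
    have "\<bar>a\<bar> powr r = \<bar>a\<bar> powr (r - 2) * (\<bar>a\<bar> * \<bar>a\<bar>)" using sq[of "\<bar>a\<bar>"] by simp
    also have "\<dots> \<le> M powr (r - 2) * (\<bar>a\<bar> * \<bar>b\<bar>)"
      using ab r by (intro mult_mono powr_mono2) auto
    finally have aM: "\<bar>a\<bar> powr r \<le> M powr (r - 2) * (\<bar>a\<bar> * \<bar>b\<bar>)" .
    have tri: "\<bar>X - Y - Z\<bar> \<le> \<bar>X - Z\<bar> + Y" if "0 \<le> Y" for X Y Z :: real using that by linarith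
    have "\<bar>\<bar>a + b\<bar> powr r - \<bar>a\<bar> powr r - \<bar>b\<bar> powr r\<bar> \<le> r * 2 powr (r - 1) * (\<bar>b\<bar> powr (r - 2) * (\<bar>a\<bar> * \<bar>b\<bar>)) + M powr (r - 2) * (\<bar>a\<bar> * \<bar>b\<bar>)"
      by (rule order_trans[OF tri[OF powr_ge_zero] add_mono[OF 1 aM]])
    also have "\<dots> \<le> r * 2 powr (r - 1) * (M powr (r - 2) * (\<bar>a\<bar> * \<bar>b\<bar>)) + M powr (r - 2) * (\<bar>a\<bar> * \<bar>b\<bar>)"
      using r by (intro add_mono mult_left_mono bM) auto
    finally show ?thesis by (simp add: algebra_simps)
  qed (use ab in auto)
  show ?thesis
  proof (cases "\<bar>a\<bar> \<le> \<bar>b\<bar>")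
    case True then show ?thesis using *[of a b] b by simp
  next
    case False then show ?thesis using *[of b a] a by (simp add: algebra_simps)
  qed
qed

lemma powr_split_le:
  fixes x S r :: real
  assumes "2 \<le> r" "\<bar>x\<bar> \<le> S" shows "\<bar>x\<bar> powr r \<le> S powr (r - 2) * x\<^sup>2"
proof (cases "x = 0")
  case False
  have "\<bar>x\<bar> powr r = \<bar>x\<bar> powr (r - 2) * \<bar>x\<bar> powr 2" by (subst powr_add[symmetric]) simp
  also have "\<dots> \<le> S powr (r - 2) * x\<^sup>2"
    unfolding abs_powr_2 using assms by (intro mult_right_mono powr_mono2) auto
  finally show ?thesis .
qed simp

section \<open>Lebesgue norms of Sobolev functions on the grid\<close>

lemma H1_bounded:
  assumes eps: "0 < eps" and u: "u \<in> H1 eps" and t: "t \<in> {0..eps}"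
  shows "\<bar>edge_fun eps u e t\<bar> \<le> sqrt (2 / eps * Lr_pow eps 2 u + 2 * eps * dirichlet eps u)"
  using real_sqrt_le_mono[OF sup_bound[OF eps u t eps order_refl, of e]] by simp

lemma H1_uniformly_bounded:
  assumes eps: "0 < eps" and u: "u \<in> H1 eps" and C: "Lr_pow eps 2 u \<le> C" "dirichlet eps u \<le> C" and t: "t \<in> {0..eps}"
  shows "\<bar>edge_fun eps u e t\<bar> \<le> sqrt (2 / eps * C + 2 * eps * C)"
proof -
  have "2 / eps * Lr_pow eps 2 u + 2 * eps * dirichlet eps u \<le> 2 / eps * C + 2 * eps * C"
    using C eps by (intro add_mono mult_left_mono) auto
  then show ?thesis using H1_bounded[OF eps u t, of e] real_sqrt_le_mono by (meson order_trans)
qed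

lemma Lr_integrable:
  assumes eps: "0 < eps" and u: "u \<in> H1 eps" and r: "2 \<le> r"
  shows "integrable (EM eps) (\<lambda>x. \<bar>pr eps u x\<bar> powr r)"
proof -
  define S where "S = sqrt (2 / eps * Lr_pow eps 2 u + 2 * eps * dirichlet eps u)"
  have pL: "pr eps u \<in> L2 (EM eps)" using H1_pr_L2[OF _ u] eps by simp
  have "integrable (EM eps) (\<lambda>x. S powr (r - 2) * (pr eps u x)\<^sup>2)"
    using L2_square_integrable[OF pL] by simp
  then show ?thesis
  proof (rule Bochner_Integration.integrable_bound)
    show "AE x in EM eps. norm (\<bar>pr eps u x\<bar> powr r) \<le> norm (S powr (r - 2) * (pr eps u x)\<^sup>2)"
      using H1_bounded[OF eps u] powr_split_le[OF r]
      by (intro AE_I2) (auto simp: space_EM pr_def S_def abs_mult)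
  qed (use L2_measurable[OF pL] in auto)
qed

lemma Lr_nonneg: "0 \<le> Lr_pow eps r u"
  unfolding Lr_pow_def by (intro infsum_nonneg) (simp add: edge_Lr_eq)

lemma dirichlet_nonneg: "0 \<le> dirichlet eps u"
  unfolding dirichlet_def by (intro infsum_nonneg) (simp add: edge_dirichlet_eq)

lemma Lr_le:
  assumes eps: "0 < eps" and u: "u \<in> H1 eps" and r: "2 \<le> r"
    and S: "\<And>e t. t \<in> {0..eps} \<Longrightarrow> \<bar>edge_fun eps u e t\<bar> \<le> S"
  shows "Lr_pow eps r u \<le> S powr (r - 2) * Lr_pow eps 2 u"
proof -
  have pL: "pr eps u \<in> L2 (EM eps)" using H1_pr_L2[OF _ u] eps by simp
  have "(\<integral>x. \<bar>pr eps u x\<bar> powr r \<partial>EM eps) \<le> (\<integral>x. S powr (r - 2) * (pr eps u x)\<^sup>2 \<partial>EM eps)"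
    using L2_square_integrable[OF pL] Lr_integrable[OF eps u r] S powr_split_le[OF r]
    by (intro integral_mono) (auto simp: space_EM pr_def)
  then show ?thesis using Lr_pow_eq[OF Lr_integrable[OF eps u r]] mass_eq[OF _ u] eps by (simp add: ip_self)
qed

lemma Lr_pos:
  assumes eps: "0 < eps" and u: "u \<in> H1 eps" and r: "2 \<le> r" and m: "0 < Lr_pow eps 2 u"
  shows "0 < Lr_pow eps r u"
proof (rule ccontr)
  assume "\<not> ?thesis"
  then have "Lr_pow eps r u = 0" using Lr_nonneg[of eps r u] by linarith
  then have "(\<integral>x. \<bar>pr eps u x\<bar> powr r \<partial>EM eps) = 0"
    using Lr_pow_eq[OF Lr_integrable[OF eps u r]] by simp
  then have "AE x in EM eps. \<bar>pr eps u x\<bar> powr r = 0"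
    by (subst (asm) integral_nonneg_eq_0_iff_AE[OF Lr_integrable[OF eps u r]]) auto
  then have "AE x in EM eps. (pr eps u x)\<^sup>2 = 0" by eventually_elim simp
  then have "Lr_pow eps 2 u = 0" using mass_eq[OF _ u] eps by (simp add: ip_self integral_eq_zero_AE)
  then show False using m by simp
qed

lemma Lr_scale: "Lr_pow eps r (\<lambda>x. a * u x) = \<bar>a\<bar> powr r * Lr_pow eps r u"
proof -
  have "edge_Lr eps r (\<lambda>x. a * u x) e = \<bar>a\<bar> powr r * edge_Lr eps r u e" for e
    by (simp add: edge_Lr_eq pr_def edge_fun_pt abs_mult powr_mult)
  then have "edge_Lr eps r (\<lambda>x. a * u x) = (\<lambda>e. \<bar>a\<bar> powr r * edge_Lr eps r u e)" by auto
  then show ?thesis unfolding Lr_pow_def by (simp add: infsum_cmult_right')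
qed

text \<open>The window of length about \<open>1 / sqrt (1 + D)\<close> balances the two terms of
  \<open>sup_bound\<close>, cut off at the edge length; adding 1 keeps the length finite when the
  Dirichlet energy vanishes. The growth of order one quarter for the sup norm is what coercivity
  needs.\<close>

lemma sup_bound_sqrt:
  assumes eps: "0 < eps" and u: "u \<in> H1 eps" and t: "t \<in> {0..eps}"
  shows "(edge_fun eps u e t)\<^sup>2 \<le> (2 / eps * Lr_pow eps 2 u + 2 * Lr_pow eps 2 u + 2) * sqrt (1 + dirichlet eps u)"
proof -
  define D where "D = dirichlet eps u" define m where "m = Lr_pow eps 2 u"
  have D: "0 \<le> D" and m: "0 \<le> m" unfolding D_def m_def by (auto intro: dirichlet_nonneg Lr_nonneg)
  define s where "s = sqrt (1 + D)"
  have s1: "1 \<le> s" and s2: "s * s = 1 + D" using D by (auto simp: s_def)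
  define l where "l = min eps (1 / s)"
  have l: "0 < l" "l \<le> eps" "l \<le> 1 / s" using eps s1 by (auto simp: l_def)
  have "1 / l \<le> 1 / eps + s" using eps s1 by (auto simp: l_def min_def)
  then have "2 / l * m \<le> (2 / eps + 2 * s) * m" using m by (intro mult_right_mono) (auto simp: field_simps)
  moreover have "2 / eps * m \<le> 2 / eps * m * s" using mult_left_mono[OF s1, of "2 / eps * m"] m eps by simp
  moreover have "2 * l * D \<le> 2 * s"
  proof -
    have "l * D \<le> 1 / s * D" using l D by (intro mult_right_mono) auto
    also have "\<dots> \<le> 1 / s * (s * s)" using s2 s1 by (intro mult_left_mono) auto
    finally show ?thesis using s1 by simp
  qed
  moreover have "(edge_fun eps u e t)\<^sup>2 \<le> 2 / l * m + 2 * l * D"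
    unfolding m_def D_def by (rule sup_bound[OF eps u t l(1,2)])
  ultimately have "(edge_fun eps u e t)\<^sup>2 \<le> 2 / eps * m * s + 2 * s * m + 2 * s" by (simp add: algebra_simps)
  then show ?thesis unfolding D_def[symmetric] m_def[symmetric] s_def[symmetric] by (simp add: algebra_simps)
qed

text \<open>The pointwise inequality is integrated with the limit \<open>v\<close> and the remainder
  \<open>w n\<close>. Both are bounded by \<open>K\<close>, and the remainder tends to zero at every
  point with bounded mass, so the integral of the product of absolute values vanishes in the limit;
  this single limit gives both conclusions.\<close>

lemma Lr_Brezis_Lieb:
  assumes eps: "0 < eps" and r: "2 \<le> r" and u: "\<And>n. u n \<in> H1 eps" and v: "v \<in> H1 eps"
    and mC: "\<And>n. Lr_pow eps 2 (u n) \<le> C" and dC: "\<And>n. dirichlet eps (u n) \<le> C"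
    and lim: "\<And>x. x \<in> space (EM eps) \<Longrightarrow> (\<lambda>n. pr eps (u n) x) \<longlonglongrightarrow> pr eps v x"
  shows "(\<lambda>n. Lr_pow eps r (u n) - Lr_pow eps r (\<lambda>x. u n x - v x) - Lr_pow eps r v) \<longlonglongrightarrow> 0"
    and "(\<lambda>n. ip (EM eps) (pr eps (u n)) (pr eps v)) \<longlonglongrightarrow> Lr_pow eps 2 v"
proof -
  have eps0: "0 \<le> eps" using eps by simp
  define w where "w n x = u n x - v x" for n x
  have w: "w n \<in> H1 eps" and pw: "pr eps (w n) = (\<lambda>x. pr eps (u n) x - pr eps v x)" for n
    unfolding w_def using H1_diff(1,2)[OF eps0 u v] by auto
  note L = H1_pr_L2[OF eps0 u] H1_pr_L2[OF eps0 v] H1_pr_L2[OF eps0 w]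
  define K where "K = sqrt (2 / eps * C + 2 * eps * C) + sqrt (2 / eps * Lr_pow eps 2 v + 2 * eps * dirichlet eps v)"
  have sn: "0 \<le> sqrt (2 / eps * Lr_pow eps 2 v + 2 * eps * dirichlet eps v)"
    using Lr_nonneg[of eps 2 v] dirichlet_nonneg[of eps v] eps by simp
  have C0: "0 \<le> C" using mC[of 0] Lr_nonneg[of eps 2 "u 0"] by linarith
  have bu: "\<bar>pr eps (u n) x\<bar> \<le> sqrt (2 / eps * C + 2 * eps * C)" if "x \<in> space (EM eps)" for n x
    using that H1_uniformly_bounded[OF eps u mC dC, of "snd x" n "fst x"] by (auto simp: space_EM pr_def)
  have bv: "\<bar>pr eps v x\<bar> \<le> sqrt (2 / eps * Lr_pow eps 2 v + 2 * eps * dirichlet eps v)" if "x \<in> space (EM eps)" for x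
    using that H1_bounded[OF eps v, of "snd x" "fst x"] by (auto simp: space_EM pr_def)
  have bw: "\<bar>pr eps (w n) x\<bar> \<le> K" and bvK: "\<bar>pr eps v x\<bar> \<le> K" if "x \<in> space (EM eps)" for n x
    using bu[OF that, of n] bv[OF that] C0 eps unfolding K_def pw by (auto intro: order_trans)
  have mw: "sqnorm (EM eps) (pr eps (w n)) \<le> 2 * C + 2 * Lr_pow eps 2 v" for n
  proof -
    have "\<bar>ip (EM eps) (pr eps (u n)) (pr eps v)\<bar> \<le> sqrt C * sqrt (Lr_pow eps 2 v)"
      using mC[of n] by (intro ip_bound L) (auto simp: mass_eq[OF eps0 u] mass_eq[OF eps0 v])
    also have "\<dots> \<le> (C + Lr_pow eps 2 v) / 2"
      using arith_geo_mean_sqrt[OF C0 Lr_nonneg[of eps 2 v]] by (simp add: real_sqrt_mult)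
    finally show ?thesis using mC[of n] H1_diff(4)[OF eps0 u[of n] v] mass_eq[OF eps0 w[of n]] unfolding w_def by auto
  qed
  have lw: "(\<lambda>n. pr eps (w n) x) \<longlonglongrightarrow> 0" if "x \<in> space (EM eps)" for x
    unfolding pw using lim[OF that] by (simp add: LIM_zero_iff)
  have z: "(\<lambda>n. \<integral>x. \<bar>pr eps v x\<bar> * \<bar>pr eps (w n) x\<bar> \<partial>EM eps) \<longlonglongrightarrow> 0"
    by (rule ip_abs_tendsto_zero[OF L(2) L(3) mw bw lw])
  define B where "B = (r * 2 powr (r - 1) + 1) * K powr (r - 2)"
  show "(\<lambda>n. Lr_pow eps r (u n) - Lr_pow eps r (\<lambda>x. u n x - v x) - Lr_pow eps r v) \<longlonglongrightarrow> 0"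
  proof (rule Lim_null_comparison)
    show "(\<lambda>n. B * (\<integral>x. \<bar>pr eps v x\<bar> * \<bar>pr eps (w n) x\<bar> \<partial>EM eps)) \<longlonglongrightarrow> 0"
      using tendsto_mult_right_zero[OF z] .
    show "\<forall>\<^sub>F n in sequentially. norm (Lr_pow eps r (u n) - Lr_pow eps r (\<lambda>x. u n x - v x) - Lr_pow eps r v) \<le>
        B * (\<integral>x. \<bar>pr eps v x\<bar> * \<bar>pr eps (w n) x\<bar> \<partial>EM eps)"
    proof (intro always_eventually allI)
      fix n
      let ?F = "\<lambda>x. \<bar>pr eps (u n) x\<bar> powr r - \<bar>pr eps (w n) x\<bar> powr r - \<bar>pr eps v x\<bar> powr r"
      note I = Lr_integrable[OF eps u[of n] r] Lr_integrable[OF eps w[of n] r] Lr_integrable[OF eps v r]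
      have eq: "Lr_pow eps r (u n) - Lr_pow eps r (w n) - Lr_pow eps r v = (\<integral>x. ?F x \<partial>EM eps)"
        unfolding I[THEN Lr_pow_eq] using I by simp
      have le1: "norm (\<integral>x. ?F x \<partial>EM eps) \<le> (\<integral>x. norm (?F x) \<partial>EM eps)" by (rule integral_norm_bound)
      have le2: "(\<integral>x. norm (?F x) \<partial>EM eps) \<le> (\<integral>x. B * (\<bar>pr eps v x\<bar> * \<bar>pr eps (w n) x\<bar>) \<partial>EM eps)"
      proof (rule integral_mono)
        show "integrable (EM eps) (\<lambda>x. norm (?F x))"
          by (intro Bochner_Integration.integrable_norm Bochner_Integration.integrable_diff I)
        show "integrable (EM eps) (\<lambda>x. B * (\<bar>pr eps v x\<bar> * \<bar>pr eps (w n) x\<bar>))"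
          using L2_mult_integrable[OF L2_abs[OF L(2)] L2_abs[OF L(3)[of n]]] by simp
        fix x assume x: "x \<in> space (EM eps)"
        have "pr eps (u n) x = pr eps v x + pr eps (w n) x" by (simp add: pw)
        moreover have "\<bar>\<bar>pr eps v x + pr eps (w n) x\<bar> powr r - \<bar>pr eps v x\<bar> powr r - \<bar>pr eps (w n) x\<bar> powr r\<bar>
            \<le> B * (\<bar>pr eps v x\<bar> * \<bar>pr eps (w n) x\<bar>)"
          unfolding B_def by (rule Brezis_Lieb_pointwise[OF r bvK[OF x] bw[OF x]])
        ultimately show "norm (?F x) \<le> B * (\<bar>pr eps v x\<bar> * \<bar>pr eps (w n) x\<bar>)" by (simp add: algebra_simps)
      qed
      have "norm (Lr_pow eps r (u n) - Lr_pow eps r (w n) - Lr_pow eps r v) \<le>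
        B * (\<integral>x. \<bar>pr eps v x\<bar> * \<bar>pr eps (w n) x\<bar> \<partial>EM eps)"
        unfolding eq using order_trans[OF le1 le2] by simp
      then show "norm (Lr_pow eps r (u n) - Lr_pow eps r (\<lambda>x. u n x - v x) - Lr_pow eps r v) \<le>
        B * (\<integral>x. \<bar>pr eps v x\<bar> * \<bar>pr eps (w n) x\<bar> \<partial>EM eps)"
        unfolding w_def[abs_def] .
    qed
  qed
  have "(\<lambda>n. ip (EM eps) (pr eps (w n)) (pr eps v)) \<longlonglongrightarrow> 0"
  proof (rule Lim_null_comparison[OF _ z], intro always_eventually allI)
    fix n
    show "norm (ip (EM eps) (pr eps (w n)) (pr eps v)) \<le> (\<integral>x. \<bar>pr eps v x\<bar> * \<bar>pr eps (w n) x\<bar> \<partial>EM eps)"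
      unfolding ip_def using integral_norm_bound[of "EM eps" "\<lambda>x. pr eps (w n) x * pr eps v x"]
      by (simp add: abs_mult mult.commute)
  qed
  moreover have "ip (EM eps) (pr eps (w n)) (pr eps v) = ip (EM eps) (pr eps (u n)) (pr eps v) - Lr_pow eps 2 v" for n
    unfolding pw mass_eq[OF eps0 v] using L by (simp add: ip_diff_left)
  ultimately show "(\<lambda>n. ip (EM eps) (pr eps (u n)) (pr eps v)) \<longlonglongrightarrow> Lr_pow eps 2 v" by (simp add: LIM_zero_iff)
qed

section \<open>Existence of ground states at negative level\<close>

text \<open>The argument is shifted forward, so the edge \<open>e\<close> of the translate carries
  what \<open>u\<close> has on \<open>shift_edge k e\<close>: translating by the base point of an
  edge moves that edge to the origin.\<close>

definition translate :: "real \<Rightarrow> int \<times> int \<Rightarrow> (real \<times> real \<Rightarrow> real) \<Rightarrow> real \<times> real \<Rightarrow> real" where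
  "translate eps k u x = u (fst x + eps * of_int (fst k), snd x + eps * of_int (snd k))"

definition shift_edge :: "int \<times> int \<Rightarrow> edge \<Rightarrow> edge" where
  "shift_edge k e = ((fst (fst e) + fst k, snd (fst e) + snd k), snd e)"

lemma edge_fun_translate: "edge_fun eps (translate eps k u) e = edge_fun eps u (shift_edge k e)"
  by (auto simp: edge_fun_def translate_def shift_edge_def algebra_simps)

lemma bij_shift_edge: "bij (shift_edge k)"
  by (rule o_bij[of "shift_edge (- fst k, - snd k)"]) (auto simp: shift_edge_def fun_eq_iff)

text \<open>All quantities are sums over edges of terms seen through \<open>edge_fun\<close>, so the
  bijection \<open>shift_edge\<close> merely reindexes them.\<close>

lemma translate_H1:
  assumes u: "u \<in> H1 eps"
  shows "translate eps k u \<in> H1 eps" "Lr_pow eps r (translate eps k u) = Lr_pow eps r u"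
    "dirichlet eps (translate eps k u) = dirichlet eps u"
    "edge_mass eps (translate eps k u) e = edge_mass eps u (shift_edge k e)"
proof -
  have L: "edge_Lr eps r (translate eps k u) = (\<lambda>e. edge_Lr eps r u (shift_edge k e))" for r
    by (simp add: edge_Lr_def[abs_def] edge_fun_translate)
  have D: "edge_dirichlet eps (translate eps k u) = (\<lambda>e. edge_dirichlet eps u (shift_edge k e))"
    by (simp add: edge_dirichlet_def[abs_def] edge_fun_translate)
  have "continuous_on (grid eps) (translate eps k u)" unfolding translate_def
  proof (rule continuous_on_compose2[OF H1_continuous[OF u]])
    have d: "eps * of_int i + eps * of_int j = eps * of_int (i + j)" for i j by (simp add: distrib_left)
    show "(\<lambda>x. (fst x + eps * of_int (fst k), snd x + eps * of_int (snd k))) ` grid eps \<subseteq> grid eps"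
    proof
      fix y assume "y \<in> (\<lambda>x. (fst x + eps * of_int (fst k), snd x + eps * of_int (snd k))) ` grid eps"
      then obtain x where x: "x \<in> grid eps" "y = (fst x + eps * of_int (fst k), snd x + eps * of_int (snd k))" by blast
      then have "(\<exists>i::int. fst x = eps * of_int i) \<or> (\<exists>i::int. snd x = eps * of_int i)"
        unfolding grid_def by (simp add: case_prod_beta)
      then have "(\<exists>i. fst y = eps * of_int (i + fst k)) \<or> (\<exists>i. snd y = eps * of_int (i + snd k))"
        unfolding x(2) by (auto simp only: fst_conv snd_conv d)
      then show "y \<in> grid eps" unfolding grid_def by (simp only: case_prod_beta mem_Collect_eq) blast
    qed
  qed (auto intro!: continuous_intros)
  moreover have "(\<lambda>e. f (shift_edge k e)) summable_on UNIV \<longleftrightarrow> f summable_on UNIV" for f :: "edge \<Rightarrow> real"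
    by (rule summable_on_reindex_bij_betw[OF bij_shift_edge])
  ultimately show "translate eps k u \<in> H1 eps"
    using u unfolding H1_def L D mem_Collect_eq edge_fun_translate by blast
  show "Lr_pow eps r (translate eps k u) = Lr_pow eps r u"
    unfolding Lr_pow_def L by (rule infsum_reindex_bij_betw[OF bij_shift_edge])
  show "dirichlet eps (translate eps k u) = dirichlet eps u"
    unfolding dirichlet_def D by (rule infsum_reindex_bij_betw[OF bij_shift_edge])
  show "edge_mass eps (translate eps k u) e = edge_mass eps u (shift_edge k e)"
    by (simp add: edge_mass_def pr_def edge_fun_translate)
qed

lemma vertex_value: "u (vtx eps z) = pr eps u ((z, True), 0)"
  by (simp add: pr_def edge_fun_start)

section \<open>The energy under scaling, coercivity and comparison with the level\<close>

locale grid_nls =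
  fixes p q \<alpha> \<beta> eps :: real
  assumes p: "2 < p" "p < 6" and q: "2 < q" "q < 4" and \<alpha>: "0 < \<alpha>" and \<beta>: "0 < \<beta>" and eps: "0 < eps"
begin

abbreviation "E \<equiv> energy p q \<alpha> \<beta> eps"
abbreviation "L \<equiv> ground_level p q \<alpha> \<beta> eps"
abbreviation "mass \<equiv> Lr_pow eps 2"
abbreviation "D \<equiv> dirichlet eps"
abbreviation "Q V u \<equiv> (\<Sum>v\<in>V. \<bar>u (vtx eps v)\<bar> powr q)"

lemma eps0: "0 \<le> eps" using eps by simp

lemma E_def: "E V u = D u / 2 - \<alpha> / p * Lr_pow eps p u - \<beta> / q * Q V u"
  by (simp add: energy_def)

lemma E_scale:
  assumes u: "u \<in> H1 eps" and a: "0 \<le> a"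
  shows "E V (\<lambda>x. a * u x) = a\<^sup>2 * D u / 2 - \<alpha> / p * (a powr p * Lr_pow eps p u) - \<beta> / q * (a powr q * Q V u)"
  using a by (simp add: E_def H1_scale[OF eps0 u] Lr_scale abs_mult powr_mult sum_distrib_left)

lemma Q_nonneg: "0 \<le> Q V u" by (intro sum_nonneg) simp

text \<open>The superquadratic gain is kept for the p-term only: it is strictly positive for every
  function of positive mass, while the point term may vanish on \<open>V\<close>.\<close>

lemma E_scale_le:
  assumes u: "u \<in> H1 eps" and a: "1 \<le> a"
  shows "E V (\<lambda>x. a * u x) \<le> a\<^sup>2 * E V u - \<alpha> / p * ((a powr p - a\<^sup>2) * Lr_pow eps p u)"
proof -
  have "a\<^sup>2 \<le> a powr q" using powr_mono[of 2 q a] a q by simp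
  then have "\<beta> / q * (a\<^sup>2 * Q V u) \<le> \<beta> / q * (a powr q * Q V u)"
    using Q_nonneg \<beta> q by (intro mult_left_mono mult_right_mono) auto
  moreover have "E V (\<lambda>x. a * u x) = a\<^sup>2 * D u / 2 - \<alpha> / p * (a powr p * Lr_pow eps p u) - \<beta> / q * (a powr q * Q V u)"
    using a by (intro E_scale[OF u]) simp
  moreover have "a\<^sup>2 * E V u - \<alpha> / p * ((a powr p - a\<^sup>2) * Lr_pow eps p u) =
      a\<^sup>2 * D u / 2 - \<alpha> / p * (a powr p * Lr_pow eps p u) - \<beta> / q * (a\<^sup>2 * Q V u)"
    unfolding E_def by (simp add: algebra_simps)
  ultimately show ?thesis by linarith
qed

text \<open>With \<open>x = 1 + D u\<close>, the sup bound makes the p-term grow like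
  \<open>x\<close> to the power (p - 2)/4 and the point term like \<open>x\<close> to the power q/4.
  Both powers are below 1 since p < 6 and q < 4, so each term is absorbed by \<open>x / 8\<close>
  plus a constant, leaving a quarter of the Dirichlet energy.\<close>

lemma coercive:
  assumes V: "finite V" and mu: "0 \<le> \<mu>"
  shows "\<exists>K. \<forall>u\<in>H1 eps. mass u \<le> \<mu> \<longrightarrow> D u / 4 - K \<le> E V u"
proof -
  define A where "A = 2 / eps * \<mu> + 2 * \<mu> + 2"
  have A: "0 < A" using mu eps unfolding A_def by (simp add: add_nonneg_pos)
  have nn: "0 \<le> \<alpha> / p * (\<mu> * A powr ((p - 2) / 2))" "0 \<le> \<beta> / q * (card V * A powr (q / 2))"
    using \<alpha> \<beta> p q mu by auto
  obtain K1 where K1: "\<And>x. 0 < x \<Longrightarrow> \<alpha> / p * (\<mu> * A powr ((p - 2) / 2)) * x powr ((p - 2) / 4) \<le> 1/8 * x + K1"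
    using powr_sublinear[OF nn(1), of "(p - 2) / 4" "1/8"] p by auto
  obtain K2 where K2: "\<And>x. 0 < x \<Longrightarrow> \<beta> / q * (card V * A powr (q / 2)) * x powr (q / 4) \<le> 1/8 * x + K2"
    using powr_sublinear[OF nn(2), of "q / 4" "1/8"] q by auto
  have "D u / 4 - (1/4 + K1 + K2) \<le> E V u" if u: "u \<in> H1 eps" and m: "mass u \<le> \<mu>" for u
  proof -
    define x where "x = 1 + D u"
    have x: "1 \<le> x" unfolding x_def using dirichlet_nonneg[of eps u] by simp
    define S where "S = sqrt (A * sqrt x)"
    have S: "S powr r = A powr (r / 2) * x powr (r / 4)" if "0 \<le> r" for r
      unfolding S_def using A x by (simp add: powr_half_sqrt[symmetric] powr_powr powr_mult)
    have bd: "\<bar>edge_fun eps u e t\<bar> \<le> S" if t: "t \<in> {0..eps}" for e t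
    proof -
      have "(edge_fun eps u e t)\<^sup>2 \<le> (2 / eps * mass u + 2 * mass u + 2) * sqrt x"
        unfolding x_def by (rule sup_bound_sqrt[OF eps u t])
      also have "\<dots> \<le> A * sqrt x"
      proof (rule mult_right_mono)
        have "2 / eps * mass u \<le> 2 / eps * \<mu>" using m eps by (intro mult_left_mono) auto
        then show "2 / eps * mass u + 2 * mass u + 2 \<le> A" using m unfolding A_def by linarith
      qed (use x in simp)
      finally show ?thesis unfolding S_def using real_sqrt_le_mono by fastforce
    qed
    have "Lr_pow eps p u \<le> S powr (p - 2) * mass u" using p by (intro Lr_le[OF eps u] bd) auto
    also have "\<dots> \<le> S powr (p - 2) * \<mu>" using m by (intro mult_left_mono) auto
    finally have "\<alpha> / p * Lr_pow eps p u \<le> \<alpha> / p * (S powr (p - 2) * \<mu>)" using \<alpha> p by (intro mult_left_mono) auto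
    also have "\<dots> = \<alpha> / p * (\<mu> * A powr ((p - 2) / 2)) * x powr ((p - 2) / 4)" using S[of "p - 2"] p by simp
    also have "\<dots> \<le> 1/8 * x + K1" using K1 x by simp
    finally have P: "\<alpha> / p * Lr_pow eps p u \<le> 1/8 * x + K1" .
    have "Q V u \<le> (\<Sum>v\<in>V. S powr q)"
      using bd[of 0] eps q by (intro sum_mono powr_mono2) (auto simp: edge_fun_start dest: spec[of _ "(v, True)" for v])
    then have "\<beta> / q * Q V u \<le> \<beta> / q * (card V * S powr q)" using \<beta> q by (intro mult_left_mono) auto
    also have "\<dots> = \<beta> / q * (card V * A powr (q / 2)) * x powr (q / 4)" using S[of q] q by simp
    also have "\<dots> \<le> 1/8 * x + K2" using K2 x by simp
    finally have "\<beta> / q * Q V u \<le> 1/8 * x + K2" .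
    then show ?thesis using P x_def unfolding E_def by linarith
  qed
  then show ?thesis by blast
qed

lemma H1_massD: "u \<in> H1_mass eps \<mu> \<Longrightarrow> u \<in> H1 eps" "u \<in> H1_mass eps \<mu> \<Longrightarrow> mass u = \<mu>"
  by (auto simp: H1_mass_def)

lemma E_bdd_below: assumes V: "finite V" shows "bdd_below (E V ` H1_mass eps \<mu>)"
proof (cases "0 \<le> \<mu>")
  case True
  then obtain K where K: "\<And>u. u \<in> H1 eps \<Longrightarrow> mass u \<le> \<mu> \<Longrightarrow> D u / 4 - K \<le> E V u" using coercive[OF V] by blast
  have "- K \<le> E V u" if "u \<in> H1_mass eps \<mu>" for u
    using K[OF H1_massD(1)[OF that]] H1_massD(2)[OF that] dirichlet_nonneg[of eps u] by simp
  then show ?thesis by (rule bdd_belowI2)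
next
  case False
  then have "H1_mass eps \<mu> = {}" using Lr_nonneg[of eps 2] by (auto simp: H1_mass_def)
  then show ?thesis by simp
qed

lemma L_le: "finite V \<Longrightarrow> u \<in> H1_mass eps \<mu> \<Longrightarrow> L V \<mu> \<le> E V u"
  unfolding ground_level_def by (intro cINF_lower E_bdd_below)

lemma minimizing_sequence:
  assumes V: "finite V" and ne: "H1_mass eps \<mu> \<noteq> {}"
  obtains u where "\<And>n. u n \<in> H1_mass eps \<mu>" "(\<lambda>n. E V (u n)) \<longlonglongrightarrow> L V \<mu>"
proof -
  have "\<exists>u. u \<in> H1_mass eps \<mu> \<and> E V u < L V \<mu> + 1 / real (Suc n)" for n
    using cINF_less_iff[OF ne E_bdd_below[OF V], of "L V \<mu> + 1 / real (Suc n)"] unfolding ground_level_def by auto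
  then obtain u where u: "\<And>n. u n \<in> H1_mass eps \<mu>" "\<And>n. E V (u n) < L V \<mu> + 1 / real (Suc n)" by metis
  have "(\<lambda>n. E V (u n)) \<longlonglongrightarrow> L V \<mu>"
  proof (rule tendsto_sandwich)
    show "(\<lambda>n. L V \<mu>) \<longlonglongrightarrow> L V \<mu>" by simp
    show "(\<lambda>n. L V \<mu> + 1 / real (Suc n)) \<longlonglongrightarrow> L V \<mu>"
      using tendsto_add[OF tendsto_const LIMSEQ_Suc[OF lim_1_over_n]] by simp
  qed (use L_le[OF V u(1)] u(2) in \<open>auto intro!: always_eventually less_imp_le\<close>)
  with u(1) that show ?thesis by blast
qed

lemma scaled_mass:
  assumes u: "u \<in> H1 eps" and m: "0 < mass u" and \<mu>: "0 < \<mu>"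
  shows "(\<lambda>x. sqrt (\<mu> / mass u) * u x) \<in> H1_mass eps \<mu>"
  using H1_scale[OF eps0 u, of "sqrt (\<mu> / mass u)"] m \<mu> by (simp add: H1_mass_def)

text \<open>Multiply \<open>u\<close> by \<open>a = sqrt (\<mu> / mass u)\<close>, at least 1, to
  reach mass \<open>\<mu>\<close>. The result has energy at least the level, and by
  \<open>E_scale_le\<close> at most \<open>a\<close> squared times the energy of \<open>u\<close>
  minus the gain of the p-term, which is positive when \<open>a > 1\<close>.\<close>

lemma E_ge_mass_fraction:
  assumes V: "finite V" and u: "u \<in> H1 eps" and m: "0 < mass u" "mass u \<le> \<mu>"
  shows "mass u / \<mu> * L V \<mu> \<le> E V u" "mass u < \<mu> \<Longrightarrow> mass u / \<mu> * L V \<mu> < E V u"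
proof -
  have \<mu>: "0 < \<mu>" using m by simp
  define a where "a = sqrt (\<mu> / mass u)"
  have a2: "a\<^sup>2 = \<mu> / mass u" unfolding a_def using m \<mu> by simp
  have le: "L V \<mu> \<le> E V (\<lambda>x. a * u x)" unfolding a_def by (intro L_le V scaled_mass u m \<mu>)
  define R where "R = \<alpha> / p * ((a powr p - a\<^sup>2) * Lr_pow eps p u)"
  have a1: "1 \<le> a" unfolding a_def using m by simp
  have "L V \<mu> \<le> \<mu> / mass u * E V u - R"
    using le E_scale_le[OF u a1, of V] unfolding a2 R_def[unfolded a2] by linarith
  then have "mass u / \<mu> * (L V \<mu> + R) \<le> mass u / \<mu> * (\<mu> / mass u * E V u)"
    using m \<mu> by (intro mult_left_mono) auto
  then have main: "mass u / \<mu> * L V \<mu> + mass u / \<mu> * R \<le> E V u" using m \<mu> by (simp add: distrib_left)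
  have P: "0 < Lr_pow eps p u" using Lr_pos[OF eps u _ m(1)] p by simp
  have "a\<^sup>2 \<le> a powr p" using powr_mono[of 2 p a] a1 p by simp
  then have "0 \<le> R" unfolding R_def using \<alpha> p P by (intro mult_nonneg_nonneg) auto
  then have "0 \<le> mass u / \<mu> * R" using m \<mu> by (intro mult_nonneg_nonneg) auto
  then show "mass u / \<mu> * L V \<mu> \<le> E V u" using main by linarith
  show "mass u / \<mu> * L V \<mu> < E V u" if "mass u < \<mu>"
  proof -
    have "1 < a" unfolding a_def using m that by simp
    then have "a\<^sup>2 < a powr p" using powr_less_mono[of 2 p a] p by simp
    then have "0 < mass u / \<mu> * R" unfolding R_def using \<alpha> p P m \<mu> by (intro mult_pos_pos) auto
    then show ?thesis using main by linarith
  qed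
qed

text \<open>If the limit carried only part of the mass, the energy would split into that of the limit and that of
  the remainder, and each part lies above its mass fraction of the level, the first one strictly.\<close>

lemma minimizer_of_nonzero_limit:
  assumes V: "finite V" and \<mu>: "0 < \<mu>" and Lneg: "L V \<mu> < 0"
    and u: "\<And>n. u n \<in> H1_mass eps \<mu>" and Eu: "(\<lambda>n. E V (u n)) \<longlonglongrightarrow> L V \<mu>" and DC: "\<And>n. D (u n) \<le> C"
    and v: "v \<in> H1 eps" and lim: "\<And>x. x \<in> space (EM eps) \<Longrightarrow> (\<lambda>n. pr eps (u n) x) \<longlonglongrightarrow> pr eps v x"
    and dlim: "(\<lambda>n. ip (EM eps) (der eps (u n)) (der eps v)) \<longlonglongrightarrow> D v" and mv: "0 < mass v"
  shows "v \<in> H1_mass eps \<mu>" "E V v = L V \<mu>"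
proof -
  note uH = H1_massD(1)[OF u] and um = H1_massD(2)[OF u]
  define w where "w n x = u n x - v x" for n x
  have wH: "w n \<in> H1 eps" for n unfolding w_def using H1_diff(1)[OF eps0 uH v] .
  define C' where "C' = max \<mu> (max C (max (mass v) (D v)))"
  have C': "mass (u n) \<le> C'" "D (u n) \<le> C'" "mass v \<le> C'" "D v \<le> C'" for n
    using um DC[of n] unfolding C'_def by auto
  note BL = Lr_Brezis_Lieb[OF eps _ uH v C'(1,2) lim]
  have massw: "mass (w n) = \<mu> - 2 * ip (EM eps) (pr eps (u n)) (pr eps v) + mass v" for n
    unfolding w_def using H1_diff(4)[OF eps0 uH v] um by simp
  have mlim: "(\<lambda>n. mass (w n)) \<longlonglongrightarrow> \<mu> - mass v"
  proof -
    have "(\<lambda>n. \<mu> - 2 * ip (EM eps) (pr eps (u n)) (pr eps v) + mass v) \<longlonglongrightarrow> \<mu> - 2 * mass v + mass v"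
      by (intro tendsto_intros BL(2)[of 2]) simp
    then show ?thesis unfolding massw by simp
  qed
  have zspace: "((z, True), 0) \<in> space (EM eps)" for z using eps by (simp add: space_EM)
  have ulim: "(\<lambda>n. u n (vtx eps z)) \<longlonglongrightarrow> v (vtx eps z)" for z
    unfolding vertex_value using lim[OF zspace] .
  have wlim: "(\<lambda>n. w n (vtx eps z)) \<longlonglongrightarrow> 0" for z
    unfolding w_def using ulim by (simp add: LIM_zero_iff)
  have q0: "q > 0" using q by simp
  have Qu: "(\<lambda>n. Q V (u n)) \<longlonglongrightarrow> Q V v"
    using q0 by (intro tendsto_sum tendsto_powr' tendsto_rabs ulim tendsto_const) auto
  have Qw: "(\<lambda>n. Q V (w n)) \<longlonglongrightarrow> 0"
  proof -
    have "(\<lambda>n. Q V (w n)) \<longlonglongrightarrow> (\<Sum>z\<in>V. \<bar>0\<bar> powr q)"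
      using q0 by (intro tendsto_sum tendsto_powr' tendsto_rabs wlim tendsto_const) auto
    then show ?thesis by simp
  qed
  \<comment> \<open>The Dirichlet part splits by weak convergence of derivatives, the p-term by the
    Brezis-Lieb lemma, and the point terms because \<open>V\<close> is finite and vertex values
    converge.\<close>
  have split: "(\<lambda>n. E V (u n) - E V (w n) - E V v) \<longlonglongrightarrow> 0"
  proof -
    have Dw: "D (w n) = D (u n) - 2 * ip (EM eps) (der eps (u n)) (der eps v) + D v" for n
      unfolding w_def using H1_diff(3)[OF eps0 uH v] .
    have "E V (u n) - E V (w n) - E V v = (ip (EM eps) (der eps (u n)) (der eps v) - D v)
        - \<alpha> / p * (Lr_pow eps p (u n) - Lr_pow eps p (w n) - Lr_pow eps p v) - \<beta> / q * (Q V (u n) - Q V (w n) - Q V v)" for n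
      unfolding E_def Dw by (simp add: algebra_simps add_divide_distrib diff_divide_distrib)
    moreover have "(\<lambda>n. Lr_pow eps p (u n) - Lr_pow eps p (w n) - Lr_pow eps p v) \<longlonglongrightarrow> 0"
      unfolding w_def[abs_def] using p by (intro BL(1)) simp
    then have "(\<lambda>n. (ip (EM eps) (der eps (u n)) (der eps v) - D v)
        - \<alpha> / p * (Lr_pow eps p (u n) - Lr_pow eps p (w n) - Lr_pow eps p v) - \<beta> / q * (Q V (u n) - Q V (w n) - Q V v))
        \<longlonglongrightarrow> (D v - D v) - \<alpha> / p * 0 - \<beta> / q * (Q V v - 0 - Q V v)"
      by (intro tendsto_diff tendsto_mult tendsto_const dlim Qu Qw)
    ultimately show ?thesis by simp
  qed
  have Ew: "(\<lambda>n. E V (w n)) \<longlonglongrightarrow> L V \<mu> - E V v"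
  proof -
    have "(\<lambda>n. E V (u n) - (E V (u n) - E V (w n) - E V v) - E V v) \<longlonglongrightarrow> L V \<mu> - 0 - E V v"
      by (intro tendsto_diff tendsto_const Eu split)
    then show ?thesis by simp
  qed
  have "0 \<le> \<mu> - mass v" by (rule LIMSEQ_le_const[OF mlim]) (auto simp: Lr_nonneg)
  moreover have "\<not> mass v < \<mu>"
  proof
    assume less: "mass v < \<mu>"
    \<comment> \<open>The limit \<open>\<mu> - mass v\<close> lies strictly between 0 and
      \<open>\<mu>\<close>, so the remainders are eventually admissible for the comparison.\<close>
    have "\<forall>\<^sub>F n in sequentially. 0 < mass (w n)" "\<forall>\<^sub>F n in sequentially. mass (w n) < \<mu>"
      using order_tendstoD(1)[OF mlim, of 0] order_tendstoD(2)[OF mlim, of \<mu>] less mv by auto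
    then have "\<forall>\<^sub>F n in sequentially. mass (w n) / \<mu> * L V \<mu> \<le> E V (w n)"
    proof eventually_elim
      case (elim n)
      then show ?case using E_ge_mass_fraction(1)[OF V wH[of n]] by simp
    qed
    moreover have "(\<lambda>n. mass (w n) / \<mu> * L V \<mu>) \<longlonglongrightarrow> (\<mu> - mass v) / \<mu> * L V \<mu>"
      by (intro tendsto_mult tendsto_divide mlim tendsto_const) (use \<mu> in auto)
    ultimately have "(\<mu> - mass v) / \<mu> * L V \<mu> \<le> L V \<mu> - E V v"
      using tendsto_le[OF sequentially_bot Ew] by blast
    moreover have "mass v / \<mu> * L V \<mu> < E V v" using E_ge_mass_fraction(2)[OF V v mv] less by simp
    moreover have "(\<mu> - mass v) / \<mu> * L V \<mu> + mass v / \<mu> * L V \<mu> = L V \<mu>" using \<mu> by (simp add: field_simps)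
    ultimately show False by linarith
  qed
  ultimately have mv_eq: "mass v = \<mu>" by simp
  then show vm: "v \<in> H1_mass eps \<mu>" using v by (simp add: H1_mass_def)
  \<comment> \<open>With the full mass in the limit, the remainders have vanishing mass and bounded
    sup norm, so their nonlinear terms vanish and their energies have a nonnegative limit.\<close>
  define S where "S = 2 * sqrt (2 / eps * C' + 2 * eps * C')"
  have Sb: "\<bar>edge_fun eps (w n) e t\<bar> \<le> S" if t: "t \<in> {0..eps}" for n e t
  proof -
    have "edge_fun eps (w n) e t = edge_fun eps (u n) e t - edge_fun eps v e t" by (simp add: edge_fun_pt w_def)
    then show ?thesis
      using H1_uniformly_bounded[OF eps uH C'(1,2) t, of n e] H1_uniformly_bounded[OF eps v C'(3,4) t, of e]
      unfolding S_def by linarith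
  qed
  have "- (\<alpha> / p * (S powr (p - 2) * mass (w n))) - \<beta> / q * Q V (w n) \<le> E V (w n)" for n
  proof -
    have "\<alpha> / p * Lr_pow eps p (w n) \<le> \<alpha> / p * (S powr (p - 2) * mass (w n))"
      using p \<alpha> by (intro mult_left_mono Lr_le[OF eps wH] Sb) auto
    then show ?thesis unfolding E_def using dirichlet_nonneg[of eps "w n"] by simp
  qed
  moreover have "(\<lambda>n. - (\<alpha> / p * (S powr (p - 2) * mass (w n))) - \<beta> / q * Q V (w n)) \<longlonglongrightarrow>
      - (\<alpha> / p * (S powr (p - 2) * (\<mu> - mass v))) - \<beta> / q * 0"
    by (intro tendsto_diff tendsto_minus tendsto_mult tendsto_const mlim Qw)
  ultimately have "0 \<le> L V \<mu> - E V v"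
    using LIMSEQ_le[OF _ Ew] mv_eq by fastforce
  then show "E V v = L V \<mu>" using L_le[OF V vm] by simp
qed

lemma E_anti: "finite V \<Longrightarrow> E V u \<le> E {} u"
  using Q_nonneg[of u V] \<beta> q by (simp add: E_def)

text \<open>In the window estimate, \<open>l\<close> is so short that the Dirichlet contribution is
  at most half of \<open>\<delta>\<close> squared; the mass of the edge has to supply the other
  half. The 1 in the denominator covers \<open>C = 0\<close>.\<close>

lemma edge_mass_if_value_large:
  assumes u: "u \<in> H1 eps" and D: "D u \<le> C" "0 \<le> C" and t: "t \<in> {0..eps}" and \<delta>: "0 < \<delta>" "\<delta> \<le> \<bar>edge_fun eps u e t\<bar>"
  shows "min eps (\<delta>\<^sup>2 / (4 * C + 1)) * \<delta>\<^sup>2 / 4 \<le> edge_mass eps u e"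
proof -
  define l where "l = min eps (\<delta>\<^sup>2 / (4 * C + 1))"
  have l: "0 < l" "l \<le> eps" using eps \<delta> D unfolding l_def by auto
  have "edge_dirichlet eps u e \<le> C"
    using has_sum_member_le[OF edge_dirichlet_has_sum[OF u] edge_dirichlet_nonneg, of e] D by simp
  then have "l * edge_dirichlet eps u e \<le> l * C" using l by (intro mult_left_mono) auto
  also have "l * C \<le> \<delta>\<^sup>2 / 4"
  proof -
    have "l * C \<le> \<delta>\<^sup>2 / (4 * C + 1) * C" using D by (intro mult_right_mono) (auto simp: l_def)
    also have "\<dots> = \<delta>\<^sup>2 * (C / (4 * C + 1))" by simp
    also have "\<dots> \<le> \<delta>\<^sup>2 * (1/4)" using D by (intro mult_left_mono) (auto simp: field_simps)
    finally show ?thesis by simp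
  qed
  finally have "2 * l * edge_dirichlet eps u e \<le> \<delta>\<^sup>2 / 2" by simp
  moreover have "\<delta>\<^sup>2 \<le> (edge_fun eps u e t)\<^sup>2" using power_mono[OF \<delta>(2), of 2] \<delta>(1) by simp
  ultimately have "\<delta>\<^sup>2 / 2 \<le> 2 / l * edge_mass eps u e" using edge_sup_bound[OF eps u t l, of e] by linarith
  then show ?thesis unfolding l_def[symmetric] using l by (simp add: field_simps)
qed

text \<open>An edge has finite length and the functions are uniformly bounded, so dominated
  convergence applies: on a fixed edge no mass is lost, which keeps the limit of a translated
  sequence nonzero.\<close>

lemma edge_mass_tendsto:
  assumes u: "\<And>n. u n \<in> H1 eps" and v: "v \<in> H1 eps" and C: "\<And>n. mass (u n) \<le> C" "\<And>n. D (u n) \<le> C"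
    and lim: "\<And>x. x \<in> space (EM eps) \<Longrightarrow> (\<lambda>n. pr eps (u n) x) \<longlonglongrightarrow> pr eps v x"
  shows "(\<lambda>n. edge_mass eps (u n) e) \<longlonglongrightarrow> edge_mass eps v e"
  unfolding edge_mass_def
proof (rule integral_dominated_convergence)
  define S where "S = sqrt (2 / eps * C + 2 * eps * C)"
  show "integrable (Iv eps) (\<lambda>t. S\<^sup>2)" by simp
  show "AE t in Iv eps. (\<lambda>n. (pr eps (u n) (e, t))\<^sup>2) \<longlonglongrightarrow> (pr eps v (e, t))\<^sup>2"
    by (intro AE_I2 tendsto_power lim) (simp add: space_EM)
  show "AE t in Iv eps. norm ((pr eps (u n) (e, t))\<^sup>2) \<le> S\<^sup>2" for n
  proof (rule AE_I2)
    fix t assume "t \<in> space (Iv eps)"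
    then have "\<bar>pr eps (u n) (e, t)\<bar> \<le> S" unfolding S_def pr_def
      using H1_uniformly_bounded[OF eps u C, of t] by simp
    from power_mono[OF this, of 2] show "norm ((pr eps (u n) (e, t))\<^sup>2) \<le> S\<^sup>2" by simp
  qed
qed (use measurable_EM_slice[OF L2_measurable[OF H1_pr_L2[OF eps0]]] u v in auto)

lemma ground_state_exists:
  assumes V: "finite V" and \<mu>: "0 < \<mu>" and Lneg: "L V \<mu> < 0" and ne: "H1_mass eps \<mu> \<noteq> {}"
  shows "\<exists>u. ground_state p q \<alpha> \<beta> eps V \<mu> u"
proof -
  obtain u0 where u0: "\<And>n. u0 n \<in> H1_mass eps \<mu>" "(\<lambda>n. E V (u0 n)) \<longlonglongrightarrow> L V \<mu>"
    using minimizing_sequence[OF V ne] by blast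
  obtain K where K: "\<And>u. u \<in> H1 eps \<Longrightarrow> mass u \<le> \<mu> \<Longrightarrow> D u / 4 - K \<le> E V u"
    using coercive[OF V less_imp_le[OF \<mu>]] by blast
  obtain B where B: "\<And>n. E V (u0 n) \<le> B"
    using convergent_imp_Bseq[OF convergentI[OF u0(2)]] by (metis Bseq_def abs_le_D1 real_norm_def)
  define C where "C = max \<mu> (4 * (B + K))"
  have C: "mass (u0 n) \<le> C" "D (u0 n) \<le> C" for n
    using K[OF H1_massD(1)[OF u0(1)[of n]]] H1_massD(2)[OF u0(1)[of n]] B[of n] unfolding C_def by auto
  have C0: "0 \<le> C" using \<mu> unfolding C_def by simp
  obtain r v where r: "strict_mono (r :: nat \<Rightarrow> nat)" and v: "v \<in> H1 eps"
    and lim: "\<And>x. x \<in> space (EM eps) \<Longrightarrow> (\<lambda>n. pr eps (u0 (r n)) x) \<longlonglongrightarrow> pr eps v x"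
    and dlim: "(\<lambda>n. ip (EM eps) (der eps (u0 (r n))) (der eps v)) \<longlonglongrightarrow> D v"
    by (rule H1_compactness[where u = u0 and C = C, OF eps H1_massD(1)[OF u0(1)] C]) (rule that)
  define u where "u n = u0 (r n)" for n
  have u: "u n \<in> H1_mass eps \<mu>" for n unfolding u_def by (rule u0)
  note uH = H1_massD(1)[OF u] and um = H1_massD(2)[OF u]
  have Cu: "mass (u n) \<le> C" "D (u n) \<le> C" for n unfolding u_def by (rule C)+
  have Eu: "(\<lambda>n. E V (u n)) \<longlonglongrightarrow> L V \<mu>"
    using LIMSEQ_subseq_LIMSEQ[OF u0(2) r] by (simp add: u_def[abs_def] o_def)
  show ?thesis
  proof (cases "0 < mass v")
    case True
    from minimizer_of_nonzero_limit[where u = u and v = v, OF V \<mu> Lneg u Eu Cu(2) v lim[folded u_def] dlim[folded u_def] True]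
    show ?thesis unfolding ground_state_def by blast
  next
    \<comment> \<open>The sequence escapes to infinity, so it does not see the vertices in \<open>V\<close>: translated back, it is a
      minimizing sequence for the problem without point nonlinearities.\<close>
    case False
    then have mv: "mass v = 0" using Lr_nonneg[of eps 2 v] by simp
    \<comment> \<open>A nonzero vertex value would force positive mass on the horizontal edge
      starting there.\<close>
    have v0: "v (vtx eps z) = 0" for z
    proof -
      have "edge_mass eps v (z, True) = 0"
        using has_sum_member_le[OF edge_mass_has_sum[OF eps0 v] edge_mass_nonneg, of "(z, True)"] mv edge_mass_nonneg[of eps v "(z, True)"] by simp
      then show ?thesis
        using edge_mass_if_value_large[OF v order_refl dirichlet_nonneg, of 0 "\<bar>v (vtx eps z)\<bar>" "(z, True)"] eps dirichlet_nonneg[of eps v]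
        by (cases "v (vtx eps z) = 0") (auto simp: edge_fun_start mult_le_0_iff divide_le_0_iff min_def split: if_splits)
    qed
    have zspace: "((z, True), 0) \<in> space (EM eps)" for z using eps by (simp add: space_EM)
    have ulim: "(\<lambda>n. u n (vtx eps z)) \<longlonglongrightarrow> 0" for z
      using lim[OF zspace[of z]] v0[of z] unfolding u_def vertex_value by simp
    have Qu: "(\<lambda>n. Q V (u n)) \<longlonglongrightarrow> 0"
    proof -
      have "(\<lambda>n. Q V (u n)) \<longlonglongrightarrow> (\<Sum>z\<in>V. \<bar>0\<bar> powr q)"
        using q by (intro tendsto_sum tendsto_powr' tendsto_rabs ulim tendsto_const) auto
      then show ?thesis by simp
    qed
    have E0: "(\<lambda>n. E {} (u n)) \<longlonglongrightarrow> L V \<mu>"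
    proof -
      have "(\<lambda>n. E V (u n) + \<beta> / q * Q V (u n)) \<longlonglongrightarrow> L V \<mu> + \<beta> / q * 0"
        by (intro tendsto_intros Eu Qu)
      then show ?thesis by (simp add: E_def)
    qed
    \<comment> \<open>One inequality comes from the sequence, whose energies without point terms
      have the same limit; the other from the sign of the point terms.\<close>
    have L0: "L {} \<mu> = L V \<mu>"
    proof (rule antisym)
      show "L {} \<mu> \<le> L V \<mu>"
        by (rule LIMSEQ_le_const[OF E0]) (use L_le[OF _ u, of "{}"] in auto)
      have "L V \<mu> \<le> E {} w" if "w \<in> H1_mass eps \<mu>" for w
        using L_le[OF V that] E_anti[OF V, of w] by simp
      then show "L V \<mu> \<le> L {} \<mu>" unfolding ground_level_def[of _ _ _ _ _ "{}"] by (intro cINF_greatest ne)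
    qed
    \<comment> \<open>A function of mass \<open>\<mu>\<close> whose absolute value stays at most
      this \<open>\<delta>\<close> has energy above half the level, so late members of the sequence
      reach \<open>\<delta>\<close> on some edge.\<close>
    obtain \<delta> where \<delta>: "0 < \<delta>" "\<alpha> / p * (\<delta> powr (p - 2) * \<mu>) < - L V \<mu> / 2"
    proof -
      have "((\<lambda>\<delta>. \<alpha> / p * (\<delta> powr (p - 2) * \<mu>)) \<longlongrightarrow> \<alpha> / p * (0 powr (p - 2) * \<mu>)) (at_right 0)"
        using p by (intro tendsto_intros) (auto simp: eventually_at_right_less intro: eventually_mono[OF eventually_at_right_less])
      then have "\<forall>\<^sub>F \<delta> in at_right 0. \<alpha> / p * (\<delta> powr (p - 2) * \<mu>) < - L V \<mu> / 2"
        using Lneg by (intro order_tendstoD(2)) auto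
      then have "\<exists>\<delta>>0. \<alpha> / p * (\<delta> powr (p - 2) * \<mu>) < - L V \<mu> / 2"
        using eventually_happens'[OF _ eventually_conj[OF eventually_at_right_less]] trivial_limit_at_right_real by blast
      then show ?thesis using that by blast
    qed
    obtain N where N: "\<And>n. n \<ge> N \<Longrightarrow> E {} (u n) < L V \<mu> / 2"
      using order_tendstoD(2)[OF E0, of "L V \<mu> / 2"] Lneg by (auto simp: eventually_sequentially)
    have ex: "\<exists>e t. t \<in> {0..eps} \<and> \<delta> \<le> \<bar>edge_fun eps (u n) e t\<bar>" if "n \<ge> N" for n
    proof (rule ccontr)
      assume neg: "\<not> ?thesis"
      have "\<bar>edge_fun eps (u n) e t\<bar> \<le> \<delta>" if t: "t \<in> {0..eps}" for e t
        using neg t linear by blast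
      then have "Lr_pow eps p (u n) \<le> \<delta> powr (p - 2) * \<mu>"
        using Lr_le[of eps "u n" p \<delta>] eps uH[of n] p um[of n] by simp
      then have "\<alpha> / p * Lr_pow eps p (u n) \<le> \<alpha> / p * (\<delta> powr (p - 2) * \<mu>)"
        using \<alpha> p by (intro mult_left_mono) auto
      then have "L V \<mu> / 2 < E {} (u n)" using \<delta>(2) dirichlet_nonneg[of eps "u n"] by (simp add: E_def)
      then show False using N[OF that] by simp
    qed
    define c where "c = min eps (\<delta>\<^sup>2 / (4 * C + 1)) * \<delta>\<^sup>2 / 4"
    have c: "0 < c" unfolding c_def using eps \<delta> C0 by simp
    have "\<exists>e. c \<le> edge_mass eps (u (n + N)) e" for n
      using ex[of "n + N"] edge_mass_if_value_large[OF uH Cu(2) C0 _ \<delta>(1), of _ "n + N"] unfolding c_def by (meson le_add2)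
    then obtain e where e: "\<And>n. c \<le> edge_mass eps (u (n + N)) (e n)" by metis
    define s where "s n = translate eps (fst (e n)) (u (n + N))" for n
    note tr = translate_H1[OF uH]
    have s: "s n \<in> H1_mass eps \<mu>" for n unfolding s_def H1_mass_def using tr(1,2) um by simp
    have Cs: "mass (s n) \<le> C" "D (s n) \<le> C" for n
      unfolding s_def using tr(2,3) Cu by auto
    have Es: "E {} (s n) = E {} (u (n + N))" for n unfolding s_def E_def using tr(2,3) by simp
    \<comment> \<open>The edge moved to the origin may be horizontal or vertical, hence the sum over
      both; this bound survives the limit.\<close>
    have sc: "c \<le> edge_mass eps (s n) ((0, 0), True) + edge_mass eps (s n) ((0, 0), False)" for n
    proof -
      have "edge_mass eps (s n) ((0, 0), snd (e n)) = edge_mass eps (u (n + N)) (e n)"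
        unfolding s_def using tr(4) by (simp add: shift_edge_def)
      then show ?thesis
        using e[of n] edge_mass_nonneg[of eps "s n" "((0, 0), True)"] edge_mass_nonneg[of eps "s n" "((0, 0), False)"]
        by (cases "snd (e n)") auto
    qed
    obtain r' v' where r': "strict_mono (r' :: nat \<Rightarrow> nat)" and v': "v' \<in> H1 eps"
      and lim': "\<And>x. x \<in> space (EM eps) \<Longrightarrow> (\<lambda>n. pr eps (s (r' n)) x) \<longlonglongrightarrow> pr eps v' x"
      and dlim': "(\<lambda>n. ip (EM eps) (der eps (s (r' n))) (der eps v')) \<longlonglongrightarrow> D v'"
      by (rule H1_compactness[where u = s and C = C, OF eps H1_massD(1)[OF s] Cs]) (rule that)
    have "(\<lambda>n. edge_mass eps (s (r' n)) ((0, 0), True) + edge_mass eps (s (r' n)) ((0, 0), False))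
        \<longlonglongrightarrow> edge_mass eps v' ((0, 0), True) + edge_mass eps v' ((0, 0), False)"
      by (intro tendsto_add edge_mass_tendsto[where u = "\<lambda>n. s (r' n)", OF H1_massD(1)[OF s] v' Cs lim'])
    then have "c \<le> edge_mass eps v' ((0, 0), True) + edge_mass eps v' ((0, 0), False)"
      by (rule LIMSEQ_le_const) (use sc in auto)
    then have mv': "0 < mass v'"
      using has_sum_member_le[OF edge_mass_has_sum[OF eps0 v'] edge_mass_nonneg, of "((0, 0), True)"]
        has_sum_member_le[OF edge_mass_has_sum[OF eps0 v'] edge_mass_nonneg, of "((0, 0), False)"] c by linarith
    have Es': "(\<lambda>n. E {} (s (r' n))) \<longlonglongrightarrow> L {} \<mu>"
      unfolding Es L0 using LIMSEQ_subseq_LIMSEQ[OF LIMSEQ_ignore_initial_segment[OF E0, of N] r'] by (simp add: o_def)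
    have Lneg0: "L {} \<mu> < 0" using L0 Lneg by simp
    from minimizer_of_nonzero_limit[where u = "\<lambda>n. s (r' n)" and v = v', OF finite.emptyI \<mu> Lneg0 s Es' Cs(2) v' lim' dlim' mv']
    have vm: "v' \<in> H1_mass eps \<mu>" and "E {} v' = L V \<mu>" using L0 by auto
    \<comment> \<open>The point terms can only lower the energy of \<open>v'\<close>, and it cannot
      drop below the level.\<close>
    then have "E V v' = L V \<mu>" using E_anti[OF V, of v'] L_le[OF V vm] by simp
    then show ?thesis unfolding ground_state_def using vm by blast
  qed
qed

end

section \<open>Spreading test functions\<close>

lemma powr_extract_square: "a powr r = a\<^sup>2 * a powr (r - 2)" if "0 < a" for a r :: real
  using that powr_add[of a 2 "r - 2"] by simp

text \<open>A pyramid in the 1-norm: along a grid line it changes slope only on the axes and on the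
  boundary of its support, which meet the line at vertices, so it is affine on every edge.\<close>

definition tent :: "real \<Rightarrow> nat \<Rightarrow> real \<times> real \<Rightarrow> real" where
  "tent eps n x = max 0 (1 - (\<bar>fst x\<bar> + \<bar>snd x\<bar>) / (real n * eps))"

text \<open>One coordinate of the edge runs from \<open>eps * i\<close>, the other has absolute
  value \<open>eps * k\<close>. The four cases are right or left of the origin, inside or outside
  the support. All breakpoints are multiples of \<open>eps\<close>, so no edge falls into two
  cases.\<close>

lemma tent_segment:
  fixes i k :: int and eps :: real and n :: nat
  defines "f \<equiv> \<lambda>t. max 0 (1 - (\<bar>eps * of_int i + t\<bar> + eps * of_int k) / (real n * eps))"
  assumes eps: "0 < eps" and n: "0 < n" and k: "0 \<le> k"
  shows "\<exists>b. \<bar>b\<bar> \<le> 1 / (real n * eps) \<and>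
    (\<forall>t\<in>{0..eps}. f t = f 0 + b * t) \<and> (int n < \<bar>i\<bar> \<or> int n < k \<longrightarrow> b = 0 \<and> f 0 = 0)"
proof -
  define N where "N = real n"
  have f: "f t = max 0 (1 - (\<bar>eps * of_int i + t\<bar> + eps * of_int k) / (N * eps))" for t
    by (simp add: f_def N_def)
  have N: "0 < N" using n by (simp add: N_def)
  have le1: "1 - y / (N * eps) \<le> 0" if "N * eps \<le> y" for y using that N eps by (simp add: field_simps)
  have ge0: "0 \<le> 1 - y / (N * eps)" if "y \<le> N * eps" for y using that N eps by (simp add: field_simps)
  have m: "N * eps = eps * of_int (int n)" by (simp add: N_def)
  have zero: "\<exists>b. \<bar>b\<bar> \<le> 1 / (N * eps) \<and> (\<forall>t\<in>{0..eps}. f t = f 0 + b * t) \<and> (P \<longrightarrow> b = 0 \<and> f 0 = 0)"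
    if "\<And>t. 0 \<le> t \<Longrightarrow> t \<le> eps \<Longrightarrow> f t = 0" for P
    using that[of 0] that N eps by (intro exI[of _ 0]) simp
  have lin: "\<exists>b. \<bar>b\<bar> \<le> 1 / (N * eps) \<and> (\<forall>t\<in>{0..eps}. f t = f 0 + b * t) \<and> (P \<longrightarrow> b = 0 \<and> f 0 = 0)"
    if "\<And>t. t \<in> {0..eps} \<Longrightarrow> f t = f 0 + b * t" "\<not> P" "\<bar>b\<bar> \<le> 1 / (N * eps)" for b P
    using that by blast
  consider (a) "0 \<le> i" "int n \<le> i + k" | (b) "0 \<le> i" "i + k + 1 \<le> int n" | (c) "i < 0" "- i + k \<le> int n" | (d) "i < 0" "int n + 1 \<le> - i + k" by linarith
  then show ?thesis
  proof cases
    case a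
    have "eps * of_int (int n) \<le> eps * of_int (i + k)" using a(2) eps by (intro mult_left_mono) linarith+
    then have "N * eps \<le> eps * of_int i + eps * of_int k" by (simp add: m distrib_left)
    moreover have "0 \<le> eps * of_int i" using a eps by simp
    ultimately have z: "f t = 0" if "0 \<le> t" for t
      unfolding f using that by (intro max_absorb1 le1) linarith
    show ?thesis unfolding N_def[symmetric] by (rule zero[OF z])
  next
    case b
    have "eps * of_int (i + k + 1) \<le> eps * of_int (int n)" using b(2) eps by (intro mult_left_mono) linarith+
    then have "eps * of_int i + eps * of_int k + eps \<le> N * eps" by (simp add: m distrib_left)
    moreover have ei: "0 \<le> eps * of_int i" using b eps by simp
    ultimately have *: "0 \<le> 1 - (\<bar>eps * of_int i + t\<bar> + eps * of_int k) / (N * eps)" if "0 \<le> t" "t \<le> eps" for t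
      using that by (intro ge0) linarith
    have lf: "f t = f 0 + (- 1 / (N * eps)) * t" if "t \<in> {0..eps}" for t
      using *[of t] *[of 0] that eps ei N by (simp add: f max_def abs_of_nonneg add_nonneg_nonneg field_simps)
    have "\<not> (int n < \<bar>i\<bar> \<or> int n < k)" using b k by linarith
    then show ?thesis unfolding N_def[symmetric] by (rule lin[OF lf, rotated]) (use N eps in simp_all)
  next
    case c
    have "eps * of_int (- i + k) \<le> eps * of_int (int n)" using c(2) eps by (intro mult_left_mono) linarith+
    then have s: "- (eps * of_int i) + eps * of_int k \<le> N * eps" by (simp add: m algebra_simps)
    have "eps * of_int i \<le> eps * of_int (-1)" using c eps by (intro mult_left_mono) linarith+
    then have ei: "eps * of_int i \<le> - eps" by simp
    have *: "0 \<le> 1 - (\<bar>eps * of_int i + t\<bar> + eps * of_int k) / (N * eps)" if "0 \<le> t" "t \<le> eps" for t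
      using that s ei by (intro ge0) linarith
    have lf: "f t = f 0 + (1 / (N * eps)) * t" if t: "t \<in> {0..eps}" for t
    proof -
      have "\<bar>eps * of_int i + t\<bar> = - (eps * of_int i) - t" "\<bar>eps * of_int i\<bar> = - (eps * of_int i)" using t ei eps by auto
      then show ?thesis using *[of t] *[of 0] t eps N by (simp add: f max_def field_simps)
    qed
    have "\<not> (int n < \<bar>i\<bar> \<or> int n < k)" using c k by linarith
    then show ?thesis unfolding N_def[symmetric] by (rule lin[OF lf, rotated]) (use N eps in simp_all)
  next
    case d
    have "eps * of_int (int n + 1) \<le> eps * of_int (- i + k)" using d(2) eps by (intro mult_left_mono) linarith+
    then have s: "N * eps + eps \<le> - (eps * of_int i) + eps * of_int k" by (simp add: m algebra_simps)
    have z: "f t = 0" if "0 \<le> t" "t \<le> eps" for t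
      unfolding f using that s by (intro max_absorb1 le1) linarith
    show ?thesis unfolding N_def[symmetric] by (rule zero[OF z])
  qed
qed

lemma tent_edge:
  assumes eps: "0 < eps" and n: "0 < n"
  shows "\<exists>b. \<bar>b\<bar> \<le> 1 / (real n * eps) \<and>
    (\<forall>t\<in>{0..eps}. edge_fun eps (tent eps n) e t = edge_fun eps (tent eps n) e 0 + b * t) \<and>
    (e \<notin> ({- int n..int n} \<times> {- int n..int n}) \<times> UNIV \<longrightarrow> b = 0 \<and> edge_fun eps (tent eps n) e 0 = 0)"
proof -
  define i where "i = (if snd e then fst (fst e) else snd (fst e))"
  define k where "k = (if snd e then \<bar>snd (fst e)\<bar> else \<bar>fst (fst e)\<bar>)"
  have f: "edge_fun eps (tent eps n) e t = max 0 (1 - (\<bar>eps * of_int i + t\<bar> + eps * of_int k) / (real n * eps))" for t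
    using eps by (simp add: i_def k_def edge_fun_def tent_def abs_mult add.commute)
  have B: "e \<notin> ({- int n..int n} \<times> {- int n..int n}) \<times> UNIV \<longleftrightarrow> int n < \<bar>i\<bar> \<or> int n < k"
    by (cases e; cases "fst e") (auto simp: i_def k_def)
  have "0 \<le> k" by (simp add: k_def)
  from tent_segment[OF eps n this, of i] show ?thesis unfolding f B add_0_right .
qed

text \<open>Mass grows like \<open>m\<close> squared while the Dirichlet energy stays bounded. With
  radius \<open>4 * m\<close> steps the tent is at least 1/2 on the \<open>2 * m^2\<close> edges
  starting in an \<open>m\<close> by \<open>m\<close> square. The support meets at most
  \<open>2 * (8 * m + 1)^2\<close>, hence at most \<open>162 * m^2\<close>, edges, each with slope
  at most \<open>1 / (4 * m * eps)\<close>; and 162/16 is below 11.\<close>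

lemma tent_estimates:
  assumes eps: "0 < eps" and m: "0 < m" and r: "2 \<le> r"
  shows "tent eps (4 * m) \<in> H1 eps" "(real m)\<^sup>2 * eps / 2 \<le> Lr_pow eps 2 (tent eps (4 * m))"
    "Lr_pow eps 2 (tent eps (4 * m)) \<le> 162 * (real m)\<^sup>2 * eps"
    "2 * (real m)\<^sup>2 * eps * (1/2) powr r \<le> Lr_pow eps r (tent eps (4 * m))"
    "dirichlet eps (tent eps (4 * m)) \<le> 11 / eps"
proof -
  define n where "n = 4 * m"
  have n: "0 < n" using m by (simp add: n_def)
  define u where "u = tent eps n"
  define B :: "edge set" where "B = ({- int n..int n} \<times> {- int n..int n}) \<times> UNIV"
  have fB: "finite B" unfolding B_def by simp
  have cB: "real (card B) \<le> 162 * (real m)\<^sup>2"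
  proof -
    have "card {- int n..int n} = 2 * n + 1" by simp
    then have "card B = (2 * n + 1) * (2 * n + 1) * 2"
      unfolding B_def card_cartesian_product by (simp only: card_UNIV_bool)
    also have "\<dots> \<le> (9 * m) * (9 * m) * 2" unfolding n_def using m by (intro mult_mono) auto
    finally have "real (card B) \<le> real ((9 * m) * (9 * m) * 2)" by (rule of_nat_mono)
    then show ?thesis by (simp add: power2_eq_square)
  qed
  define b where "b e = (SOME b. \<bar>b\<bar> \<le> 1 / (real n * eps) \<and>
    (\<forall>t\<in>{0..eps}. edge_fun eps u e t = edge_fun eps u e 0 + b * t) \<and>
    (e \<notin> B \<longrightarrow> b = 0 \<and> edge_fun eps u e 0 = 0))" for e
  have b: "\<bar>b e\<bar> \<le> 1 / (real n * eps)" "\<And>t. t \<in> {0..eps} \<Longrightarrow> edge_fun eps u e t = edge_fun eps u e 0 + b e * t"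
    "e \<notin> B \<Longrightarrow> b e = 0" "e \<notin> B \<Longrightarrow> edge_fun eps u e 0 = 0" for e
    using someI_ex[OF tent_edge[OF eps n, of e]] unfolding b_def u_def B_def by blast+
  have u01: "0 \<le> u x" "u x \<le> 1" for x using eps n by (auto simp: u_def tent_def)
  have cu: "continuous_on A u" for A
    unfolding u_def tent_def using eps n by (intro continuous_intros) auto
  have pm: "(\<lambda>t. pr eps u (e, t)) \<in> borel_measurable (Iv eps)" for e
    using measurable_EM_slice[OF pr_measurable[OF cu]] .
  have lI: "(\<integral>t. (c::real) \<partial>Iv eps) = eps * c" for c
    using eps by (simp add: measure_restrict_space)
  have p01: "0 \<le> pr eps u x" "pr eps u x \<le> 1" for x using u01 by (auto simp: pr_def edge_fun_pt)
  have pow01: "\<bar>pr eps u x\<bar> powr s \<le> 1" if "0 \<le> s" for x s using powr_mono2[OF that, of "\<bar>pr eps u x\<bar>" 1] p01[of x] by simp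
  have si: "integrable (Iv eps) (\<lambda>t. \<bar>pr eps u (e, t)\<bar> powr s)" if "0 \<le> s" for e s
    using pm[of e] pow01[OF that] by (intro Iv.integrable_const_bound[of _ 1]) auto
  have off: "pr eps u (e, t) = 0" if "e \<notin> B" "t \<in> {0..eps}" for e t
    using b(2)[OF that(2)] b(3,4)[OF that(1)] by (simp add: pr_def)
  have off_int: "(\<integral>t. \<bar>pr eps u (e, t)\<bar> powr s \<partial>Iv eps) = 0" if "e \<notin> B" for e s
    using off[OF that] by (intro integral_eq_zero_AE AE_I2) (simp add: space_Iv)
  have fs: "f summable_on UNIV" if "\<And>e. e \<notin> B \<Longrightarrow> f e = (0::real)" for f
    using summable_on_cong_neutral[of B UNIV f f] that fB by auto
  have iE: "integrable (EM eps) (\<lambda>x. \<bar>pr eps u x\<bar> powr s)" if "0 \<le> s" for s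
    using pm si[OF that] by (intro integrable_EM_nonneg fs off_int) auto
  have hs: "((\<lambda>e. \<integral>t. \<bar>pr eps u (e, t)\<bar> powr s \<partial>Iv eps) has_sum Lr_pow eps s u) UNIV" if "0 \<le> s" for s
    unfolding Lr_pow_eq[OF iE[OF that]] by (rule integral_EM[OF iE[OF that]])
  define G where "G x = b (fst x)" for x :: "edge \<times> real"
  have G2: "((\<lambda>e. eps * (b e)\<^sup>2) has_sum sqnorm (EM eps) G) UNIV" and GL: "G \<in> L2 (EM eps)"
  proof -
    have sl: "(\<lambda>e. \<integral>t. (G (e, t))\<^sup>2 \<partial>Iv eps) = (\<lambda>e. eps * (b e)\<^sup>2)" by (simp only: G_def fst_conv lI)
    have i: "integrable (EM eps) (\<lambda>x. (G x)\<^sup>2)"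
    proof (rule integrable_EM_nonneg)
      show "(\<lambda>e. \<integral>t. (G (e, t))\<^sup>2 \<partial>Iv eps) summable_on UNIV" unfolding sl by (rule fs) (simp add: b(3))
    qed (auto simp: G_def)
    show "((\<lambda>e. eps * (b e)\<^sup>2) has_sum sqnorm (EM eps) G) UNIV"
      using integral_EM[OF i] unfolding sl ip_self .
    show "G \<in> L2 (EM eps)" unfolding L2_def using i by (auto intro!: measurable_EM simp: G_def)
  qed
  have d: "h1_deriv 0 eps (edge_fun eps u e) (\<lambda>t. G (e, t))" for e
    unfolding h1_deriv_iff
  proof (intro conjI ballI)
    show "(\<lambda>t. G (e, t)) \<in> L2 (Iv eps)" by (rule L2_EM_slice[OF GL])
    fix x assume x: "x \<in> {0..eps}"
    have "ip (Iv eps) (indicator {0..x}) (\<lambda>t. G (e, t)) = set_lebesgue_integral lborel {0..x} (\<lambda>t. b e)"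
      unfolding G_def fst_conv by (rule ip_indicator[OF x, symmetric])
    also have "\<dots> = b e * x" using x by (simp add: set_lebesgue_integral_def)
    finally show "edge_fun eps u e x = edge_fun eps u e 0 + ip (Iv eps) (indicator {0..x}) (\<lambda>t. G (e, t))"
      using b(2)[OF x, of e] by (simp only:)
  qed
  have pL: "pr eps u \<in> L2 (EM eps)"
    using iE[of 2] pr_measurable[OF cu] by (simp add: L2_def abs_powr_2)
  have uH: "u \<in> H1 eps" using eps by (intro H1_intro[OF _ cu pL GL d]) simp
  then show "tent eps (4 * m) \<in> H1 eps" by (simp add: u_def n_def)
  have fsum: "S = sum f B" if "(f has_sum S) UNIV" "\<And>e. e \<notin> B \<Longrightarrow> f e = 0" for f and S :: real
  proof -
    have "(f has_sum S) B" using that has_sum_cong_neutral[of B UNIV f f S] by auto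
    then show ?thesis using has_sum_unique has_sum_finite[OF fB] by blast
  qed
  have "Lr_pow eps 2 u = (\<Sum>e\<in>B. \<integral>t. \<bar>pr eps u (e, t)\<bar> powr 2 \<partial>Iv eps)"
    by (rule fsum[OF hs off_int]) auto
  also have "\<dots> \<le> (\<Sum>e\<in>B. eps)"
  proof (rule sum_mono)
    fix e
    have "(\<integral>t. \<bar>pr eps u (e, t)\<bar> powr 2 \<partial>Iv eps) \<le> (\<integral>t. 1 \<partial>Iv eps)"
      using si[of 2 e] pow01[of 2] by (intro integral_mono) auto
    then show "(\<integral>t. \<bar>pr eps u (e, t)\<bar> powr 2 \<partial>Iv eps) \<le> eps" unfolding lI by simp
  qed
  also have "\<dots> = real (card B) * eps" by simp
  also have "\<dots> \<le> 162 * (real m)\<^sup>2 * eps" using cB eps by (intro mult_right_mono) auto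
  finally show "Lr_pow eps 2 (tent eps (4 * m)) \<le> 162 * (real m)\<^sup>2 * eps" by (simp add: u_def n_def)
  \<comment> \<open>Points on these edges have 1-norm at most \<open>2 * m * eps\<close>, half the
    radius of the tent.\<close>
  define S :: "edge set" where "S = ({0..<int m} \<times> {0..<int m}) \<times> UNIV"
  have fS: "finite S" and cS: "real (card S) = 2 * (real m)\<^sup>2"
    unfolding S_def by (simp_all add: card_cartesian_product power2_eq_square)
  have half: "1/2 \<le> pr eps u (e, t)" if e: "e \<in> S" and t: "t \<in> {0..eps}" for e t
  proof -
    obtain i j d where ed: "e = ((i, j), d)" by (metis prod.exhaust)
    have ij: "0 \<le> i" "0 \<le> j" "i + j + 1 \<le> 2 * int m" using e unfolding ed S_def by auto
    have "eps * of_int (i + j + 1) \<le> eps * of_int (2 * int m)" using ij eps by (intro mult_left_mono) linarith+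
    then have *: "eps * of_int i + eps * of_int j + eps \<le> 2 * real m * eps" by (simp add: algebra_simps)
    have "0 \<le> eps * of_int i" "0 \<le> eps * of_int j" using ij eps by auto
    then have "\<bar>fst (edge_pt eps e t)\<bar> + \<bar>snd (edge_pt eps e t)\<bar> \<le> 2 * real m * eps"
      using t * unfolding ed edge_pt_def by (cases d) auto
    then have "(\<bar>fst (edge_pt eps e t)\<bar> + \<bar>snd (edge_pt eps e t)\<bar>) / (real n * eps) \<le> 1/2"
      using eps m by (simp add: n_def field_simps)
    then have "1/2 \<le> 1 - (\<bar>fst (edge_pt eps e t)\<bar> + \<bar>snd (edge_pt eps e t)\<bar>) / (real n * eps)" by linarith
    also have "\<dots> \<le> pr eps u (e, t)" unfolding pr_def edge_fun_pt u_def tent_def fst_conv snd_conv by (rule max.cobounded2)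
    finally show ?thesis .
  qed
  have low: "2 * (real m)\<^sup>2 * eps * (1/2) powr s \<le> Lr_pow eps s u" if s: "0 \<le> s" for s
  proof -
    have "2 * (real m)\<^sup>2 * eps * (1/2) powr s = (\<Sum>e\<in>S. eps * (1/2) powr s)" by (simp add: cS)
    also have "\<dots> \<le> (\<Sum>e\<in>S. \<integral>t. \<bar>pr eps u (e, t)\<bar> powr s \<partial>Iv eps)"
    proof (rule sum_mono)
      fix e assume e: "e \<in> S"
      have "(\<integral>t. (1/2) powr s \<partial>Iv eps) \<le> (\<integral>t. \<bar>pr eps u (e, t)\<bar> powr s \<partial>Iv eps)"
        unfolding abs_of_nonneg[OF p01(1)]
        using half[OF e] s si[OF s, of e, unfolded abs_of_nonneg[OF p01(1)]]
        by (intro integral_mono powr_mono2) (auto simp: space_Iv)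
      then show "eps * (1/2) powr s \<le> (\<integral>t. \<bar>pr eps u (e, t)\<bar> powr s \<partial>Iv eps)" unfolding lI .
    qed
    also have "\<dots> \<le> Lr_pow eps s u" using fS by (intro finite_sum_le_has_sum[OF hs[OF s]]) auto
    finally show ?thesis .
  qed
  from low[of 2] show "(real m)\<^sup>2 * eps / 2 \<le> Lr_pow eps 2 (tent eps (4 * m))" by (simp add: u_def n_def power2_eq_square mult_ac)
  from low[of r] r show "2 * (real m)\<^sup>2 * eps * (1/2) powr r \<le> Lr_pow eps r (tent eps (4 * m))" by (simp add: u_def n_def)
  have "dirichlet eps u = sqnorm (EM eps) G"
    unfolding dirichlet_eq[OF uH] using der_AE[OF GL d] L2_measurable[OF GL] by (intro ip_cong_AE) auto
  also have "\<dots> = (\<Sum>e\<in>B. eps * (b e)\<^sup>2)" by (rule fsum[OF G2]) (simp add: b(3))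
  also have "\<dots> \<le> (\<Sum>e\<in>B. eps * (1 / (real n * eps))\<^sup>2)"
  proof (intro sum_mono mult_left_mono)
    show "(b e)\<^sup>2 \<le> (1 / (real n * eps))\<^sup>2" for e using power_mono[OF b(1)[of e], of 2] by simp
  qed (use eps in simp)
  also have "\<dots> = real (card B) * (1 / (16 * (real m)\<^sup>2 * eps))"
    using eps by (simp add: n_def power2_eq_square field_simps)
  also have "\<dots> \<le> (162 * (real m)\<^sup>2) * (1 / (16 * (real m)\<^sup>2 * eps))"
    using cB eps by (intro mult_right_mono) auto
  also have "\<dots> \<le> 11 / eps" using m eps by (simp add: field_simps)
  finally show "dirichlet eps (tent eps (4 * m)) \<le> 11 / eps" by (simp add: u_def n_def)
qed

context grid_nls
begin

lemma tent_scaled: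
  assumes \<mu>: "0 < \<mu>" and m: "0 < (m::nat)"
  obtains a where "0 \<le> a" "(\<lambda>x. a * tent eps (4 * m) x) \<in> H1_mass eps \<mu>"
    "\<mu> / (162 * (real m)\<^sup>2 * eps) \<le> a\<^sup>2" "a\<^sup>2 \<le> 2 * \<mu> / ((real m)\<^sup>2 * eps)"
proof -
  note T = tent_estimates[OF eps m order_refl]
  have mp: "0 < (real m)\<^sup>2 * eps / 2" using m eps by simp
  have M: "0 < mass (tent eps (4 * m))" using T(2) mp by linarith
  define a where "a = sqrt (\<mu> / mass (tent eps (4 * m)))"
  have a2: "a\<^sup>2 = \<mu> / mass (tent eps (4 * m))" unfolding a_def using \<mu> M by simp
  show ?thesis
  proof (rule that)
    show "0 \<le> a" unfolding a_def using \<mu> M by simp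
    show "(\<lambda>x. a * tent eps (4 * m) x) \<in> H1_mass eps \<mu>" unfolding a_def by (rule scaled_mass[OF T(1) M \<mu>])
    show "\<mu> / (162 * (real m)\<^sup>2 * eps) \<le> a\<^sup>2" unfolding a2 using T(3) M \<mu> m eps by (intro divide_left_mono mult_pos_pos) auto
    have "\<mu> / mass (tent eps (4 * m)) \<le> \<mu> / ((real m)\<^sup>2 * eps / 2)"
      using T(2) M mp \<mu> by (intro divide_left_mono) auto
    then show "a\<^sup>2 \<le> 2 * \<mu> / ((real m)\<^sup>2 * eps)" unfolding a2 by (simp add: mult.commute)
  qed
qed

lemma H1_mass_nonempty: "0 < \<mu> \<Longrightarrow> H1_mass eps \<mu> \<noteq> {}"
  using tent_scaled[of \<mu> 1] by (metis empty_iff zero_less_one)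

lemma E_tent_le:
  assumes a: "0 \<le> a" and m: "0 < (m::nat)"
  shows "E V (\<lambda>x. a * tent eps (4 * m) x) \<le> a\<^sup>2 * (11 / (2 * eps)) - \<alpha> / p * (a powr p * (2 * (real m)\<^sup>2 * eps * (1/2) powr p))"
proof -
  note T = tent_estimates[OF eps m less_imp_le[OF p(1)]]
  have "\<alpha> / p * (a powr p * (2 * (real m)\<^sup>2 * eps * (1/2) powr p)) \<le> \<alpha> / p * (a powr p * Lr_pow eps p (tent eps (4 * m)))"
    using T(4) \<alpha> p by (intro mult_left_mono) auto
  moreover have "a\<^sup>2 * D (tent eps (4 * m)) / 2 \<le> a\<^sup>2 * (11 / eps) / 2"
    using T(5) by (intro divide_right_mono mult_left_mono) auto
  moreover have "0 \<le> \<beta> / q * (a powr q * Q V (tent eps (4 * m)))" using \<beta> q Q_nonneg by simp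
  ultimately show ?thesis unfolding E_scale[OF T(1) a] by simp
qed

lemma L_nonpos:
  assumes V: "finite V" and \<mu>: "0 < \<mu>" shows "L V \<mu> \<le> 0"
proof (rule LIMSEQ_le_const)
  show "(\<lambda>n. 11 * \<mu> / eps\<^sup>2 * (1 / real (Suc n))) \<longlonglongrightarrow> 0"
    using tendsto_mult_right_zero[OF LIMSEQ_Suc[OF lim_1_over_n]] .
  have "L V \<mu> \<le> 11 * \<mu> / eps\<^sup>2 * (1 / real (Suc n))" for n
  proof -
    have m: "0 < Suc n" by simp
    obtain a where a: "0 \<le> a" "(\<lambda>x. a * tent eps (4 * Suc n) x) \<in> H1_mass eps \<mu>" "a\<^sup>2 \<le> 2 * \<mu> / ((real (Suc n))\<^sup>2 * eps)"
      using tent_scaled[OF \<mu> m] by blast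
    have "0 \<le> \<alpha> / p * (a powr p * (2 * (real (Suc n))\<^sup>2 * eps * (1/2) powr p))"
      using \<alpha> p eps by (intro mult_nonneg_nonneg divide_nonneg_nonneg) auto
    then have "L V \<mu> \<le> a\<^sup>2 * (11 / (2 * eps))" using L_le[OF V a(2)] E_tent_le[OF a(1) m, of V] by linarith
    also have "\<dots> \<le> 2 * \<mu> / ((real (Suc n))\<^sup>2 * eps) * (11 / (2 * eps))"
      using a(3) eps by (intro mult_right_mono) auto
    also have "\<dots> \<le> 2 * \<mu> / (real (Suc n) * eps) * (11 / (2 * eps))"
    proof (intro mult_right_mono divide_left_mono)
      have "real (Suc n) * 1 \<le> real (Suc n) * real (Suc n)" by (intro mult_left_mono) auto
      then show "real (Suc n) \<le> (real (Suc n))\<^sup>2" unfolding power2_eq_square by simp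
    qed (use eps \<mu> in auto)
    also have "\<dots> = 11 * \<mu> / eps\<^sup>2 * (1 / real (Suc n))" by (simp add: power2_eq_square)
    finally show ?thesis .
  qed
  then show "\<exists>N. \<forall>n\<ge>N. L V \<mu> \<le> 11 * \<mu> / eps\<^sup>2 * (1 / real (Suc n))" by blast
qed

text \<open>After division by \<open>a\<close> squared, a bounded Dirichlet term competes with a
  p-term of order \<open>m^2 * a powr (p - 2)\<close>. Since \<open>a\<close> is at least of order
  \<open>1 / m\<close>, this is at least of order \<open>m powr (4 - p)\<close>, which is unbounded
  for \<open>p < 4\<close>.\<close>

lemma L_neg_subcritical:
  assumes V: "finite V" and \<mu>: "0 < \<mu>" and p4: "p < 4" shows "L V \<mu> < 0"
proof -
  define c where "c = \<alpha> / p * (2 * eps * (1/2) powr p) * (\<mu> / (162 * eps)) powr ((p - 2) / 2)"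
  have c: "0 < c" unfolding c_def using \<alpha> p eps \<mu> by simp
  \<comment> \<open>At \<open>X\<close> the two terms balance, so any integer above it makes the
    energy negative.\<close>
  define X where "X = (11 / (2 * eps) / c) powr (1 / (4 - p))"
  have Y: "0 < 11 / (2 * eps) / c" using c eps by simp
  then have X: "0 < X" "X powr (4 - p) = 11 / (2 * eps) / c" unfolding X_def using p4 by (auto simp: powr_powr)
  obtain m :: nat where "X < real m" using reals_Archimedean2 by blast
  then have m: "11 / (2 * eps) / c < real m powr (4 - p)" "0 < m"
    unfolding X(2)[symmetric] using X(1) p4 by (auto intro!: powr_less_mono2 intro: gr0I)
  obtain a where a: "0 \<le> a" "(\<lambda>x. a * tent eps (4 * m) x) \<in> H1_mass eps \<mu>" "\<mu> / (162 * (real m)\<^sup>2 * eps) \<le> a\<^sup>2"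
    using tent_scaled[OF \<mu> m(2)] by blast
  have "0 < \<mu> / (162 * (real m)\<^sup>2 * eps)" using \<mu> m eps by simp
  then have apos: "0 < a" using a(1,3) by (cases "a = 0") auto
  note ap = powr_extract_square[OF apos, of p]
  have "(\<mu> / (162 * eps)) powr ((p - 2) / 2) * real m powr (- (p - 2)) = (\<mu> / (162 * (real m)\<^sup>2 * eps)) powr ((p - 2) / 2)"
  proof -
    have "real m powr (- (p - 2)) = (1 / (real m)\<^sup>2) powr ((p - 2) / 2)"
    proof -
      have "1 / (real m)\<^sup>2 = real m powr (-2)" using m by (simp add: powr_minus_divide)
      moreover have "-2 * ((p - 2) / 2) = - (p - 2)" by simp
      ultimately show ?thesis by (simp only: powr_powr)
    qed
    then show ?thesis using \<mu> eps by (simp flip: powr_mult) (simp add: mult_ac)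
  qed
  also have "\<dots> \<le> (a\<^sup>2) powr ((p - 2) / 2)" using a(3) \<mu> eps p by (intro powr_mono2) auto
  also have "\<dots> = a powr (p - 2)"
  proof -
    have "a\<^sup>2 = a powr 2" using apos by simp
    moreover have "2 * ((p - 2) / 2) = p - 2" by simp
    ultimately show ?thesis by (simp only: powr_powr)
  qed
  finally have al: "(\<mu> / (162 * eps)) powr ((p - 2) / 2) * real m powr (- (p - 2)) \<le> a powr (p - 2)" .
  have mp: "real m powr (- (p - 2)) * (real m)\<^sup>2 = real m powr (4 - p)"
  proof -
    have "(real m)\<^sup>2 = real m powr 2" using m by simp
    then have "real m powr (- (p - 2)) * (real m)\<^sup>2 = real m powr (- (p - 2) + 2)" by (simp only: powr_add)
    then show ?thesis by (simp add: algebra_simps)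
  qed
  have "11 / (2 * eps) < c * real m powr (4 - p)" using m(1) c by (subst (asm) pos_divide_less_eq) (simp_all add: mult.commute)
  also have "\<dots> = \<alpha> / p * (2 * eps * (1/2) powr p) * (real m)\<^sup>2 * ((\<mu> / (162 * eps)) powr ((p - 2) / 2) * real m powr (- (p - 2)))"
    unfolding mp[symmetric] c_def by (simp add: mult_ac)
  also have "\<dots> \<le> \<alpha> / p * (2 * eps * (1/2) powr p) * (real m)\<^sup>2 * a powr (p - 2)"
    using \<alpha> p eps by (intro mult_left_mono al) auto
  finally have "11 / (2 * eps) < \<alpha> / p * (2 * eps * (1/2) powr p) * (real m)\<^sup>2 * a powr (p - 2)" .
  then have "a\<^sup>2 * (11 / (2 * eps)) < a\<^sup>2 * (\<alpha> / p * (2 * eps * (1/2) powr p) * (real m)\<^sup>2 * a powr (p - 2))"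
    using apos by (intro mult_strict_left_mono) auto
  also have "\<dots> = \<alpha> / p * (a powr p * (2 * (real m)\<^sup>2 * eps * (1/2) powr p))" unfolding ap by (simp add: mult_ac)
  finally show ?thesis using L_le[OF V a(2)] E_tent_le[OF a(1) m(2), of V] by linarith
qed

end

section \<open>A Gagliardo-Nirenberg inequality on the square lattice\<close>

lemma power_diff_abs_le:
  fixes x y :: real
  shows "\<bar>x ^ Suc k - y ^ Suc k\<bar> \<le> real (Suc k) * (\<bar>x\<bar> ^ k + \<bar>y\<bar> ^ k) * \<bar>x - y\<bar>"
proof -
  define M where "M = max \<bar>x\<bar> \<bar>y\<bar>"
  have t: "\<bar>x ^ i * y ^ (k - i)\<bar> \<le> \<bar>x\<bar> ^ k + \<bar>y\<bar> ^ k" if "i < Suc k" for i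
  proof -
    have "\<bar>x ^ i * y ^ (k - i)\<bar> = \<bar>x\<bar> ^ i * \<bar>y\<bar> ^ (k - i)" by (simp add: abs_mult power_abs)
    also have "\<dots> \<le> M ^ i * M ^ (k - i)" unfolding M_def by (intro mult_mono power_mono) auto
    also have "\<dots> = M ^ k" using that by (simp flip: power_add)
    also have "\<dots> \<le> \<bar>x\<bar> ^ k + \<bar>y\<bar> ^ k" unfolding M_def by (simp add: max_def)
    finally show ?thesis .
  qed
  have eq: "\<bar>x ^ Suc k - y ^ Suc k\<bar> = \<bar>x - y\<bar> * \<bar>\<Sum>i<Suc k. x ^ i * y ^ (k - i)\<bar>"
    unfolding diff_power_eq_sum abs_mult ..
  have "\<bar>\<Sum>i<Suc k. x ^ i * y ^ (k - i)\<bar> \<le> (\<Sum>i<Suc k. \<bar>x ^ i * y ^ (k - i)\<bar>)" by (rule sum_abs)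
  also have "\<dots> \<le> (\<Sum>i<Suc k. \<bar>x\<bar> ^ k + \<bar>y\<bar> ^ k)" using t by (intro sum_mono) auto
  also have "\<dots> = real (Suc k) * (\<bar>x\<bar> ^ k + \<bar>y\<bar> ^ k)" by simp
  finally have "\<bar>\<Sum>i<Suc k. x ^ i * y ^ (k - i)\<bar> \<le> real (Suc k) * (\<bar>x\<bar> ^ k + \<bar>y\<bar> ^ k)" .
  from mult_right_mono[OF this, of "\<bar>x - y\<bar>"] show ?thesis unfolding eq by (simp only: mult.commute[of "\<bar>x - y\<bar>"])
qed

lemma sum_power_increment_le:
  fixes w :: "'a \<Rightarrow> real" and s :: "'a \<Rightarrow> 'a"
  assumes inj: "inj s"
    and g: "\<And>F. finite F \<Longrightarrow> (\<Sum>z\<in>F. (w (s z) - w z)\<^sup>2) \<le> G"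
    and n: "\<And>F. finite F \<Longrightarrow> (\<Sum>z\<in>F. w z ^ (2 * k)) \<le> N"
    and F: "finite F"
  shows "(\<Sum>z\<in>F. \<bar>w (s z) ^ Suc k - w z ^ Suc k\<bar>) \<le> sqrt (4 * (real (Suc k))\<^sup>2 * G * N)"
proof (rule real_le_rsqrt)
  let ?a = "\<lambda>z. \<bar>w (s z)\<bar> ^ k + \<bar>w z\<bar> ^ k" and ?b = "\<lambda>z. \<bar>w (s z) - w z\<bar>"
  have N0: "0 \<le> N" using n[of "{}"] by simp
  have "(\<Sum>z\<in>F. \<bar>w (s z) ^ Suc k - w z ^ Suc k\<bar>) \<le> (\<Sum>z\<in>F. real (Suc k) * (?a z * ?b z))"
    using power_diff_abs_le[where k = k] by (intro sum_mono) (simp add: mult.assoc)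
  also have "\<dots> = real (Suc k) * (\<Sum>z\<in>F. ?a z * ?b z)" by (simp add: sum_distrib_left)
  finally have "(\<Sum>z\<in>F. \<bar>w (s z) ^ Suc k - w z ^ Suc k\<bar>)\<^sup>2 \<le> (real (Suc k) * (\<Sum>z\<in>F. ?a z * ?b z))\<^sup>2"
    by (intro power_mono sum_nonneg) auto
  also have "\<dots> = (real (Suc k))\<^sup>2 * (\<Sum>z\<in>F. ?a z * ?b z)\<^sup>2" by (simp only: power_mult_distrib)
  also have "(\<Sum>z\<in>F. ?a z * ?b z)\<^sup>2 \<le> (\<Sum>z\<in>F. (?a z)\<^sup>2) * (\<Sum>z\<in>F. (?b z)\<^sup>2)" by (rule Cauchy_Schwarz_ineq_sum)
  also have "\<dots> \<le> (4 * N) * G"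
  proof (rule mult_mono)
    have "(\<Sum>z\<in>F. (?a z)\<^sup>2) \<le> (\<Sum>z\<in>F. 2 * w (s z) ^ (2 * k) + 2 * w z ^ (2 * k))"
    proof (rule sum_mono)
      fix z
      have sq: "(x ^ k)\<^sup>2 = x ^ (2 * k)" for x :: real by (simp add: power_mult[symmetric] mult.commute)
      from sum_squared_le[of "\<bar>w (s z)\<bar> ^ k" "\<bar>w z\<bar> ^ k"]
      show "(?a z)\<^sup>2 \<le> 2 * w (s z) ^ (2 * k) + 2 * w z ^ (2 * k)" unfolding sq by (simp add: power_even_abs)
    qed
    also have "\<dots> = 2 * (\<Sum>z\<in>F. w (s z) ^ (2 * k)) + 2 * (\<Sum>z\<in>F. w z ^ (2 * k))"
      by (simp add: sum.distrib sum_distrib_left)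
    also have "(\<Sum>z\<in>F. w (s z) ^ (2 * k)) = (\<Sum>z\<in>s ` F. w z ^ (2 * k))"
      using inj_on_subset[OF inj subset_UNIV] by (simp add: sum.reindex)
    also have "2 * (\<Sum>z\<in>s ` F. w z ^ (2 * k)) + 2 * (\<Sum>z\<in>F. w z ^ (2 * k)) \<le> 2 * N + 2 * N"
      using n[OF F] n[of "s ` F"] F by (intro add_mono mult_left_mono) auto
    finally show "(\<Sum>z\<in>F. (?a z)\<^sup>2) \<le> 4 * N" by simp
    show "(\<Sum>z\<in>F. (?b z)\<^sup>2) \<le> G" using g[OF F] by simp
  qed (use N0 in \<open>auto intro: sum_nonneg\<close>)
  finally show "(\<Sum>z\<in>F. \<bar>w (s z) ^ Suc k - w z ^ Suc k\<bar>)\<^sup>2 \<le> 4 * (real (Suc k))\<^sup>2 * G * N"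
    by (simp add: mult_left_mono mult_ac)
qed

text \<open>Square summability supplies the zero boundary value at infinity for telescoping along
  rows and columns.\<close>

lemma tendsto_zero_along_injection:
  fixes w :: "'a \<Rightarrow> real"
  assumes s: "\<And>F. finite F \<Longrightarrow> (\<Sum>z\<in>F. (w z)\<^sup>2) \<le> S" and inj: "inj f"
  shows "(\<lambda>l. w (f (l :: nat))) \<longlonglongrightarrow> 0"
proof -
  have "(\<Sum>l<n. (w (f l))\<^sup>2) \<le> S" for n
  proof -
    have "(\<Sum>z\<in>f ` {..<n}. (w z)\<^sup>2) = (\<Sum>l<n. (w (f l))\<^sup>2)"
      by (subst sum.reindex) (auto intro: inj_on_subset[OF inj])
    then show ?thesis using s[of "f ` {..<n}"] by simp
  qed
  then have "summable (\<lambda>l. (w (f l))\<^sup>2)" by (intro summableI_nonneg_bounded) auto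
  from summable_LIMSEQ_zero[OF this] have "(\<lambda>l. sqrt ((w (f l))\<^sup>2)) \<longlonglongrightarrow> sqrt 0" by (rule tendsto_real_sqrt)
  then show ?thesis by (simp add: tendsto_rabs_zero_iff)
qed

text \<open>A power of \<open>w\<close> at a point is bounded by its total variation
  along the row and along the column through that point, and the product of the two bounds
  separates in the double sum.\<close>

lemma lattice_power_sum_step:
  fixes w :: "int \<times> int \<Rightarrow> real"
  assumes S: "\<And>F. finite F \<Longrightarrow> (\<Sum>z\<in>F. (w z)\<^sup>2) \<le> S"
    and A: "\<And>F. finite F \<Longrightarrow> (\<Sum>z\<in>F. \<bar>w (fst z + 1, snd z) ^ k - w z ^ k\<bar>) \<le> A"
    and B: "\<And>F. finite F \<Longrightarrow> (\<Sum>z\<in>F. \<bar>w (fst z, snd z + 1) ^ k - w z ^ k\<bar>) \<le> B"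
    and k: "0 < k" and F: "finite F"
  shows "(\<Sum>z\<in>F. w z ^ (2 * k)) \<le> A * B"
proof -
  have A0: "0 \<le> A" and B0: "0 \<le> B" using A[of "{}"] B[of "{}"] by auto
  have tele: "\<bar>h b\<bar> \<le> \<bar>h a\<bar> + (\<Sum>c\<in>{a..<b}. \<bar>h (c + 1) - h c\<bar>)" if "a \<le> b" for h :: "int \<Rightarrow> real" and a b
    using that
  proof (induction b rule: int_ge_induct)
    case (step b)
    have "{a..<b + 1} = insert b {a..<b}" using step.hyps by auto
    then show ?case using step.IH by simp
  qed simp
  obtain I J :: "int set" where IJ: "finite I" "finite J" "F \<subseteq> I \<times> J"
    using F by (metis finite_imageI fst_image_times subset_fst_snd finite_subset)
  define N where "N = (\<Sum>i\<in>I \<union> J. \<bar>i\<bar>)"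
  have N: "- N \<le> i" "i \<le> N" if "i \<in> I \<union> J" for i
    using member_le_sum[of i "I \<union> J" abs] that IJ unfolding N_def by auto
  \<comment> \<open>Boundary terms of the telescoping sums, started \<open>l\<close> steps outside a
    box that contains \<open>F\<close>; they vanish as \<open>l\<close> grows.\<close>
  define x where "x l = (\<Sum>j\<in>J. \<bar>w (- N - int l, j)\<bar> ^ k)" for l
  define y where "y l = (\<Sum>i\<in>I. \<bar>w (i, - N - int l)\<bar> ^ k)" for l
  have x0: "x \<longlonglongrightarrow> 0"
  proof -
    have "x \<longlonglongrightarrow> (\<Sum>j\<in>J. \<bar>0\<bar> ^ k)" unfolding x_def[abs_def]
      by (intro tendsto_sum tendsto_power tendsto_rabs tendsto_zero_along_injection[OF S]) (auto simp: inj_def)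
    then show ?thesis using k by (simp add: zero_power)
  qed
  have y0: "y \<longlonglongrightarrow> 0"
  proof -
    have "y \<longlonglongrightarrow> (\<Sum>i\<in>I. \<bar>0\<bar> ^ k)" unfolding y_def[abs_def]
      by (intro tendsto_sum tendsto_power tendsto_rabs tendsto_zero_along_injection[OF S]) (auto simp: inj_def)
    then show ?thesis using k by (simp add: zero_power)
  qed
  have bound: "(\<Sum>z\<in>F. w z ^ (2 * k)) \<le> (x l + A) * (y l + B)" for l
  proof -
    define R where "R j = \<bar>w (- N - int l, j)\<bar> ^ k + (\<Sum>c\<in>{- N - int l..<N}. \<bar>w (c + 1, j) ^ k - w (c, j) ^ k\<bar>)" for j
    define C where "C i = \<bar>w (i, - N - int l)\<bar> ^ k + (\<Sum>c\<in>{- N - int l..<N}. \<bar>w (i, c + 1) ^ k - w (i, c) ^ k\<bar>)" for i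
    have R0: "0 \<le> R j" and C0: "0 \<le> C i" for i j unfolding R_def C_def by (auto intro!: add_nonneg_nonneg sum_nonneg)
    have wR: "\<bar>w (i, j)\<bar> ^ k \<le> R j" if "i \<in> I" for i j
    proof -
      have "\<bar>w (i, j) ^ k\<bar> \<le> \<bar>w (- N - int l, j) ^ k\<bar> + (\<Sum>c\<in>{- N - int l..<i}. \<bar>w (c + 1, j) ^ k - w (c, j) ^ k\<bar>)"
        using N(1)[of i] that by (intro tele[where h = "\<lambda>c. w (c, j) ^ k"]) auto
      also have "(\<Sum>c\<in>{- N - int l..<i}. \<bar>w (c + 1, j) ^ k - w (c, j) ^ k\<bar>) \<le> (\<Sum>c\<in>{- N - int l..<N}. \<bar>w (c + 1, j) ^ k - w (c, j) ^ k\<bar>)"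
        using N(2)[of i] that by (intro sum_mono2) auto
      finally show ?thesis unfolding R_def power_abs by simp
    qed
    have wC: "\<bar>w (i, j)\<bar> ^ k \<le> C i" if "j \<in> J" for i j
    proof -
      have "\<bar>w (i, j) ^ k\<bar> \<le> \<bar>w (i, - N - int l) ^ k\<bar> + (\<Sum>c\<in>{- N - int l..<j}. \<bar>w (i, c + 1) ^ k - w (i, c) ^ k\<bar>)"
        using N(1)[of j] that by (intro tele[where h = "\<lambda>c. w (i, c) ^ k"]) auto
      also have "(\<Sum>c\<in>{- N - int l..<j}. \<bar>w (i, c + 1) ^ k - w (i, c) ^ k\<bar>) \<le> (\<Sum>c\<in>{- N - int l..<N}. \<bar>w (i, c + 1) ^ k - w (i, c) ^ k\<bar>)"
        using N(2)[of j] that by (intro sum_mono2) auto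
      finally show ?thesis unfolding C_def power_abs by simp
    qed
    have "(\<Sum>z\<in>F. w z ^ (2 * k)) \<le> (\<Sum>z\<in>I \<times> J. w z ^ (2 * k))"
      using IJ by (intro sum_mono2) (auto simp: power_mult)
    also have "\<dots> \<le> (\<Sum>z\<in>I \<times> J. C (fst z) * R (snd z))"
    proof (rule sum_mono)
      fix z assume z: "z \<in> I \<times> J"
      have "w z ^ (2 * k) = \<bar>w z\<bar> ^ k * \<bar>w z\<bar> ^ k" by (simp add: mult_2 power_add flip: power_mult_distrib)
      also have "\<dots> \<le> C (fst z) * R (snd z)" using z wR wC C0 by (intro mult_mono) auto
      finally show "w z ^ (2 * k) \<le> C (fst z) * R (snd z)" .
    qed
    \<comment> \<open>The column bound depends only on \<open>i\<close> and the row bound only on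
      \<open>j\<close>, so the double sum factorizes.\<close>
    also have "\<dots> = (\<Sum>i\<in>I. C i) * (\<Sum>j\<in>J. R j)" by (simp add: sum_product sum.cartesian_product case_prod_beta)
    also have "\<dots> \<le> (y l + B) * (x l + A)"
    proof (rule mult_mono)
      have "(\<Sum>i\<in>I. C i) = y l + (\<Sum>z\<in>I \<times> {- N - int l..<N}. \<bar>w (fst z, snd z + 1) ^ k - w z ^ k\<bar>)"
        unfolding C_def y_def by (simp add: sum.distrib sum.cartesian_product case_prod_beta)
      also have "\<dots> \<le> y l + B" using IJ by (intro add_left_mono B) auto
      finally show "(\<Sum>i\<in>I. C i) \<le> y l + B" .
      have "(\<Sum>j\<in>J. R j) = x l + (\<Sum>j\<in>J. \<Sum>c\<in>{- N - int l..<N}. \<bar>w (c + 1, j) ^ k - w (c, j) ^ k\<bar>)"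
        unfolding R_def x_def by (simp add: sum.distrib)
      also have "(\<Sum>j\<in>J. \<Sum>c\<in>{- N - int l..<N}. \<bar>w (c + 1, j) ^ k - w (c, j) ^ k\<bar>) =
          (\<Sum>z\<in>{- N - int l..<N} \<times> J. \<bar>w (fst z + 1, snd z) ^ k - w z ^ k\<bar>)"
        by (subst sum.swap) (simp add: sum.cartesian_product case_prod_beta)
      also have "x l + \<dots> \<le> x l + A" using IJ by (intro add_left_mono A) auto
      finally show "(\<Sum>j\<in>J. R j) \<le> x l + A" .
      show "0 \<le> y l + B" using B0 unfolding y_def by (intro add_nonneg_nonneg sum_nonneg) auto
      show "0 \<le> (\<Sum>j\<in>J. R j)" using R0 by (intro sum_nonneg)
    qed
    finally show ?thesis by (simp add: mult.commute)
  qed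
  have "(\<lambda>l. (x l + A) * (y l + B)) \<longlonglongrightarrow> (0 + A) * (0 + B)" by (intro tendsto_intros x0 y0)
  then have "(\<Sum>z\<in>F. w z ^ (2 * k)) \<le> (0 + A) * (0 + B)" by (rule LIMSEQ_le_const) (use bound in auto)
  then show ?thesis by simp
qed

text \<open>A bootstrap on the exponent: the sum of powers \<open>2 * Suc k\<close> and the gradient
  control the variation of the next power of \<open>w\<close>, and the product of row and column
  variations controls the next even power sum. Each round contributes \<open>G\<close> and a factor
  \<open>4 * (k + 2)^2\<close>, which accumulate to the power of 4 and the squared
  factorial.\<close>

lemma lattice_power_sum_le:
  fixes w :: "int \<times> int \<Rightarrow> real"
  assumes S: "\<And>F. finite F \<Longrightarrow> (\<Sum>z\<in>F. (w z)\<^sup>2) \<le> S"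
    and gx: "\<And>F. finite F \<Longrightarrow> (\<Sum>z\<in>F. (w (fst z + 1, snd z) - w z)\<^sup>2) \<le> G"
    and gy: "\<And>F. finite F \<Longrightarrow> (\<Sum>z\<in>F. (w (fst z, snd z + 1) - w z)\<^sup>2) \<le> G"
  shows "finite F \<Longrightarrow> (\<Sum>z\<in>F. w z ^ (2 * Suc k)) \<le> 4 ^ k * (fact (Suc k))\<^sup>2 * G ^ k * S"
proof (induction k arbitrary: F)
  case 0
  then show ?case using S by simp
next
  case (Suc k)
  define N where "N = 4 ^ k * (fact (Suc k))\<^sup>2 * G ^ k * S"
  define A where "A = 4 * (real (Suc (Suc k)))\<^sup>2 * G * N"
  have G0: "0 \<le> G" and N0: "0 \<le> N" using gx[of "{}"] Suc.IH[of "{}"] by (auto simp: N_def)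
  have a: "(\<Sum>z\<in>F. \<bar>w (fst z + 1, snd z) ^ Suc (Suc k) - w z ^ Suc (Suc k)\<bar>) \<le> sqrt A" if "finite F" for F
    unfolding A_def using Suc.IH that gx
    by (intro sum_power_increment_le[where s = "\<lambda>z. (fst z + 1, snd z)"]) (auto simp: inj_def prod_eq_iff N_def)
  have b: "(\<Sum>z\<in>F. \<bar>w (fst z, snd z + 1) ^ Suc (Suc k) - w z ^ Suc (Suc k)\<bar>) \<le> sqrt A" if "finite F" for F
    unfolding A_def using Suc.IH that gy
    by (intro sum_power_increment_le[where s = "\<lambda>z. (fst z, snd z + 1)"]) (auto simp: inj_def prod_eq_iff N_def)
  have "(\<Sum>z\<in>F. w z ^ (2 * Suc (Suc k))) \<le> sqrt A * sqrt A"
    by (rule lattice_power_sum_step[OF S a b]) (use Suc.prems in auto)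
  also have "\<dots> = A" unfolding A_def using G0 N0 by simp
  also have "A = 4 ^ Suc k * (fact (Suc (Suc k)))\<^sup>2 * G ^ Suc k * S"
  proof -
    have "fact (Suc (Suc k)) = real (Suc (Suc k)) * fact (Suc k)" by (simp only: fact_Suc of_nat_mult)
    then show ?thesis unfolding A_def N_def by (simp only: power_mult_distrib power_Suc mult_ac)
  qed
  finally show ?case .
qed

section \<open>From the lattice of vertices back to the grid\<close>

context grid_nls
begin

text \<open>Each vertex value is charged to the horizontal edge starting there, so no edge is used
  twice. The window length stays free, to make the square sum small when the mass is small.\<close>

lemma vertex_sums:
  assumes u: "u \<in> H1 eps" and l: "0 < l" "l \<le> eps" and F: "finite F"
  shows "(\<Sum>z\<in>F. (u (vtx eps z))\<^sup>2) \<le> 2 / l * mass u + 2 * l * D u"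
    and "(\<Sum>z\<in>F. (u (vtx eps (fst z + 1, snd z)) - u (vtx eps z))\<^sup>2) \<le> eps * D u"
    and "(\<Sum>z\<in>F. (u (vtx eps (fst z, snd z + 1)) - u (vtx eps z))\<^sup>2) \<le> eps * D u"
proof -
  have em: "(\<Sum>z\<in>F. edge_mass eps u (z, d)) \<le> mass u" for d
  proof -
    have "(\<Sum>z\<in>F. edge_mass eps u (z, d)) = sum (edge_mass eps u) ((\<lambda>z. (z, d)) ` F)" by (subst sum.reindex) (auto simp: inj_on_def)
    also have "\<dots> \<le> mass u" using F edge_mass_nonneg by (intro finite_sum_le_has_sum[OF edge_mass_has_sum[OF eps0 u]]) auto
    finally show ?thesis .
  qed
  have ed: "(\<Sum>z\<in>F. edge_dirichlet eps u (z, d)) \<le> D u" for d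
  proof -
    have "(\<Sum>z\<in>F. edge_dirichlet eps u (z, d)) = sum (edge_dirichlet eps u) ((\<lambda>z. (z, d)) ` F)" by (subst sum.reindex) (auto simp: inj_on_def)
    also have "\<dots> \<le> D u" using F edge_dirichlet_nonneg by (intro finite_sum_le_has_sum[OF edge_dirichlet_has_sum[OF u]]) auto
    finally show ?thesis .
  qed
  have "(\<Sum>z\<in>F. (u (vtx eps z))\<^sup>2) \<le> (\<Sum>z\<in>F. 2 / l * edge_mass eps u (z, True) + 2 * l * edge_dirichlet eps u (z, True))"
    using edge_sup_bound[OF eps u _ l, of 0 "(z, True)" for z] eps by (intro sum_mono) (auto simp: edge_fun_start)
  also have "\<dots> = 2 / l * (\<Sum>z\<in>F. edge_mass eps u (z, True)) + 2 * l * (\<Sum>z\<in>F. edge_dirichlet eps u (z, True))"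
    by (simp add: sum.distrib sum_distrib_left)
  also have "\<dots> \<le> 2 / l * mass u + 2 * l * D u" using em ed l by (intro add_mono mult_left_mono) auto
  finally show "(\<Sum>z\<in>F. (u (vtx eps z))\<^sup>2) \<le> 2 / l * mass u + 2 * l * D u" .
  have h: "(edge_fun eps u e eps - edge_fun eps u e 0)\<^sup>2 \<le> eps * edge_dirichlet eps u e" for e
    using h1_deriv_Hoelder[OF H1_der[OF u], of 0 eps e] eps by (simp add: edge_dirichlet_eq ip_self)
  have v: "edge_fun eps u (z, True) eps = u (vtx eps (fst z + 1, snd z))" "edge_fun eps u (z, False) eps = u (vtx eps (fst z, snd z + 1))"
    "edge_fun eps u (z, d) 0 = u (vtx eps z)" for z d
    by (simp_all add: edge_fun_def vtx_def distrib_left)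
  have s: "(\<Sum>z\<in>F. (edge_fun eps u (z, d) eps - edge_fun eps u (z, d) 0)\<^sup>2) \<le> eps * D u" for d
  proof -
    have "(\<Sum>z\<in>F. (edge_fun eps u (z, d) eps - edge_fun eps u (z, d) 0)\<^sup>2) \<le> (\<Sum>z\<in>F. eps * edge_dirichlet eps u (z, d))"
      by (intro sum_mono h)
    also have "\<dots> \<le> eps * D u" unfolding sum_distrib_left[symmetric] using ed eps by (intro mult_left_mono) auto
    finally show ?thesis .
  qed
  show "(\<Sum>z\<in>F. (u (vtx eps (fst z + 1, snd z)) - u (vtx eps z))\<^sup>2) \<le> eps * D u"
    "(\<Sum>z\<in>F. (u (vtx eps (fst z, snd z + 1)) - u (vtx eps z))\<^sup>2) \<le> eps * D u"
    using s[of True] s[of False] unfolding v by auto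
qed

text \<open>The choice \<open>l = sqrt (mass u)\<close> makes both terms of the window estimate
  small with the mass alone, as long as the Dirichlet energy is at most 1.\<close>

lemma window_sqrt_mass:
  assumes "0 < mass u" "D u \<le> 1"
  shows "2 / sqrt (mass u) * mass u + 2 * sqrt (mass u) * D u \<le> 4 * sqrt (mass u)"
proof -
  have "2 / sqrt (mass u) * mass u = 2 * (mass u / sqrt (mass u))" by simp
  also have "\<dots> = 2 * sqrt (mass u)" using assms by (simp add: real_div_sqrt)
  finally have "2 / sqrt (mass u) * mass u = 2 * sqrt (mass u)" .
  moreover have "2 * sqrt (mass u) * D u \<le> 2 * sqrt (mass u) * 1" using assms by (intro mult_left_mono) auto
  ultimately show ?thesis by linarith
qed

lemma vertex_power_sum_le:
  assumes u: "u \<in> H1 eps" and m: "0 < mass u" "sqrt (mass u) \<le> eps" and D1: "D u \<le> 1" and F: "finite F"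
  shows "(\<Sum>z\<in>F. u (vtx eps z) ^ (2 * Suc k)) \<le> 4 ^ k * (fact (Suc k))\<^sup>2 * (eps * D u) ^ k * (4 * sqrt (mass u))"
proof -
  note l = vertex_sums[OF u, of "sqrt (mass u)"]
  have "(\<Sum>z\<in>F. (u (vtx eps z))\<^sup>2) \<le> 4 * sqrt (mass u)" if "finite F" for F
    by (rule order_trans[OF l(1) window_sqrt_mass[OF m(1) D1]]) (use m that in auto)
  then show ?thesis using l(2,3) m F
    by (intro lattice_power_sum_le[where w = "\<lambda>z. u (vtx eps z)"]) auto
qed

lemma sup_le_small:
  assumes u: "u \<in> H1 eps" and m: "0 < mass u" "sqrt (mass u) \<le> eps" and D1: "D u \<le> 1" and t: "t \<in> {0..eps}"
  shows "(edge_fun eps u e t)\<^sup>2 \<le> 4 * sqrt (mass u)"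
  using sup_bound[OF eps u t _ m(2), of e] window_sqrt_mass[OF m(1) D1] m(1) by simp

text \<open>The window \<open>l = sqrt (mass u / D u)\<close> makes the two terms equal; it fits
  into an edge because \<open>D u\<close> is at least 1.\<close>

lemma sup_le_large:
  assumes u: "u \<in> H1 eps" and m: "0 < mass u" "sqrt (mass u) \<le> eps" and D1: "1 \<le> D u" and t: "t \<in> {0..eps}"
  shows "(edge_fun eps u e t)\<^sup>2 \<le> 4 * sqrt (mass u * D u)"
proof -
  define l where "l = sqrt (mass u / D u)"
  have l: "0 < l" unfolding l_def using m D1 by simp
  have "l \<le> sqrt (mass u)" unfolding l_def using m D1 by (simp add: divide_le_eq)
  then have le: "l \<le> eps" using m by simp
  have ll: "l * l = mass u / D u" unfolding l_def using m D1 by simp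
  have lD: "l * D u = sqrt (mass u * D u)"
  proof -
    have "(l * D u)\<^sup>2 = mass u * D u" using ll D1 by (simp add: power2_eq_square field_simps)
    then show ?thesis using l D1 by (intro real_sqrt_unique[symmetric]) auto
  qed
  have "mass u = l * (l * D u)" using ll D1 by (simp add: field_simps)
  then have "2 / l * mass u = 2 * (l * D u)" using l by (simp add: field_simps)
  then show ?thesis using sup_bound[OF eps u t l le, of e] lD by simp
qed

lemma power4_integrable:
  assumes u: "u \<in> H1 eps" shows "integrable (EM eps) (\<lambda>x. (pr eps u x) ^ 4)"
proof -
  have "\<bar>x\<bar> powr 4 = x ^ 4" for x :: real by (cases "x = 0") (auto simp: powr_numeral)
  then show ?thesis using Lr_integrable[OF eps u, of 4] by simp
qed

text \<open>On an edge \<open>u\<close> is its starting vertex value plus an oscillation. Fourth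
  powers of vertex values are summed by the lattice inequality. The squared oscillation is at most
  \<open>eps\<close> times the Dirichlet energy of the edge and also at most
  \<open>4 * \<eta>\<close>, so its square is small and linear in that energy. The two parts
  contribute 256 and 32 to the constant 288, and 1152 is 4 times that.\<close>

lemma L4_le:
  assumes u: "u \<in> H1 eps" and m: "0 < mass u" "sqrt (mass u) \<le> eps" and D1: "D u \<le> 1"
  shows "(\<integral>x. (pr eps u x) ^ 4 \<partial>EM eps) \<le> 1152 * eps\<^sup>2 * sqrt (mass u) * D u"
proof -
  define \<eta> where "\<eta> = 4 * sqrt (mass u)"
  have \<eta>: "0 \<le> \<eta>" unfolding \<eta>_def using m by simp
  have sup: "(edge_fun eps u e t)\<^sup>2 \<le> \<eta>" if "t \<in> {0..eps}" for e t
    unfolding \<eta>_def by (rule sup_le_small[OF u m D1 that])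
  note i4 = power4_integrable[OF u]
  have pt: "(pr eps u (e, t)) ^ 4 \<le> 8 * u (vtx eps (fst e)) ^ 4 + 32 * \<eta> * eps * edge_dirichlet eps u e"
    if t: "t \<in> {0..eps}" for e t
  proof -
    let ?a = "edge_fun eps u e t" and ?w = "edge_fun eps u e 0"
    have "(?a - ?w)\<^sup>2 \<le> \<bar>t - 0\<bar> * edge_dirichlet eps u e"
      using h1_deriv_Hoelder[OF H1_der[OF u], of 0 t e] t by (simp add: edge_dirichlet_eq ip_self)
    also have "\<dots> \<le> eps * edge_dirichlet eps u e"
      using t edge_dirichlet_nonneg by (intro mult_right_mono) auto
    finally have h: "(?a - ?w)\<^sup>2 \<le> eps * edge_dirichlet eps u e" .
    have 4: "x ^ 4 = (x\<^sup>2)\<^sup>2" for x :: real by simp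
    have "(?a - ?w)\<^sup>2 \<le> 4 * \<eta>"
      using sum_squared_le[of ?a "- ?w"] sup[OF t, of e] sup[of 0 e] eps by simp
    then have "(?a - ?w) ^ 4 \<le> 4 * \<eta> * (eps * edge_dirichlet eps u e)"
      unfolding 4 power2_eq_square[of "(?a - ?w)\<^sup>2"] using h \<eta> by (intro mult_mono) auto
    moreover have "?a ^ 4 \<le> 8 * ?w ^ 4 + 8 * (?a - ?w) ^ 4"
    proof -
      have "?a\<^sup>2 \<le> 2 * ?w\<^sup>2 + 2 * (?a - ?w)\<^sup>2" using sum_squared_le[of ?w "?a - ?w"] by simp
      then have "(?a\<^sup>2)\<^sup>2 \<le> (2 * ?w\<^sup>2 + 2 * (?a - ?w)\<^sup>2)\<^sup>2" by (intro power_mono) auto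
      also have "\<dots> \<le> 2 * (2 * ?w\<^sup>2)\<^sup>2 + 2 * (2 * (?a - ?w)\<^sup>2)\<^sup>2" by (rule sum_squared_le)
      finally show ?thesis unfolding 4 by (simp add: power_mult_distrib)
    qed
    ultimately show ?thesis unfolding edge_fun_start by (simp add: pr_def)
  qed
  \<comment> \<open>The case \<open>k = 1\<close> of the lattice inequality; 16 is 4 times the
    square of \<open>fact 2\<close>.\<close>
  have W: "(\<Sum>z\<in>F. u (vtx eps z) ^ 4) \<le> 16 * (eps * D u) * \<eta>" if "finite F" for F
  proof -
    have "x ^ (2 * Suc 1) = x ^ 4" "fact (Suc 1) = (2::real)" for x :: real by simp_all
    from vertex_power_sum_le[OF u m D1 that, of 1, unfolded this] show ?thesis unfolding \<eta>_def by simp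
  qed
  have "(\<Sum>e\<in>F. \<integral>t. (pr eps u (e, t)) ^ 4 \<partial>Iv eps) \<le> 288 * eps\<^sup>2 * \<eta> * D u" if F: "finite F" for F
  proof -
    have lI: "(\<integral>t. (c::real) \<partial>Iv eps) = eps * c" for c using eps by (simp add: measure_restrict_space)
    have "(\<Sum>e\<in>F. \<integral>t. (pr eps u (e, t)) ^ 4 \<partial>Iv eps) \<le> (\<Sum>e\<in>F. eps * (8 * u (vtx eps (fst e)) ^ 4 + 32 * \<eta> * eps * edge_dirichlet eps u e))"
    proof (rule sum_mono)
      fix e
      have "(\<integral>t. (pr eps u (e, t)) ^ 4 \<partial>Iv eps) \<le> (\<integral>t. 8 * u (vtx eps (fst e)) ^ 4 + 32 * \<eta> * eps * edge_dirichlet eps u e \<partial>Iv eps)"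
        using pt by (intro integral_mono integrable_EM_slice[OF i4]) (auto simp: space_Iv)
      then show "(\<integral>t. (pr eps u (e, t)) ^ 4 \<partial>Iv eps) \<le> eps * (8 * u (vtx eps (fst e)) ^ 4 + 32 * \<eta> * eps * edge_dirichlet eps u e)"
        unfolding lI .
    qed
    also have "\<dots> = 8 * eps * (\<Sum>e\<in>F. u (vtx eps (fst e)) ^ 4) + 32 * \<eta> * eps\<^sup>2 * (\<Sum>e\<in>F. edge_dirichlet eps u e)"
      by (simp only: sum.distrib sum_distrib_left[symmetric]) (simp add: algebra_simps power2_eq_square)
    also have "\<dots> \<le> 8 * eps * (32 * (eps * D u) * \<eta>) + 32 * \<eta> * eps\<^sup>2 * D u"
    proof (intro add_mono mult_left_mono)
      \<comment> \<open>Two edges start at each vertex, which doubles 16 to 32.\<close>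
      have "(\<Sum>e\<in>F. u (vtx eps (fst e)) ^ 4) \<le> (\<Sum>e\<in>fst ` F \<times> (UNIV :: bool set). u (vtx eps (fst e)) ^ 4)"
      proof (rule sum_mono2)
        show "F \<subseteq> fst ` F \<times> UNIV" by (intro subsetI) (simp add: mem_Times_iff)
      qed (use F in auto)
      also have "\<dots> = (\<Sum>z\<in>fst ` F. \<Sum>d\<in>(UNIV :: bool set). u (vtx eps z) ^ 4)"
        unfolding sum.cartesian_product by (intro sum.cong) auto
      also have "\<dots> = 2 * (\<Sum>z\<in>fst ` F. u (vtx eps z) ^ 4)" by (simp add: sum_distrib_left)
      also have "\<dots> \<le> 32 * (eps * D u) * \<eta>" using W[OF finite_imageI[OF F, of fst]] by linarith
      finally show "(\<Sum>e\<in>F. u (vtx eps (fst e)) ^ 4) \<le> 32 * (eps * D u) * \<eta>" .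
      show "(\<Sum>e\<in>F. edge_dirichlet eps u e) \<le> D u"
        using F edge_dirichlet_nonneg by (intro finite_sum_le_has_sum[OF edge_dirichlet_has_sum[OF u]]) auto
    qed (use eps \<eta> in auto)
    also have "\<dots> = 288 * eps\<^sup>2 * \<eta> * D u" by (simp add: power2_eq_square)
    finally show ?thesis .
  qed
  then have "(\<integral>x. (pr eps u x) ^ 4 \<partial>EM eps) \<le> 288 * eps\<^sup>2 * \<eta> * D u"
    using has_sum_le_finite_sums[OF integral_EM[OF i4]] by auto
  then show ?thesis unfolding \<eta>_def by simp
qed

end

section \<open>Small masses and the critical mass\<close>

context grid_nls
begin

text \<open>For Dirichlet energy at most 1 small mass forces values of size at most 1, so the power
  \<open>p \<ge> 4\<close> is dominated by the fourth power. For larger energy the one-dimensional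
  sup bound suffices.\<close>

lemma Lp_le_small_mass:
  assumes p4: "4 \<le> p" and u: "u \<in> H1 eps" and m: "0 < mass u" "sqrt (mass u) \<le> eps" "4 * sqrt (mass u) \<le> 1"
  shows "Lr_pow eps p u \<le> max (1152 * eps\<^sup>2 * sqrt (mass u)) (16 * mass u) * D u" (is "_ \<le> ?B")
proof (cases "D u \<le> 1")
  case True
  note i4 = power4_integrable[OF u]
  have p2: "2 \<le> p" using p by simp
  have "\<bar>pr eps u x\<bar> powr p \<le> (pr eps u x) ^ 4" if x: "x \<in> space (EM eps)" for x
  proof (cases "pr eps u x = 0")
    case False
    have "(pr eps u x)\<^sup>2 \<le> 1"
      using sup_le_small[OF u m(1,2) True, of "snd x" "fst x"] x m(3) by (auto simp: space_EM pr_def)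
    then have "\<bar>pr eps u x\<bar> \<le> 1" by (simp add: abs_square_le_1)
    then have "\<bar>pr eps u x\<bar> powr p \<le> \<bar>pr eps u x\<bar> powr 4" using p4 False by (intro powr_mono') auto
    also have "\<bar>pr eps u x\<bar> powr 4 = (pr eps u x) ^ 4" using False by (simp add: powr_numeral)
    finally show ?thesis .
  qed simp
  then have "Lr_pow eps p u \<le> (\<integral>x. (pr eps u x) ^ 4 \<partial>EM eps)"
    unfolding Lr_pow_eq[OF Lr_integrable[OF eps u p2]] by (intro integral_mono Lr_integrable[OF eps u p2] i4)
  also have "\<dots> \<le> 1152 * eps\<^sup>2 * sqrt (mass u) * D u" by (rule L4_le[OF u m(1,2) True])
  also have "\<dots> \<le> ?B"
    using dirichlet_nonneg[of eps u] by (intro mult_right_mono) auto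
  finally show ?thesis .
next
  case False
  then have D1: "1 \<le> D u" by simp
  define S where "S = sqrt (4 * sqrt (mass u * D u))"
  have S: "\<bar>edge_fun eps u e t\<bar> \<le> S" if "t \<in> {0..eps}" for e t
    unfolding S_def using real_sqrt_le_mono[OF sup_le_large[OF u m(1,2) D1 that, of e]] by simp
  have m1: "mass u \<le> 1"
  proof -
    have "sqrt (mass u) \<le> 1" using m(3) by linarith
    then show ?thesis by simp
  qed
  have "S powr (p - 2) = 4 powr ((p - 2) / 2) * (mass u powr ((p - 2) / 4) * D u powr ((p - 2) / 4))"
    unfolding S_def using m D1 by (simp add: powr_half_sqrt[symmetric] powr_powr powr_mult)
  \<comment> \<open>Here \<open>p < 6\<close> makes the exponent of \<open>D u\<close> at most 1 and
    that of 4 at most 2.\<close>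
  also have "\<dots> \<le> 4 powr 2 * (1 * D u powr 1)"
    using m m1 D1 p by (intro mult_mono powr_mono powr_le1 mult_nonneg_nonneg) auto
  finally have "S powr (p - 2) \<le> 16 * D u" using D1 by simp
  have "Lr_pow eps p u \<le> S powr (p - 2) * mass u" using p by (intro Lr_le[OF eps u] S) auto
  also have "\<dots> \<le> 16 * D u * mass u" using \<open>S powr (p - 2) \<le> 16 * D u\<close> m by (intro mult_right_mono) auto
  also have "\<dots> = 16 * mass u * D u" by simp
  also have "\<dots> \<le> ?B"
    using D1 by (intro mult_right_mono) auto
  finally show ?thesis .
qed

text \<open>The exponent \<open>k q / (2 k + 2)\<close> of the Dirichlet energy produced by the lattice inequality is at
  least 1 once \<open>k\<close> is large, which is where \<open>q > 2\<close> enters.\<close>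

lemma vertex_le_small_mass:
  obtains c r where "0 \<le> c" "0 < r"
    "\<And>u z. u \<in> H1 eps \<Longrightarrow> 0 < mass u \<Longrightarrow> sqrt (mass u) \<le> eps \<Longrightarrow> 4 * sqrt (mass u) \<le> 1 \<Longrightarrow>
      \<bar>u (vtx eps z)\<bar> powr q \<le> max (c * sqrt (mass u) powr r) (16 * sqrt (mass u)) * D u"
proof -
  \<comment> \<open>Equivalent to \<open>k * q > 2 * k + 2\<close>, so the exponent
    \<open>k * r\<close> of the Dirichlet energy exceeds 1.\<close>
  obtain k :: nat where k: "2 / (q - 2) < real k" using reals_Archimedean2 by blast
  define r where "r = q / (2 * real (Suc k))"
  have r: "0 < r" unfolding r_def using q by simp
  have kr: "1 \<le> real k * r"
  proof -
    have "2 < real k * (q - 2)" using k q by (simp add: pos_divide_less_eq)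
    then show ?thesis unfolding r_def by (simp add: field_simps)
  qed
  define c where "c = (4 ^ k * (fact (Suc k))\<^sup>2 * eps ^ k * 4) powr r"
  have c: "0 \<le> c" unfolding c_def by simp
  have "\<bar>u (vtx eps z)\<bar> powr q \<le> max (c * sqrt (mass u) powr r) (16 * sqrt (mass u)) * D u"
    if u: "u \<in> H1 eps" and m: "0 < mass u" "sqrt (mass u) \<le> eps" "4 * sqrt (mass u) \<le> 1" for u z
  proof (cases "D u \<le> 1")
    case True
    let ?w = "u (vtx eps z)"
    have D0: "0 \<le> D u" by (rule dirichlet_nonneg)
    show ?thesis
    proof (cases "?w = 0")
      case False
      \<comment> \<open>The lattice inequality for the single vertex \<open>z\<close>.\<close>
      have "?w ^ (2 * Suc k) \<le> 4 ^ k * (fact (Suc k))\<^sup>2 * (eps * D u) ^ k * (4 * sqrt (mass u))"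
        using vertex_power_sum_le[OF u m(1,2) True, of "{z}" k] by simp
      also have "\<dots> = (4 ^ k * (fact (Suc k))\<^sup>2 * eps ^ k * 4) * (sqrt (mass u) * D u ^ k)"
        by (simp add: power_mult_distrib mult_ac)
      finally have le: "?w ^ (2 * Suc k) \<le> (4 ^ k * (fact (Suc k))\<^sup>2 * eps ^ k * 4) * (sqrt (mass u) * D u ^ k)" .
      have "\<bar>?w\<bar> powr q = (\<bar>?w\<bar> powr (real (2 * Suc k))) powr r" unfolding powr_powr r_def by simp
      also have "\<bar>?w\<bar> powr (real (2 * Suc k)) = ?w ^ (2 * Suc k)" using False by (subst powr_realpow) (auto simp: power_even_abs)
      also have "(?w ^ (2 * Suc k)) powr r \<le> ((4 ^ k * (fact (Suc k))\<^sup>2 * eps ^ k * 4) * (sqrt (mass u) * D u ^ k)) powr r"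
      proof (rule powr_mono2[OF less_imp_le[OF r] _ le])
        show "0 \<le> ?w ^ (2 * Suc k)" unfolding power_mult by (rule zero_le_power[OF zero_le_power2])
      qed
      also have "\<dots> = c * (sqrt (mass u) powr r * (D u ^ k) powr r)"
        unfolding c_def using eps D0 m by (simp add: powr_mult)
      also have "(D u ^ k) powr r \<le> D u"
      proof (cases "D u = 0")
        case True
        have "0 < k" using kr by (cases k) auto
        then show ?thesis using True by simp
      next
        case False
        then have "(D u ^ k) powr r = D u powr (real k * r)" using D0 by (simp add: powr_realpow[symmetric] powr_powr)
        also have "\<dots> \<le> D u powr 1" using kr \<open>D u \<le> 1\<close> D0 by (intro powr_mono') auto
        finally show ?thesis using D0 by simp
      qed
      then have "c * (sqrt (mass u) powr r * (D u ^ k) powr r) \<le> c * sqrt (mass u) powr r * D u"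
        unfolding mult.assoc using c by (intro mult_left_mono) auto
      also have "\<dots> \<le> max (c * sqrt (mass u) powr r) (16 * sqrt (mass u)) * D u"
        using D0 by (intro mult_right_mono) auto
      finally show ?thesis .
    qed (use m D0 in \<open>simp add: le_max_iff_disj\<close>)
  next
    case False
    then have D1: "1 \<le> D u" by simp
    have s1: "sqrt (mass u) \<le> 1" using m(3) by linarith
    have "\<bar>u (vtx eps z)\<bar> \<le> sqrt (4 * sqrt (mass u * D u))"
      using real_sqrt_le_mono[OF sup_le_large[OF u m(1,2) D1, of 0 "(z, True)"]] eps by (simp add: edge_fun_start)
    then have "\<bar>u (vtx eps z)\<bar> powr q \<le> sqrt (4 * sqrt (mass u * D u)) powr q" using q by (intro powr_mono2) auto
    also have "\<dots> = 4 powr (q / 2) * (sqrt (mass u) powr (q / 2) * D u powr (q / 4))"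
      using m D1 by (simp add: powr_half_sqrt[symmetric] powr_powr powr_mult)
    \<comment> \<open>The exponents use \<open>2 < q\<close> for \<open>sqrt (mass u)\<close>, which
      is at most 1, and \<open>q < 4\<close> for 4 and for \<open>D u\<close>, which is at least
      1.\<close>
    also have "\<dots> \<le> 4 powr 2 * (sqrt (mass u) powr 1 * D u powr 1)"
      using m s1 D1 q by (intro mult_mono powr_mono powr_mono' mult_nonneg_nonneg) auto
    also have "\<dots> = 16 * sqrt (mass u) * D u" using m D1 by simp
    also have "\<dots> \<le> max (c * sqrt (mass u) powr r) (16 * sqrt (mass u)) * D u"
      using D1 by (intro mult_right_mono) auto
    finally show ?thesis .
  qed
  with that[OF c r] show ?thesis by blast
qed

text \<open>For small \<open>s = sqrt \<mu>\<close> each nonlinear term is at most a quarter of the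
  Dirichlet energy, and the kinetic half pays for both. The number of vertices in \<open>V\<close>
  enters the threshold through \<open>g\<close>.\<close>

lemma E_nonneg_small_mass:
  assumes V: "finite V" and p4: "4 \<le> p"
  shows "\<exists>\<mu>0>0. \<forall>\<mu>. 0 < \<mu> \<and> \<mu> \<le> \<mu>0 \<longrightarrow> (\<forall>u\<in>H1_mass eps \<mu>. 0 \<le> E V u)"
proof -
  obtain c r where c: "0 \<le> c" "0 < r" and vx: "\<And>u z. u \<in> H1 eps \<Longrightarrow> 0 < mass u \<Longrightarrow> sqrt (mass u) \<le> eps \<Longrightarrow> 4 * sqrt (mass u) \<le> 1 \<Longrightarrow>
      \<bar>u (vtx eps z)\<bar> powr q \<le> max (c * sqrt (mass u) powr r) (16 * sqrt (mass u)) * D u"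
    using vertex_le_small_mass by blast
  define f where "f s = \<alpha> / p * max (1152 * eps\<^sup>2 * s) (16 * s\<^sup>2)" for s
  define g where "g s = \<beta> / q * (real (card V) * max (c * s powr r) (16 * s))" for s
  have "(f \<longlongrightarrow> \<alpha> / p * max (1152 * eps\<^sup>2 * 0) (16 * 0\<^sup>2)) (at_right 0)" unfolding f_def
    by (intro tendsto_intros)
  then have ef: "\<forall>\<^sub>F s in at_right 0. f s < 1/4" by (intro order_tendstoD(2)) auto
  have pw: "((\<lambda>s. s powr r) \<longlongrightarrow> 0 powr r) (at_right (0::real))"
    using c by (intro tendsto_powr' tendsto_ident_at tendsto_const) (auto intro: eventually_mono[OF eventually_at_right_less])
  have "(g \<longlongrightarrow> \<beta> / q * (real (card V) * max (c * 0 powr r) (16 * 0))) (at_right 0)" unfolding g_def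
    by (intro tendsto_mult tendsto_max tendsto_const tendsto_ident_at pw)
  then have eg: "\<forall>\<^sub>F s in at_right 0. g s < 1/4" using c by (intro order_tendstoD(2)) auto
  have "\<forall>\<^sub>F s in at_right 0. f s < 1/4 \<and> g s < 1/4" using ef eg by (rule eventually_conj)
  then obtain b where b: "0 < b" "\<And>s. 0 < s \<Longrightarrow> s < b \<Longrightarrow> f s < 1/4 \<and> g s < 1/4"
    unfolding eventually_at_right_field by auto
  define s0 where "s0 = min (b / 2) (min eps (1/4))"
  have s0: "0 < s0" "s0 < b" "s0 \<le> eps" "4 * s0 \<le> 1" using b eps unfolding s0_def by auto
  have "0 \<le> E V u" if u: "u \<in> H1_mass eps \<mu>" and \<mu>: "0 < \<mu>" "\<mu> \<le> s0\<^sup>2" for u \<mu>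
  proof -
    note uH = H1_massD(1)[OF u] and um = H1_massD(2)[OF u]
    define s where "s = sqrt \<mu>"
    have s: "0 < s" "s \<le> s0" "\<mu> = s\<^sup>2" unfolding s_def using \<mu> s0 real_sqrt_le_mono[OF \<mu>(2)] by auto
    have fg: "f s < 1/4" "g s < 1/4" using b(2)[of s] s s0 by auto
    have m: "0 < mass u" "sqrt (mass u) \<le> eps" "4 * sqrt (mass u) \<le> 1" unfolding um s_def[symmetric] using s s0 \<mu> by auto
    have D0: "0 \<le> D u" by (rule dirichlet_nonneg)
    have "\<alpha> / p * Lr_pow eps p u \<le> \<alpha> / p * (max (1152 * eps\<^sup>2 * s) (16 * s\<^sup>2) * D u)"
      using Lp_le_small_mass[OF p4 uH m] \<alpha> p s(1) unfolding um s_def[symmetric] s(3) by (intro mult_left_mono) auto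
    also have "\<dots> = f s * D u" unfolding f_def by simp
    also have "\<dots> \<le> 1/4 * D u" using fg D0 by (intro mult_right_mono) auto
    finally have 1: "\<alpha> / p * Lr_pow eps p u \<le> 1/4 * D u" .
    have "Q V u \<le> (\<Sum>z\<in>V. max (c * s powr r) (16 * s) * D u)"
      using vx[OF uH m] unfolding um s_def[symmetric] by (intro sum_mono)
    then have "\<beta> / q * Q V u \<le> \<beta> / q * (real (card V) * (max (c * s powr r) (16 * s) * D u))"
      using \<beta> q by (intro mult_left_mono) auto
    also have "\<dots> = g s * D u" unfolding g_def by simp
    also have "\<dots> \<le> 1/4 * D u" using fg D0 by (intro mult_right_mono) auto
    finally have 2: "\<beta> / q * Q V u \<le> 1/4 * D u" .
    show ?thesis unfolding E_def using 1 2 by linarith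
  qed
  then show ?thesis using s0(1) by (intro exI[of _ "s0\<^sup>2"]) auto
qed

section \<open>The sign of the level as the mass varies\<close>

lemma L_neg_if_E_neg:
  assumes V: "finite V" and u: "u \<in> H1 eps" "0 < mass u" "mass u \<le> \<mu>" and E: "E V u < 0"
  shows "L V \<mu> < 0"
proof -
  have "mass u / \<mu> * L V \<mu> \<le> E V u" by (rule E_ge_mass_fraction(1)[OF V u])
  then have "mass u / \<mu> * L V \<mu> < 0" using E by simp
  moreover have "0 \<le> mass u / \<mu> * L V \<mu>" if "0 \<le> L V \<mu>" using that u by (intro mult_nonneg_nonneg) auto
  ultimately show ?thesis by linarith
qed

lemma obtain_E_neg:
  assumes \<mu>: "0 < \<mu>" and "L V \<mu> < 0"
  obtains u where "u \<in> H1_mass eps \<mu>" "E V u < 0"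
proof -
  have "\<not> (\<forall>u\<in>H1_mass eps \<mu>. 0 \<le> E V u)"
    using cINF_greatest[OF H1_mass_nonempty[OF \<mu>], of 0 "E V"] assms(2) unfolding ground_level_def by force
  with that show ?thesis by force
qed

text \<open>A fixed tent is taken with large amplitude: the p-term grows faster than the square of
  the amplitude.\<close>

lemma L_neg_large_mass:
  assumes V: "finite V" shows "\<exists>\<mu>>0. L V \<mu> < 0"
proof -
  note T = tent_estimates[OF eps zero_less_one, of p]
  define P where "P = \<alpha> / p * (2 * eps * (1/2) powr p)"
  have P: "0 < P" unfolding P_def using \<alpha> p eps by simp
  \<comment> \<open>Chosen so that the bound on the energy becomes exactly \<open>- P\<close> times
    \<open>a\<close> squared.\<close>
  define a where "a = (11 / (2 * eps) / P + 1) powr (1 / (p - 2))"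
  have B: "0 < 11 / (2 * eps) / P + 1" using eps P by (intro add_nonneg_pos divide_nonneg_nonneg) auto
  have a: "0 < a" and ap2: "a powr (p - 2) = 11 / (2 * eps) / P + 1"
    unfolding a_def using p B by (auto simp: powr_powr)
  let ?u = "\<lambda>x. a * tent eps (4 * 1) x"
  have TH: "tent eps (4 * 1) \<in> H1 eps" "eps / 2 \<le> mass (tent eps (4 * 1))" using T(1,2) p by auto
  note ap = powr_extract_square[OF a, of p]
  have "E V ?u \<le> a\<^sup>2 * (11 / (2 * eps)) - \<alpha> / p * (a powr p * (2 * (real 1)\<^sup>2 * eps * (1/2) powr p))"
    by (rule E_tent_le) (use a in auto)
  also have "\<dots> = a\<^sup>2 * (11 / (2 * eps) - P * a powr (p - 2))" unfolding ap P_def by (simp add: algebra_simps)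
  also have "P * a powr (p - 2) = 11 / (2 * eps) + P" unfolding ap2 using P by (simp add: distrib_left)
  also have "a\<^sup>2 * (11 / (2 * eps) - (11 / (2 * eps) + P)) < 0" using a P by simp
  finally have "E V ?u < 0" .
  moreover have "mass ?u = a\<^sup>2 * mass (tent eps (4 * 1))" by (rule H1_scale(2)[OF eps0 TH(1)])
  then have "0 < mass ?u" using a TH(2) eps by (smt (verit) half_gt_zero mult_pos_pos zero_less_power)
  ultimately show ?thesis using L_neg_if_E_neg[OF V H1_scale(1)[OF eps0 TH(1)] _ order_refl] by blast
qed

text \<open>Negativity of the level passes to larger masses, so the masses with level zero form an
  interval, nonempty by the small mass estimate and bounded by large amplitudes; the critical mass
  is its supremum.\<close>

lemma critical_mass:
  assumes V: "finite V" and p4: "4 \<le> p"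
  shows "\<exists>\<mu>b>0. (\<forall>\<mu>. 0 < \<mu> \<and> \<mu> \<le> \<mu>b \<longrightarrow> L V \<mu> = 0) \<and> (\<forall>\<mu>>\<mu>b. L V \<mu> < 0) \<and>
    (\<forall>\<mu>>\<mu>b. \<exists>u. ground_state p q \<alpha> \<beta> eps V \<mu> u) \<and>
    (\<forall>\<mu>. 0 < \<mu> \<and> \<mu> < \<mu>b \<longrightarrow> \<not> (\<exists>u. ground_state p q \<alpha> \<beta> eps V \<mu> u))"
proof -
  have mono: "L V \<mu>' < 0" if \<mu>: "0 < \<mu>" "\<mu> \<le> \<mu>'" "L V \<mu> < 0" for \<mu> \<mu>'
  proof -
    obtain u where u: "u \<in> H1_mass eps \<mu>" "E V u < 0" by (rule obtain_E_neg[OF \<mu>(1,3)])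
    show ?thesis using L_neg_if_E_neg[OF V H1_massD(1)[OF u(1)] _ _ u(2)] H1_massD(2)[OF u(1)] \<mu> by simp
  qed
  define Z where "Z = {\<mu>. 0 < \<mu> \<and> L V \<mu> = 0}"
  obtain \<mu>0 where \<mu>0: "0 < \<mu>0" "\<And>\<mu> u. 0 < \<mu> \<Longrightarrow> \<mu> \<le> \<mu>0 \<Longrightarrow> u \<in> H1_mass eps \<mu> \<Longrightarrow> 0 \<le> E V u"
    using E_nonneg_small_mass[OF V p4] by blast
  have small: "\<mu>0 \<in> Z"
  proof -
    have "0 \<le> L V \<mu>0" unfolding ground_level_def
      using \<mu>0 by (intro cINF_greatest H1_mass_nonempty) auto
    then show ?thesis using L_nonpos[OF V \<mu>0(1)] \<mu>0(1) by (simp add: Z_def)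
  qed
  obtain \<mu>1 where \<mu>1: "0 < \<mu>1" "L V \<mu>1 < 0" using L_neg_large_mass[OF V] by blast
  have Zle: "\<mu> \<le> \<mu>1" if Z: "\<mu> \<in> Z" for \<mu>
  proof (rule ccontr)
    assume "\<not> ?thesis"
    then have "L V \<mu> < 0" by (intro mono[OF \<mu>1(1) _ \<mu>1(2)]) simp
    then show False using Z by (simp add: Z_def)
  qed
  have bdd: "bdd_above Z" using Zle by (rule bdd_aboveI)
  define \<mu>b where "\<mu>b = Sup Z"
  have pos: "0 < \<mu>b" using cSup_upper[OF small bdd] \<mu>0(1) unfolding \<mu>b_def by simp
  have neg: "L V \<mu> < 0" if "\<mu> > \<mu>b" for \<mu>
  proof -
    have "\<mu> \<notin> Z" using cSup_upper[OF _ bdd, of \<mu>] that unfolding \<mu>b_def by auto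
    then show ?thesis using L_nonpos[OF V, of \<mu>] that pos by (auto simp: Z_def)
  qed
  have zero_less: "L V \<mu> = 0" if \<mu>: "0 < \<mu>" "\<mu> < \<mu>b" for \<mu>
  proof -
    obtain \<nu> where "\<nu> \<in> Z" "\<mu> < \<nu>" using \<mu>(2) less_cSupD[of Z \<mu>] small unfolding \<mu>b_def by blast
    then have "\<not> L V \<mu> < 0" using mono[OF \<mu>(1), of \<nu>] by (auto simp: Z_def)
    then show ?thesis using L_nonpos[OF V \<mu>(1)] by simp
  qed
  \<comment> \<open>The supremum belongs to the interval: a function of negative energy at
    \<open>\<mu>b\<close>, multiplied by a factor slightly below 1, keeps negative energy by
    continuity and contradicts level zero at smaller masses.\<close>
  have zero_b: "L V \<mu>b = 0"
  proof (rule ccontr)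
    assume "\<not> ?thesis"
    then have "L V \<mu>b < 0" using L_nonpos[OF V pos] by simp
    then obtain u where u: "u \<in> H1_mass eps \<mu>b" "E V u < 0" using obtain_E_neg[OF pos] by blast
    note uH = H1_massD(1)[OF u(1)]
    have "((\<lambda>a. a\<^sup>2 * D u / 2 - \<alpha> / p * (a powr p * Lr_pow eps p u) - \<beta> / q * (a powr q * Q V u)) \<longlongrightarrow>
        1\<^sup>2 * D u / 2 - \<alpha> / p * (1 powr p * Lr_pow eps p u) - \<beta> / q * (1 powr q * Q V u)) (at_left 1)"
      by (intro tendsto_intros) auto
    also have "1\<^sup>2 * D u / 2 - \<alpha> / p * (1 powr p * Lr_pow eps p u) - \<beta> / q * (1 powr q * Q V u) = E V u" by (simp add: E_def)
    finally have "\<forall>\<^sub>F a in at_left 1. a\<^sup>2 * D u / 2 - \<alpha> / p * (a powr p * Lr_pow eps p u) - \<beta> / q * (a powr q * Q V u) < 0"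
      using u(2) by (intro order_tendstoD(2)) auto
    moreover have "\<forall>\<^sub>F a in at_left (1::real). 0 < a" "\<forall>\<^sub>F a in at_left (1::real). a < 1"
      using eventually_at_left_real[of 0 "1::real"] by (auto elim: eventually_mono)
    ultimately have "\<forall>\<^sub>F a in at_left 1. E V (\<lambda>x. a * u x) < 0 \<and> 0 < a \<and> a < 1"
    proof eventually_elim
      case (elim a)
      then show ?case using E_scale[OF uH, of a V] by simp
    qed
    then obtain a where a: "E V (\<lambda>x. a * u x) < 0" "0 < a" "a < 1"
      using eventually_happens'[OF trivial_limit_at_left_real] by blast
    have m: "mass (\<lambda>x. a * u x) = a\<^sup>2 * \<mu>b" using H1_scale(2)[OF eps0 uH, of a] H1_massD(2)[OF u(1)] by simp
    have "a\<^sup>2 < 1" using a by (simp add: power_less_one_iff abs_square_less_1)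
    then have "a\<^sup>2 * \<mu>b < \<mu>b" using pos by simp
    moreover have "0 < a\<^sup>2 * \<mu>b" using a pos by simp
    moreover have "L V (a\<^sup>2 * \<mu>b) < 0"
      using L_neg_if_E_neg[OF V H1_scale(1)[OF eps0 uH, of a] _ _ a(1), of "a\<^sup>2 * \<mu>b"] m \<open>0 < a\<^sup>2 * \<mu>b\<close> by simp
    ultimately show False using zero_less[of "a\<^sup>2 * \<mu>b"] by simp
  qed
  \<comment> \<open>A ground state would have energy zero, but the strict comparison with the level
    zero at \<open>\<mu>b\<close> makes its energy positive.\<close>
  have no_gs: "\<not> (\<exists>u. ground_state p q \<alpha> \<beta> eps V \<mu> u)" if \<mu>: "0 < \<mu>" "\<mu> < \<mu>b" for \<mu>
  proof
    assume "\<exists>u. ground_state p q \<alpha> \<beta> eps V \<mu> u"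
    then obtain u where u: "u \<in> H1_mass eps \<mu>" "E V u = 0" unfolding ground_state_def using zero_less[OF \<mu>] by auto
    have "mass u / \<mu>b * L V \<mu>b < E V u"
      by (rule E_ge_mass_fraction(2)[OF V H1_massD(1)[OF u(1)]]) (use H1_massD(2)[OF u(1)] \<mu> in auto)
    then show False using zero_b u(2) by simp
  qed
  have "L V \<mu> = 0" if "0 < \<mu>" "\<mu> \<le> \<mu>b" for \<mu> using that zero_less[of \<mu>] zero_b by (cases "\<mu> = \<mu>b") auto
  moreover have "\<exists>u. ground_state p q \<alpha> \<beta> eps V \<mu> u" if "\<mu> > \<mu>b" for \<mu>
    using that pos by (intro ground_state_exists V neg H1_mass_nonempty) auto
  ultimately show ?thesis using pos neg no_gs by blast
qed

end

theorem theorem1p1: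
  fixes p q \<alpha> \<beta> eps :: real and V :: "(int \<times> int) set"
  assumes "2 < p" "p < 6" "2 < q" "q < 4" "\<alpha> > 0" "\<beta> > 0" "eps > 0" "finite V"
  shows "(p < 4 \<longrightarrow>
            (\<forall>\<mu>>0. ground_level p q \<alpha> \<beta> eps V \<mu> < 0 \<and>
                    (\<exists>u. ground_state p q \<alpha> \<beta> eps V \<mu> u)))
       \<and> (4 \<le> p \<longrightarrow>
            (\<exists>\<mu>bar>0.
               (\<forall>\<mu>. 0 < \<mu> \<and> \<mu> \<le> \<mu>bar \<longrightarrow> ground_level p q \<alpha> \<beta> eps V \<mu> = 0) \<and>
               (\<forall>\<mu>>\<mu>bar. ground_level p q \<alpha> \<beta> eps V \<mu> < 0) \<and>
               (\<forall>\<mu>>\<mu>bar. \<exists>u. ground_state p q \<alpha> \<beta> eps V \<mu> u) \<and>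
               (\<forall>\<mu>. 0 < \<mu> \<and> \<mu> < \<mu>bar \<longrightarrow> \<not> (\<exists>u. ground_state p q \<alpha> \<beta> eps V \<mu> u))))"
proof -
  interpret grid_nls p q \<alpha> \<beta> eps using assms by unfold_locales auto
  note V = \<open>finite V\<close>
  show ?thesis
    using L_neg_subcritical[OF V] ground_state_exists[OF V] H1_mass_nonempty critical_mass[OF V] by simp
qed

end
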